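(* Let $c>0$, $b\ge0$, $T>0$. Let $\alpha_h\in C^1([0,T];V_h)$ satisfy $\alpha_0\le\alpha_h(x,t)\le\alpha_1$ on $\overline\Omega\times[0,T]$ for constants $\alpha_0,\alpha_1>0$ independent of the discretization parameters, and assume there is $\gamma\in(0,1)$ with $$\|\dot\alpha_h/\alpha_h\|_{L^1(0,T;L^\infty(\Omega))}=\int_0^T\sup_{x\in\Omega}\Big|\frac{\dot\alpha_h(x,t)}{\alpha_h(x,t)}\Big|\,dt\le\gamma .$$ Let $\psi_{0,h},\psi_{1,h}\in V_h$. Then, provided the penalty parameter $\beta$ in $\chi$ is sufficiently large, the linear semi-discrete problem: find $\psi_h\in C^2([0,T];V_h)$ with $$(\alpha_h\ddot\psi_h,v_h)_{L^2(\Omega)}+a_h(\tilde\psi_h,v_h)=0\quad\forall v_h\in V_h,\ t\in(0,T],\qquad (\psi_h(0),\dot\psi_h(0))=(\psi_{0,h},\psi_{1,h}),$$ has a unique solution, and it satisfies $$\max_{t\in[0,T]}E[\psi_h](t)\le C\,E[\psi_h](0),$$ where $C>0$ does not depend on the mesh size, the number of faces of a mesh element, or on $c,b$, but may depend on the polynomial degree $p$ (and on $\gamma$).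
   Context: Let $\Omega\subset\mathbb{R}^d$, $d\in\{2,3\}$, be a bounded convex polygonal/polyhedral domain, and let $\mathcal{T}_h$ be a member of a family of meshes of $\Omega$ consisting of disjoint open polygonal/polyhedral elements $\kappa$ of diameter $h_\kappa$. Mesh assumptions (constants uniform over the family): $h_\kappa^d\ge|\kappa|\ge C h_\kappa^d$; every $\kappa$ admits a sub-triangulation into at most $m$ (fixed) shape-regular simplices $\mathtt{s}_i$ with $|\mathtt{s}_i|\ge C|\kappa|$; $\max_\kappa h_\kappa/\min_\kappa h_\kappa\le C$. Faces: intersections of $(d-1)$-dimensional facets of neighboring elements or with $\partial\Omega$ (in 3D subdivided into co-planar triangles); $\mathcal{F}_h=\mathcal{F}_h^i\cup\mathcal{F}_h^b$ (interior/boundary faces). For an integer $p\ge1$, $V_h=\{v\in L^2(\Omega): v|_\kappa\in\mathcal{P}_p(\kappa)\ \forall\kappa\}$ ($\mathcal P_p$: polynomials of total degree $\le p$); $\nabla_h$ is the broken gradient. On interior $F\subset\partial\kappa^+\cap\partial\kappa^-$: $\llbracket w\rrbracket=w^+\mathbf{n}^++w^-\mathbf{n}^-$ (for vectors with a dot product), $\{\!\{w\}\!\}=(w^++w^-)/2$ (traces $w^\pm$ from $\kappa^\pm$, outward normals $\mathbf n^\pm$); on boundary faces $\llbracket w\rrbracket=w\mathbf{n}$, $\{\!\{w\}\!\}=w$. Stabilization: $\chi|_F=c^2\beta\max_{\kappa\in\{\kappa^\pm\}}p^2/h_\kappa$ on interior faces, $\chi|_F=c^2\beta p^2/h_\kappa$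 on boundary faces $F\subset\partial\kappa$, with $\beta>0$. $\langle\psi,v\rangle_{\mathcal{F}}=\sum_{F\in\mathcal{F}}(\psi,v)_{L^2(F)}$, $\|\psi\|_{\mathcal F}=\langle\psi,\psi\rangle_{\mathcal F}^{1/2}$. DG bilinear form: $a_h(\psi,v_h)=c^2(\nabla_h\psi,\nabla_hv_h)_{L^2}-\langle\{\!\{c^2\nabla_h\psi\}\!\},\llbracket v_h\rrbracket\rangle_{\mathcal{F}_h}-\langle\llbracket\psi\rrbracket,\{\!\{c^2\nabla_hv_h\}\!\}\rangle_{\mathcal{F}_h}+\langle\chi\llbracket\psi\rrbracket,\llbracket v_h\rrbracket\rangle_{\mathcal{F}_h}$. Notation: $\tilde\psi_h=\psi_h+\frac{b}{c^2}\dot\psi_h$ (dots denote time derivatives). Discrete energy: $E[\psi_h](t)=\|\sqrt{\alpha_h(t)}\dot\psi_h(t)\|_{L^2}^2+\frac{b}{c^2}\int_0^t\|\sqrt{\alpha_h}\ddot\psi_h\|_{L^2}^2ds+c^2\|\nabla_h\tilde\psi_h(t)\|_{L^2}^2+\|\sqrt\chi\llbracket\tilde\psi_h(t)\rrbracket\|_{\mathcal{F}_h}^2.$ *)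

theory Defs
  imports "HOL-Analysis.Analysis"
begin

definition hausdorff_const :: "real \<Rightarrow> real" where
  "hausdorff_const s = pi powr (s / 2) / Gamma (s / 2 + 1)"

definition hausdorff_outer :: "real \<Rightarrow> 'a::metric_space set \<Rightarrow> ennreal" where
  "hausdorff_outer s A =
     (SUP \<delta>\<in>{0::real<..}.
        INF C\<in>{C :: nat \<Rightarrow> 'a set. A \<subseteq> (\<Union>i. C i) \<and> (\<forall>i. bounded (C i) \<and> diameter (C i) < \<delta>)}.
          (\<Sum>i. ennreal (hausdorff_const s * (diameter (C i) / 2) powr s)))"

definition hausdorff_measure :: "real \<Rightarrow> 'a::metric_space measure" where
  "hausdorff_measure s = measure_of UNIV (sets borel) (hausdorff_outer s)"

definition poly_le :: "nat \<Rightarrow> (real^'n \<Rightarrow> real) \<Rightarrow> bool" where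
  "poly_le p f \<longleftrightarrow> (\<exists>c :: ('n \<Rightarrow> nat) \<Rightarrow> real.
      \<forall>x. f x = (\<Sum>a\<in>{a :: 'n \<Rightarrow> nat. (\<Sum>i\<in>UNIV. a i) \<le> p}. c a * (\<Prod>i\<in>UNIV. (x $ i) ^ a i)))"

definition grad :: "(real^'n \<Rightarrow> real) \<Rightarrow> real^'n \<Rightarrow> real^'n" where
  "grad f x = (\<chi> i. frechet_derivative f (at x) (axis i 1))"

text \<open>Outward unit normal of an (open) element at a boundary point where the
  boundary is locally flat; 0 elsewhere (a set of surface measure zero).\<close>
definition onormal :: "(real^'n) set \<Rightarrow> real^'n \<Rightarrow> real^'n" where
  "onormal k x = (if \<exists>n. norm n = 1 \<and> (\<exists>e>0. ball x e \<inter> k = ball x e \<inter> {y. (y - x) \<bullet> n < 0})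
     then (SOME n. norm n = 1 \<and> (\<exists>e>0. ball x e \<inter> k = ball x e \<inter> {y. (y - x) \<bullet> n < 0}))
     else 0)"

definition shape_reg_simplex :: "real \<Rightarrow> (real^'n) set \<Rightarrow> bool" where
  "shape_reg_simplex \<rho> s \<longleftrightarrow> (int CARD('n)) simplex s \<and> (\<exists>z. ball z (\<rho> * diameter s) \<subseteq> s)"

definition admissible_mesh ::
  "(real^'n) set \<Rightarrow> real \<Rightarrow> nat \<Rightarrow> real \<Rightarrow> real \<Rightarrow> real \<Rightarrow> (real^'n) set set \<Rightarrow> bool" where
  "admissible_mesh Om Cv m Cs \<rho> Cq K \<longleftrightarrow>
     finite K \<and> K \<noteq> {} \<and>
     (\<forall>k\<in>K. open k \<and> k \<noteq> {} \<and> k \<subseteq> Om \<and> interior (closure k) = k) \<and>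
     (\<forall>k1\<in>K. \<forall>k2\<in>K. k1 \<noteq> k2 \<longrightarrow> k1 \<inter> k2 = {}) \<and>
     closure Om = (\<Union>k\<in>K. closure k) \<and>
     (\<forall>k\<in>K. diameter k ^ CARD('n) \<ge> measure lborel k \<and>
             measure lborel k \<ge> Cv * diameter k ^ CARD('n)) \<and>
     (\<forall>k\<in>K. \<exists>S. finite S \<and> card S \<le> m \<and> closure k = \<Union>S \<and>
             (\<forall>s\<in>S. shape_reg_simplex \<rho> s \<and> measure lborel s \<ge> Cs * measure lborel k) \<and>
             (\<forall>s1\<in>S. \<forall>s2\<in>S. s1 \<noteq> s2 \<longrightarrow> interior s1 \<inter> interior s2 = {})) \<and>
     (\<forall>k1\<in>K. \<forall>k2\<in>K. diameter k1 \<le> Cq * diameter k2)"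

text \<open>An element of V_h is represented elementwise: u k is the polynomial on element k.\<close>
definition Vh :: "nat \<Rightarrow> (real^'n) set set \<Rightarrow> ((real^'n) set \<Rightarrow> real^'n \<Rightarrow> real) \<Rightarrow> bool" where
  "Vh p K u \<longleftrightarrow> (\<forall>k\<in>K. poly_le p (u k))"

abbreviation surf :: "(real^'n) measure" where
  "surf \<equiv> hausdorff_measure (real CARD('n) - 1)"

text \<open>Sum over all mesh faces: interior faces are the common boundaries
  closure k1 \<inter> closure k2 (each unordered pair counted once via the factor 1/2),
  boundary faces are closure k \<inter> frontier Om.\<close>
definition face_sum ::
  "(real^'n) set \<Rightarrow> (real^'n) set set \<Rightarrow> ((real^'n) set \<Rightarrow> (real^'n) set \<Rightarrow> real^'n \<Rightarrow> real)
    \<Rightarrow> ((real^'n) set \<Rightarrow> real^'n \<Rightarrow> real) \<Rightarrow> real" where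
  "face_sum Om K fi fb =
     (\<Sum>(k1, k2)\<in>{(k1, k2). k1 \<in> K \<and> k2 \<in> K \<and> k1 \<noteq> k2}.
         set_lebesgue_integral surf (closure k1 \<inter> closure k2) (fi k1 k2) / 2)
     + (\<Sum>k\<in>K. set_lebesgue_integral surf (closure k \<inter> frontier Om) (fb k))"

definition jump :: "((real^'n) set \<Rightarrow> real^'n \<Rightarrow> real) \<Rightarrow> (real^'n) set \<Rightarrow> (real^'n) set \<Rightarrow> real^'n \<Rightarrow> real^'n" where
  "jump u k1 k2 x = u k1 x *\<^sub>R onormal k1 x + u k2 x *\<^sub>R onormal k2 x"

definition bjump :: "((real^'n) set \<Rightarrow> real^'n \<Rightarrow> real) \<Rightarrow> (real^'n) set \<Rightarrow> real^'n \<Rightarrow> real^'n" where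
  "bjump u k x = u k x *\<^sub>R onormal k x"

definition avg_grad :: "((real^'n) set \<Rightarrow> real^'n \<Rightarrow> real) \<Rightarrow> (real^'n) set \<Rightarrow> (real^'n) set \<Rightarrow> real^'n \<Rightarrow> real^'n" where
  "avg_grad u k1 k2 x = (1/2) *\<^sub>R (grad (u k1) x + grad (u k2) x)"

definition chi_int :: "real \<Rightarrow> real \<Rightarrow> nat \<Rightarrow> (real^'n) set \<Rightarrow> (real^'n) set \<Rightarrow> real" where
  "chi_int c \<beta> p k1 k2 = c^2 * \<beta> * max (real p ^ 2 / diameter k1) (real p ^ 2 / diameter k2)"

definition chi_bd :: "real \<Rightarrow> real \<Rightarrow> nat \<Rightarrow> (real^'n) set \<Rightarrow> real" where
  "chi_bd c \<beta> p k = c^2 * \<beta> * real p ^ 2 / diameter k"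

definition wip :: "(real^'n) set set \<Rightarrow> ((real^'n) set \<Rightarrow> real^'n \<Rightarrow> real)
    \<Rightarrow> ((real^'n) set \<Rightarrow> real^'n \<Rightarrow> real) \<Rightarrow> ((real^'n) set \<Rightarrow> real^'n \<Rightarrow> real) \<Rightarrow> real" where
  "wip K w u v = (\<Sum>k\<in>K. set_lebesgue_integral lborel k (\<lambda>x. w k x * u k x * v k x))"

definition grad_ip :: "(real^'n) set set \<Rightarrow> ((real^'n) set \<Rightarrow> real^'n \<Rightarrow> real)
    \<Rightarrow> ((real^'n) set \<Rightarrow> real^'n \<Rightarrow> real) \<Rightarrow> real" where
  "grad_ip K u v = (\<Sum>k\<in>K. set_lebesgue_integral lborel k (\<lambda>x. grad (u k) x \<bullet> grad (v k) x))"

definition ah :: "real \<Rightarrow> real \<Rightarrow> nat \<Rightarrow> (real^'n) set \<Rightarrow> (real^'n) set set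
    \<Rightarrow> ((real^'n) set \<Rightarrow> real^'n \<Rightarrow> real) \<Rightarrow> ((real^'n) set \<Rightarrow> real^'n \<Rightarrow> real) \<Rightarrow> real" where
  "ah c \<beta> p Om K u v =
     c^2 * grad_ip K u v
     - face_sum Om K (\<lambda>k1 k2 x. (c^2 *\<^sub>R avg_grad u k1 k2 x) \<bullet> jump v k1 k2 x)
                     (\<lambda>k x. (c^2 *\<^sub>R grad (u k) x) \<bullet> bjump v k x)
     - face_sum Om K (\<lambda>k1 k2 x. jump u k1 k2 x \<bullet> (c^2 *\<^sub>R avg_grad v k1 k2 x))
                     (\<lambda>k x. bjump u k x \<bullet> (c^2 *\<^sub>R grad (v k) x))
     + face_sum Om K (\<lambda>k1 k2 x. chi_int c \<beta> p k1 k2 * (jump u k1 k2 x \<bullet> jump v k1 k2 x))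
                     (\<lambda>k x. chi_bd c \<beta> p k * (bjump u k x \<bullet> bjump v k x))"

definition tder :: "real \<Rightarrow> (real \<Rightarrow> 'a \<Rightarrow> 'b \<Rightarrow> real) \<Rightarrow> real \<Rightarrow> 'a \<Rightarrow> 'b \<Rightarrow> real" where
  "tder T f t k x = vector_derivative (\<lambda>s. f s k x) (at t within {0..T})"

definition C1Vh :: "nat \<Rightarrow> (real^'n) set set \<Rightarrow> real \<Rightarrow> (real \<Rightarrow> (real^'n) set \<Rightarrow> real^'n \<Rightarrow> real) \<Rightarrow> bool" where
  "C1Vh p K T f \<longleftrightarrow>
     (\<forall>t\<in>{0..T}. Vh p K (f t)) \<and>
     (\<forall>k\<in>K. \<forall>x. \<forall>t\<in>{0..T}. ((\<lambda>s. f s k x) has_vector_derivative tder T f t k x) (at t within {0..T})) \<and>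
     (\<forall>k\<in>K. \<forall>x. continuous_on {0..T} (\<lambda>t. tder T f t k x)) \<and>
     (\<forall>t\<in>{0..T}. Vh p K (tder T f t))"

definition C2Vh :: "nat \<Rightarrow> (real^'n) set set \<Rightarrow> real \<Rightarrow> (real \<Rightarrow> (real^'n) set \<Rightarrow> real^'n \<Rightarrow> real) \<Rightarrow> bool" where
  "C2Vh p K T f \<longleftrightarrow> C1Vh p K T f \<and> C1Vh p K T (tder T f)"

definition tilde :: "real \<Rightarrow> real \<Rightarrow> real \<Rightarrow> (real \<Rightarrow> (real^'n) set \<Rightarrow> real^'n \<Rightarrow> real) \<Rightarrow> real \<Rightarrow> (real^'n) set \<Rightarrow> real^'n \<Rightarrow> real" where
  "tilde T b c psi t k x = psi t k x + b / c^2 * tder T psi t k x"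

definition is_solution ::
  "nat \<Rightarrow> (real^'n) set \<Rightarrow> (real^'n) set set \<Rightarrow> real \<Rightarrow> real \<Rightarrow> real \<Rightarrow> real
    \<Rightarrow> (real \<Rightarrow> (real^'n) set \<Rightarrow> real^'n \<Rightarrow> real)
    \<Rightarrow> ((real^'n) set \<Rightarrow> real^'n \<Rightarrow> real) \<Rightarrow> ((real^'n) set \<Rightarrow> real^'n \<Rightarrow> real)
    \<Rightarrow> (real \<Rightarrow> (real^'n) set \<Rightarrow> real^'n \<Rightarrow> real) \<Rightarrow> bool" where
  "is_solution p Om K c b \<beta> T al psi0 psi1 psi \<longleftrightarrow>
     C2Vh p K T psi \<and>
     (\<forall>t\<in>{0<..T}. \<forall>v. Vh p K v \<longrightarrow>
        wip K (al t) (tder T (tder T psi) t) v + ah c \<beta> p Om K (tilde T b c psi t) v = 0) \<and>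
     (\<forall>k\<in>K. psi 0 k = psi0 k \<and> tder T psi 0 k = psi1 k)"

definition energy ::
  "nat \<Rightarrow> (real^'n) set \<Rightarrow> (real^'n) set set \<Rightarrow> real \<Rightarrow> real \<Rightarrow> real \<Rightarrow> real
    \<Rightarrow> (real \<Rightarrow> (real^'n) set \<Rightarrow> real^'n \<Rightarrow> real)
    \<Rightarrow> (real \<Rightarrow> (real^'n) set \<Rightarrow> real^'n \<Rightarrow> real) \<Rightarrow> real \<Rightarrow> real" where
  "energy p Om K c b \<beta> T al psi t =
     wip K (al t) (tder T psi t) (tder T psi t)
     + b / c^2 * integral {0..t} (\<lambda>s. wip K (al s) (tder T (tder T psi) s) (tder T (tder T psi) s))
     + c^2 * grad_ip K (tilde T b c psi t) (tilde T b c psi t)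
     + face_sum Om K (\<lambda>k1 k2 x. chi_int c \<beta> p k1 k2 * (jump (tilde T b c psi t) k1 k2 x \<bullet> jump (tilde T b c psi t) k1 k2 x))
                     (\<lambda>k x. chi_bd c \<beta> p k * (bjump (tilde T b c psi t) k x \<bullet> bjump (tilde T b c psi t) k x))"

end

theory Submission
  imports Defs "HOL-Probability.Discrete_Topology"
begin

text \<open>Testing the equation with the time derivative of \<open>tilde\<close> (that is, of the combination of
  \<open>psi\<close> and its time derivative) shows that half of the weighted kinetic energy plus half of
  \<open>ah\<close> evaluated at \<open>tilde\<close> plus the dissipated energy grows only through the time derivative of the
  coefficient, whose relative size integrates to at most \<open>\<gamma> < 1\<close>; the supremum of this energy can
  therefore be absorbed. It is comparable to \<open>energy\<close> as soon as the penalty dominates the consistency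
  terms. For the latter only upper bounds on the surface measure are needed: the nearest-point
  projection onto a simplex maps the boundary of a cube onto the boundary of the simplex, which bounds
  the Hausdorff measure of element boundaries; combined with the equivalence of norms on polynomials
  and a packing bound for the number of neighbours this gives the trace estimate with constants that
  do not depend on the number of faces. Uniqueness is the energy estimate for the difference of two
  solutions, and existence is a linear ordinary differential equation for the coefficients, in which
  the mass matrix is inverted continuously in time.\<close>

section \<open>Linear systems and linear ordinary differential equations\<close>

text \<open>The surface measure is \<open>measure_of\<close> applied to an outer measure, and the
  only fact about it at hand is the upper bound
  \<open>emeasure (hausdorff_measure s) A \<le> hausdorff_outer s A\<close>. This shapes the
  argument: exact areas never occur, nor the claim that two faces of an element overlap in a null
  set. The consistency term is bounded by the supremum of the gradient times the size of the element
  boundary, and overlaps of faces are paid for by the number of neighbours. The count of faces does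
  not enter, because an element boundary is covered by the boundaries of at most \<open>m\<close>
  simplices. In \<open>cons_form_le\<close> the powers of the diameter cancel: one from the inverse
  penalty, d - 1 from the boundary, -d from the inverse estimate. The constant
  \<open>4 / (1 - \<gamma>)\<close> arises because \<open>ah\<close> lies between 1/2 and 3/2 of the
  squared mesh norm and the maximal energy is absorbed at the price of the factor
  \<open>1 - \<gamma>\<close>. A mesh function is constrained by \<open>Vh\<close> only on the
  elements of \<open>K\<close>, hence the many congruences restricted to
  \<open>k \<in> K\<close>.\<close>

text \<open>Gaussian elimination: one unknown is removed through its pivot \<open>M n n t\<close>,
  which is positive because the form can be tested with a unit vector. The Schur complement
  \<open>M'\<close> is again positive definite, and all denominators are continuous and positive, so
  continuity in \<open>t\<close> is preserved at every stage.\<close>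

lemma pd_system_solvable:
  fixes M :: "'i \<Rightarrow> 'i \<Rightarrow> 't::topological_space \<Rightarrow> real"
  assumes "finite I"
    and "\<And>i j. i \<in> I \<Longrightarrow> j \<in> I \<Longrightarrow> continuous_on S (M i j)"
    and "\<And>i. i \<in> I \<Longrightarrow> continuous_on S (f i)"
    and "\<And>t x. t \<in> S \<Longrightarrow> \<exists>i\<in>I. x i \<noteq> 0 \<Longrightarrow> 0 < (\<Sum>i\<in>I. \<Sum>j\<in>I. x i * M i j t * x j)"
  shows "\<exists>y. (\<forall>i\<in>I. continuous_on S (y i)) \<and> (\<forall>t\<in>S. \<forall>i\<in>I. (\<Sum>j\<in>I. M i j t * y j t) = f i t)"
  using assms
proof (induction I arbitrary: M f rule: finite_induct)
  case empty
  then show ?case by simp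
next
  case (insert n I)
  have piv: "M n n t > 0" if "t \<in> S" for t
  proof -
    have "0 < (\<Sum>i\<in>insert n I. \<Sum>j\<in>insert n I. of_bool (i = n) * M i j t * of_bool (j = n))"
      using insert.prems(3)[OF that, of "\<lambda>i. of_bool (i = n)"] by auto
    also have "\<dots> = (\<Sum>i\<in>insert n I. of_bool (i = n) * M i n t)"
      using insert.hyps by (intro sum.cong refl) (auto intro!: sum.neutral)
    also have "\<dots> = M n n t"
      using insert.hyps by (auto intro!: sum.neutral)
    finally show ?thesis .
  qed
  have cM: "continuous_on S (M i j)" if "i \<in> insert n I" "j \<in> insert n I" for i j
    using insert.prems(1) that by blast
  have cf: "continuous_on S (f i)" if "i \<in> insert n I" for i
    using insert.prems(2) that by blast
  define M' where "M' i j t = M i j t - M i n t * M n j t / M n n t" for i j t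
  define f' where "f' i t = f i t - M i n t * f n t / M n n t" for i t
  have "\<exists>y. (\<forall>i\<in>I. continuous_on S (y i)) \<and> (\<forall>t\<in>S. \<forall>i\<in>I. (\<Sum>j\<in>I. M' i j t * y j t) = f' i t)"
  proof (rule insert.IH)
    show "continuous_on S (M' i j)" if "i \<in> I" "j \<in> I" for i j
      unfolding M'_def using that piv by (intro continuous_intros cM) fastforce+
    show "continuous_on S (f' i)" if "i \<in> I" for i
      unfolding f'_def using that piv by (intro continuous_intros cM cf) fastforce+
    fix t and x :: "'i \<Rightarrow> real"
    assume t: "t \<in> S" and x: "\<exists>i\<in>I. x i \<noteq> 0"
    \<comment> \<open>This value makes row \<open>n\<close> of \<open>M\<close> annihilate
      \<open>z\<close>; what is left of the full form at \<open>z\<close> is the form of the Schur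
      complement at \<open>x\<close>, so positivity is inherited.\<close>
    define xn where "xn = - (\<Sum>j\<in>I. M n j t * x j) / M n n t"
    define z where "z = x(n := xn)"
    have z: "z n = xn" "\<And>i. i \<in> I \<Longrightarrow> z i = x i"
      using insert.hyps by (auto simp: z_def)
    have row: "(\<Sum>j\<in>insert n I. M n j t * z j) = 0"
      using insert.hyps piv[OF t] by (simp add: z xn_def)
    have row': "(\<Sum>j\<in>insert n I. M i j t * z j) = (\<Sum>j\<in>I. M' i j t * x j)" if "i \<in> I" for i
      using insert.hyps by (simp add: z xn_def M'_def left_diff_distrib right_diff_distrib sum_subtractf
          sum_distrib_left sum_divide_distrib divide_inverse mult_ac sum_negf)
    have "0 < (\<Sum>i\<in>insert n I. \<Sum>j\<in>insert n I. z i * M i j t * z j)"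
      using insert.prems(3)[OF t, of z] x z(2) by (metis insertI2)
    also have "\<dots> = (\<Sum>i\<in>insert n I. z i * (\<Sum>j\<in>insert n I. M i j t * z j))"
      by (simp only: sum_distrib_left mult.assoc)
    also have "\<dots> = (\<Sum>i\<in>I. z i * (\<Sum>j\<in>insert n I. M i j t * z j))"
      using insert.hyps row by simp
    also have "\<dots> = (\<Sum>i\<in>I. x i * (\<Sum>j\<in>I. M' i j t * x j))"
      by (intro sum.cong refl) (simp only: row' z)
    finally show "0 < (\<Sum>i\<in>I. \<Sum>j\<in>I. x i * M' i j t * x j)"
      by (simp only: sum_distrib_left mult.assoc)
  qed
  then obtain y where y: "\<And>i. i \<in> I \<Longrightarrow> continuous_on S (y i)"
    "\<And>t i. t \<in> S \<Longrightarrow> i \<in> I \<Longrightarrow> (\<Sum>j\<in>I. M' i j t * y j t) = f' i t" by blast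
  define yn where "yn t = (f n t - (\<Sum>j\<in>I. M n j t * y j t)) / M n n t" for t
  define z where "z = y(n := yn)"
  have z: "z n = yn" "\<And>i. i \<in> I \<Longrightarrow> z i = y i"
    using insert.hyps by (auto simp: z_def)
  have "continuous_on S yn"
    unfolding yn_def using piv by (intro continuous_intros cM cf y) fastforce+
  then have "\<forall>i\<in>insert n I. continuous_on S (z i)"
    using z y by auto
  moreover have "(\<Sum>j\<in>insert n I. M i j t * z j t) = f i t" if t: "t \<in> S" and i: "i \<in> insert n I" for t i
  proof (cases "i = n")
    case True
    then show ?thesis using insert.hyps piv[OF t] by (simp add: z yn_def)
  next
    case False
    then have iI: "i \<in> I" using i by simp
    have "(\<Sum>j\<in>insert n I. M i j t * z j t) = (\<Sum>j\<in>I. M' i j t * y j t) + M i n t * f n t / M n n t"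
      using insert.hyps by (simp add: z yn_def M'_def left_diff_distrib right_diff_distrib
          diff_divide_distrib sum_subtractf sum_distrib_left sum_divide_distrib divide_inverse mult_ac)
    also have "\<dots> = f i t" using y(2)[OF t iI] by (simp add: f'_def)
    finally show ?thesis .
  qed
  ultimately show ?case by blast
qed

lemma pd_system_solvable_const:
  fixes M :: "'i \<Rightarrow> 'i \<Rightarrow> real"
  assumes "finite I" and "\<And>x. \<exists>i\<in>I. x i \<noteq> 0 \<Longrightarrow> 0 < (\<Sum>i\<in>I. \<Sum>j\<in>I. x i * M i j * x j)"
  shows "\<exists>y. \<forall>i\<in>I. (\<Sum>j\<in>I. M i j * y j) = f i"
proof -
  have "\<exists>y. (\<forall>i\<in>I. continuous_on {0::real} (y i)) \<and>
      (\<forall>t\<in>{0::real}. \<forall>i\<in>I. (\<Sum>j\<in>I. M i j * y j t) = f i)"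
    by (rule pd_system_solvable) (use assms in auto)
  then obtain y where "(\<forall>i\<in>I. continuous_on {0::real} (y i)) \<and>
      (\<forall>t\<in>{0::real}. \<forall>i\<in>I. (\<Sum>j\<in>I. M i j * y j t) = f i)" ..
  then show ?thesis by (intro exI[of _ "\<lambda>j. y j 0"]) simp
qed

text \<open>With the unknown \<open>z t = exp (- \<lambda> * t) * y t\<close> the Picard operator is a contraction on all of
  \<open>{0..T}\<close>. A vector-valued function is treated as a scalar one on the product with the discrete index
  space, so that the Banach space needs no type that depends on the dimension.\<close>

lemma linear_ode_solvable:
  fixes A :: "'i \<Rightarrow> 'i \<Rightarrow> real \<Rightarrow> real" and y0 :: "'i \<Rightarrow> real"
  assumes T: "T > 0" and I: "finite I"
    and A: "\<And>i j. i \<in> I \<Longrightarrow> j \<in> I \<Longrightarrow> continuous_on {0..T} (A i j)"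
  shows "\<exists>y. \<forall>i\<in>I. y i 0 = y0 i \<and>
      (\<forall>t\<in>{0..T}. (y i has_vector_derivative (\<Sum>j\<in>I. A i j t * y j t)) (at t within {0..T}))"
proof -
  have "\<exists>L>0. \<forall>i\<in>I. \<forall>j\<in>I. \<forall>t\<in>{0..T}. \<bar>A i j t\<bar> \<le> L"
  proof -
    have "\<exists>B. i \<in> I \<longrightarrow> j \<in> I \<longrightarrow> (\<forall>t\<in>{0..T}. \<bar>A i j t\<bar> \<le> B)" for i j
      using compact_imp_bounded[OF compact_continuous_image[OF A[of i j] compact_Icc]]
      by (auto simp: bounded_iff)
    then obtain B where B: "\<And>i j t. i \<in> I \<Longrightarrow> j \<in> I \<Longrightarrow> t \<in> {0..T} \<Longrightarrow> \<bar>A i j t\<bar> \<le> B i j" by metis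
    define L where "L = 1 + (\<Sum>i\<in>I. \<Sum>j\<in>I. \<bar>B i j\<bar>)"
    have "\<bar>A i j t\<bar> \<le> L" if "i \<in> I" "j \<in> I" "t \<in> {0..T}" for i j t
    proof -
      have "\<bar>A i j t\<bar> \<le> \<bar>B i j\<bar>" using B[OF that] by linarith
      also have "\<dots> \<le> (\<Sum>j\<in>I. \<bar>B i j\<bar>)" using that I by (intro member_le_sum) auto
      also have "\<dots> \<le> (\<Sum>i\<in>I. \<Sum>j\<in>I. \<bar>B i j\<bar>)"
        using that I by (intro member_le_sum[of i "I" "\<lambda>i. \<Sum>j\<in>I. \<bar>B i j\<bar>"]) (auto intro: sum_nonneg)
      finally show ?thesis by (simp add: L_def)
    qed
    moreover have "L > 0" unfolding L_def by (intro add_pos_nonneg sum_nonneg) auto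
    ultimately show ?thesis by blast
  qed
  then obtain L where L: "L > 0" "\<And>i j t. i \<in> I \<Longrightarrow> j \<in> I \<Longrightarrow> t \<in> {0..T} \<Longrightarrow> \<bar>A i j t\<bar> \<le> L"
    by blast
  \<comment> \<open>The weighted integral of \<open>exp (lam * s)\<close> gains a factor
    \<open>1 / lam\<close>, so the contraction factor is \<open>card I * L / lam\<close>, at most
    1/2. The added 1 keeps \<open>lam\<close> positive when \<open>I\<close> is empty.\<close>
  define lam where "lam = 2 * (real (card I) * L) + 1"
  have lam: "lam > 0" using L by (simp add: lam_def add_nonneg_pos)
  \<comment> \<open>Time is clamped to \<open>{0..T}\<close>, so that the iterates are bounded
    continuous functions on the whole line.\<close>
  define cl where "cl t = max 0 (min T t)" for t :: real
  have cl: "cl t \<in> {0..T}" "t \<in> {0..T} \<Longrightarrow> cl t = t" for t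
    using T by (auto simp: cl_def)
  have ccl: "continuous_on UNIV cl"
    unfolding cl_def by (intro continuous_intros)
  define h where "h z i s = exp (lam * s) * (\<Sum>j\<in>I. A i j s * apply_bcontfun z (s, discrete j))"
    for z :: "(real \<times> 'i discrete) \<Rightarrow>\<^sub>C real" and i s
  have ch: "continuous_on {0..T} (h z i)" if "i \<in> I" for z i
  proof -
    have "continuous_on {0..T} (\<lambda>s. apply_bcontfun z (s, discrete j))" for j
    proof (rule continuous_on_compose2[of UNIV "apply_bcontfun z"])
      show "continuous_on UNIV (apply_bcontfun z)" by (rule continuous_on_apply_bcontfun)
    qed (auto intro!: continuous_intros)
    then show ?thesis
      unfolding h_def by (intro continuous_intros A that)
  qed
  \<comment> \<open>Components outside \<open>I\<close> are set to 0; since \<open>I\<close> is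
    finite, this keeps \<open>F z\<close> bounded even if the index type is infinite.\<close>
  define F where "F z = (\<lambda>(t, d). let i = of_discrete d in if i \<in> I then exp (- lam * cl t) * (y0 i + integral {0..cl t} (h z i)) else 0)"
    for z :: "(real \<times> 'i discrete) \<Rightarrow>\<^sub>C real"
  have cF: "F z \<in> bcontfun" for z
  proof -
    have cint: "continuous_on {0..T} (\<lambda>t. exp (- lam * t) * (y0 i + integral {0..t} (h z i)))" if "i \<in> I" for i
      by (intro continuous_intros indefinite_integral_continuous_1 integrable_continuous_real ch[OF that])
    have c1: "continuous_on UNIV (\<lambda>t. F z (t, d))" for d
    proof (cases "of_discrete d \<in> I")
      case True
      have "continuous_on UNIV (\<lambda>t. exp (- lam * cl t) * (y0 (of_discrete d) + integral {0..cl t} (h z (of_discrete d))))"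
        by (rule continuous_on_compose2[OF cint[OF True] ccl]) (use cl in auto)
      then show ?thesis using True by (simp add: F_def Let_def)
    qed (simp add: F_def Let_def)
    have "continuous_on UNIV (F z)"
    proof -
      have "isCont (F z) (t, i)" for t i
      proof -
        have "continuous_on (UNIV \<times> {i}) (F z)"
        proof -
          have "continuous_on (UNIV \<times> {i}) (\<lambda>u. F z (fst u, i))"
            by (rule continuous_on_compose2[OF c1[of i]]) (auto intro: continuous_intros)
          then show ?thesis by (rule continuous_on_eq) auto
        qed
        \<comment> \<open>The sheet over a single index is open in the product with a discrete
          space, so continuity in \<open>t\<close> alone gives joint continuity.\<close>
        moreover have "open (UNIV \<times> {i} :: (real \<times> 'i discrete) set)"
          by (intro open_Times) (auto simp: Discrete_Topology.open_discrete)
        ultimately show ?thesis by (simp add: continuous_on_eq_continuous_at)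
      qed
      then show ?thesis by (auto intro: continuous_at_imp_continuous_on)
    qed
    moreover have "bounded (range (F z))"
    proof -
      have "range (F z) \<subseteq> {0} \<union> (\<Union>i\<in>I. (\<lambda>t. exp (- lam * t) * (y0 i + integral {0..t} (h z i))) ` {0..T})"
      proof
        fix v assume "v \<in> range (F z)"
        then obtain t d where v: "v = F z (t, d)" by auto
        define i where "i = of_discrete d"
        show "v \<in> {0} \<union> (\<Union>i\<in>I. (\<lambda>t. exp (- lam * t) * (y0 i + integral {0..t} (h z i))) ` {0..T})"
        proof (cases "i \<in> I")
          case True
          then show ?thesis unfolding v F_def using cl(1)[of t]
            by (intro UnI2 UN_I[of i] image_eqI[of _ _ "cl t"]) (auto simp: i_def Let_def)
        qed (simp add: v F_def i_def Let_def)
      qed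
      moreover have "bounded \<dots>"
        by (intro bounded_Un[THEN iffD2] conjI bounded_UN I ballI
            compact_imp_bounded compact_continuous_image cint compact_Icc) auto
      ultimately show ?thesis by (rule bounded_subset[rotated])
    qed
    ultimately show ?thesis by (simp add: bcontfun_def)
  qed
  define P where "P z = Bcontfun (F z)" for z
  have P: "apply_bcontfun (P z) = F z" for z
    unfolding P_def using cF by (rule Bcontfun_inverse)
  have contr: "dist (P z) (P w) \<le> 1/2 * dist z w" for z w
  proof (rule dist_bound)
    fix u :: "real \<times> 'i discrete"
    obtain t d where td: "u = (t, d)" by (cases u)
    define i where "i = of_discrete d"
    have u: "u = (t, discrete i)" by (simp add: td i_def of_discrete_inverse)
    show "dist (apply_bcontfun (P z) u) (apply_bcontfun (P w) u) \<le> 1/2 * dist z w"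
    proof (cases "i \<in> I")
      case False
      then show ?thesis by (simp add: P F_def Let_def u discrete_inverse)
    next
      case True
      define D where "D = dist z w"
      let ?t = "cl t"
      have t: "?t \<in> {0..T}" by (rule cl)
      have int: "(h z i) integrable_on {0..?t}" for z
        using t by (intro integrable_continuous_real continuous_on_subset[OF ch[OF True]]) auto
      have hi: "((\<lambda>s. real (card I) * L * D * exp (lam * s)) has_integral
          (real (card I) * L * D * exp (lam * ?t) / lam - real (card I) * L * D * exp (lam * 0) / lam)) {0..?t}"
        using t lam by (intro fundamental_theorem_of_calculus)
          (auto intro!: derivative_eq_intros simp: has_real_derivative_iff_has_vector_derivative[symmetric])
      have ie: "integral {0..?t} (\<lambda>s. real (card I) * L * D * exp (lam * s))
          = real (card I) * L * D * (exp (lam * ?t) - 1) / lam"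
        unfolding integral_unique[OF hi] by (simp add: right_diff_distrib diff_divide_distrib)
      have ii: "(\<lambda>s. real (card I) * L * D * exp (lam * s)) integrable_on {0..?t}"
        using hi by (rule has_integral_integrable)
      have "norm (integral {0..?t} (\<lambda>s. h z i s - h w i s)) \<le> integral {0..?t} (\<lambda>s. real (card I) * L * D * exp (lam * s))"
      proof (rule integral_norm_bound_integral)
        show "(\<lambda>s. h z i s - h w i s) integrable_on {0..?t}" by (intro integrable_diff int)
        fix s assume s: "s \<in> {0..?t}"
        have "\<bar>\<Sum>j\<in>I. A i j s * (apply_bcontfun z (s, discrete j) - apply_bcontfun w (s, discrete j))\<bar> \<le> (\<Sum>j\<in>I. L * D)"
        proof (rule order_trans[OF sum_abs], rule sum_mono)
          fix j assume j: "j \<in> I"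
          show "\<bar>A i j s * (apply_bcontfun z (s, discrete j) - apply_bcontfun w (s, discrete j))\<bar> \<le> L * D"
            unfolding abs_mult using j s t True dist_bounded[of z "(s, discrete j)" w] L(1)
            by (intro mult_mono L) (auto simp: D_def dist_real_def)
        qed
        then have "exp (lam * s) * \<bar>\<Sum>j\<in>I. A i j s * (apply_bcontfun z (s, discrete j) - apply_bcontfun w (s, discrete j))\<bar>
            \<le> exp (lam * s) * (real (card I) * L * D)" by (intro mult_left_mono) auto
        then show "norm (h z i s - h w i s) \<le> real (card I) * L * D * exp (lam * s)"
          by (simp add: h_def right_diff_distrib[symmetric] sum_subtractf[symmetric] abs_mult mult.commute)
      qed (use ii in simp)
      also have "\<dots> \<le> real (card I) * L * D * exp (lam * ?t) / lam"
        unfolding ie using lam L(1) by (intro divide_right_mono mult_left_mono) (auto simp: D_def)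
      finally have *: "\<bar>integral {0..?t} (h z i) - integral {0..?t} (h w i)\<bar> \<le> real (card I) * L * D * exp (lam * ?t) / lam"
        by (simp add: integral_diff int)
      have "dist (F z u) (F w u) = exp (- lam * ?t) * \<bar>integral {0..?t} (h z i) - integral {0..?t} (h w i)\<bar>"
        using True by (simp add: F_def Let_def u discrete_inverse dist_real_def right_diff_distrib[symmetric] abs_mult)
      also have "\<dots> \<le> exp (- lam * ?t) * (real (card I) * L * D * exp (lam * ?t) / lam)"
        using * by (intro mult_left_mono) auto
      also have "\<dots> = real (card I) * L / lam * D"
        by (simp add: exp_minus field_simps)
      also have "\<dots> \<le> 1/2 * D"
        using lam by (intro mult_right_mono) (auto simp: lam_def D_def field_simps)
      finally show ?thesis by (simp add: P D_def)
    qed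
  qed
  have "\<exists>!z. P z = z"
    by (rule banach_fix_type[of "1/2"]) (use contr in auto)
  then obtain z where z: "P z = z" by blast
  define y where "y i t = exp (lam * t) * apply_bcontfun z (t, discrete i)" for i t
  have yI: "y i t = y0 i + integral {0..t} (h z i)" if "t \<in> {0..T}" "i \<in> I" for i t
  proof -
    have "apply_bcontfun z (t, discrete i) = F z (t, discrete i)" using z P by metis
    also have "\<dots> = exp (- lam * t) * (y0 i + integral {0..t} (h z i))"
      using that cl by (simp add: F_def Let_def discrete_inverse)
    finally show ?thesis by (simp add: y_def exp_minus field_simps)
  qed
  have hy: "h z i s = (\<Sum>j\<in>I. A i j s * y j s)" for i s
    by (simp add: h_def y_def sum_distrib_left mult_ac)
  show ?thesis
  proof (intro exI[of _ y] allI impI conjI ballI)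
    fix i assume i: "i \<in> I"
    show "y i 0 = y0 i" using yI[of 0 i] i T by simp
    fix t assume t: "t \<in> {0..T}"
    have "((\<lambda>t. y0 i + integral {0..t} (h z i)) has_vector_derivative h z i t) (at t within {0..T})"
      using integral_has_vector_derivative[OF ch[OF i] t, of z]
      by (auto intro!: derivative_eq_intros)
    then have "(y i has_vector_derivative h z i t) (at t within {0..T})"
      by (rule has_vector_derivative_transform[OF t, rotated]) (simp add: yI i)
    then show "(y i has_vector_derivative (\<Sum>j\<in>I. A i j t * y j t)) (at t within {0..T})"
      by (simp only: hy)
  qed
qed

section \<open>Polynomials in several variables\<close>

definition mon :: "('n \<Rightarrow> nat) \<Rightarrow> real^'n \<Rightarrow> real" where
  "mon a x = (\<Prod>i\<in>UNIV. (x $ i) ^ a i)"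

definition midx :: "nat \<Rightarrow> ('n::finite \<Rightarrow> nat) set" where
  "midx p = {a. (\<Sum>i\<in>UNIV. a i) \<le> p}"

lemma midx_le: "a \<in> midx p \<Longrightarrow> a i \<le> p"
  using member_le_sum[of i UNIV a] by (force simp: midx_def)

lemma finite_midx: "finite (midx p :: ('n::finite \<Rightarrow> nat) set)"
proof (rule finite_subset)
  show "(midx p :: ('n \<Rightarrow> nat) set) \<subseteq> Pi\<^sub>E UNIV (\<lambda>_. {..p})"
    using midx_le by (auto simp: PiE_def extensional_def)
qed (intro finite_PiE; simp)

lemma poly_le_iff: "poly_le p f \<longleftrightarrow> (\<exists>c. \<forall>x. f x = (\<Sum>a\<in>midx p. c a * mon a x))"
  by (simp add: poly_le_def mon_def midx_def)

lemma poly_leE: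
  assumes "poly_le p f"
  obtains c where "f = (\<lambda>x. \<Sum>a\<in>midx p. c a * mon a x)"
  using assms unfolding poly_le_iff fun_eq_iff by blast

lemma mon_add: "mon (\<lambda>i. a i + b i) x = mon a x * mon b x"
  by (simp add: mon_def power_add prod.distrib)

lemma mon_zero: "mon (\<lambda>_. 0) x = 1"
  by (simp add: mon_def)

lemma poly_le_mono: "a \<in> midx p \<Longrightarrow> poly_le p (mon a)"
  unfolding poly_le_iff
  by (intro exI[of _ "\<lambda>b. if b = a then 1 else 0"]) (simp add: if_distribR if_distrib[of "\<lambda>c. c * mon _ _"] if_distrib[of "(*) _"] finite_midx cong: if_cong)

lemma poly_le_add: "poly_le p f \<Longrightarrow> poly_le p g \<Longrightarrow> poly_le p (\<lambda>x. f x + g x)"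
  unfolding poly_le_iff
proof (elim exE)
  fix c d assume "\<forall>x. f x = (\<Sum>a\<in>midx p. c a * mon a x)" "\<forall>x. g x = (\<Sum>a\<in>midx p. d a * mon a x)"
  then show "\<exists>c. \<forall>x. f x + g x = (\<Sum>a\<in>midx p. c a * mon a x)"
    by (intro exI[of _ "\<lambda>a. c a + d a"]) (simp add: distrib_right sum.distrib)
qed

lemma poly_le_cmult: "poly_le p f \<Longrightarrow> poly_le p (\<lambda>x. r * f x)"
  unfolding poly_le_iff
proof (elim exE)
  fix c assume "\<forall>x. f x = (\<Sum>a\<in>midx p. c a * mon a x)"
  then show "\<exists>c. \<forall>x. r * f x = (\<Sum>a\<in>midx p. c a * mon a x)"
    by (intro exI[of _ "\<lambda>a. r * c a"]) (simp add: sum_distrib_left mult.assoc)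
qed

lemma poly_le_0: "poly_le p (\<lambda>_. 0)"
  unfolding poly_le_iff by (intro exI[of _ "\<lambda>_. 0"]) simp

lemma poly_le_sum: "(\<And>i. i \<in> I \<Longrightarrow> poly_le p (f i)) \<Longrightarrow> poly_le p (\<lambda>x. \<Sum>i\<in>I. f i x)"
  by (induction I rule: infinite_finite_induct) (auto intro: poly_le_0 poly_le_add)

lemma poly_le_weaken: assumes "poly_le p f" "p \<le> q" shows "poly_le q f"
proof -
  obtain c where "f = (\<lambda>x. \<Sum>a\<in>midx p. c a * mon a x)"
    using assms(1) by (rule poly_leE)
  moreover have "midx p \<subseteq> midx q" using assms(2) by (auto simp: midx_def)
  ultimately show ?thesis by (auto intro!: poly_le_sum poly_le_cmult poly_le_mono)
qed

lemma poly_le_const: "poly_le p (\<lambda>_. r)"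
  using poly_le_cmult[OF poly_le_mono[of "\<lambda>_. 0" p], of r] by (simp add: midx_def mon_zero)

lemma poly_le_coord: "poly_le 1 (\<lambda>x. x $ i)"
proof -
  have "mon (\<lambda>j. if j = i then 1 else 0) = (\<lambda>x. x $ i)"
    by (auto simp: mon_def fun_eq_iff if_distrib cong: if_cong)
  then show ?thesis
    using poly_le_mono[of "\<lambda>j. if j = i then 1 else 0" 1] by (simp add: midx_def)
qed

lemma poly_le_mult:
  assumes "poly_le p f" "poly_le q g" shows "poly_le (p + q) (\<lambda>x. f x * g x)"
proof -
  obtain c where f: "f = (\<lambda>x. \<Sum>a\<in>midx p. c a * mon a x)"
    using assms(1) by (rule poly_leE)
  obtain d where g: "g = (\<lambda>x. \<Sum>a\<in>midx q. d a * mon a x)"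
    using assms(2) by (rule poly_leE)
  have "(\<lambda>x. f x * g x) = (\<lambda>x. \<Sum>a\<in>midx p. \<Sum>b\<in>midx q. c a * d b * mon (\<lambda>i. a i + b i) x)"
    by (simp add: f g sum_product mon_add mult_ac)
  moreover have "(\<lambda>i. a i + b i) \<in> midx (p + q)" if "a \<in> midx p" "b \<in> midx q" for a b
    using that by (simp add: midx_def sum.distrib)
  ultimately show ?thesis by (auto intro!: poly_le_sum poly_le_cmult poly_le_mono)
qed

lemma poly_le_power: "poly_le p f \<Longrightarrow> poly_le (n * p) (\<lambda>x. f x ^ n)"
  by (induction n) (auto intro: poly_le_const poly_le_mult)

lemma poly_le_prod:
  "(\<And>i. i \<in> I \<Longrightarrow> poly_le (d i) (f i)) \<Longrightarrow> poly_le (\<Sum>i\<in>I. d i) (\<lambda>x. \<Prod>i\<in>I. f i x)"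
  by (induction I rule: infinite_finite_induct) (auto intro: poly_le_const poly_le_mult)

text \<open>Degrees add under products, so a monomial in functions of degree at most 1 keeps its
  total degree. This covers all affine substitutions.\<close>

lemma poly_le_compose_coord:
  assumes "poly_le p f" "\<And>i. poly_le 1 (\<lambda>x. g x $ i)"
  shows "poly_le p (\<lambda>x. f (g x))"
proof -
  obtain c where f: "f = (\<lambda>x. \<Sum>a\<in>midx p. c a * mon a x)"
    using assms(1) by (rule poly_leE)
  have "poly_le p (\<lambda>x. mon a (g x))" if "a \<in> midx p" for a
  proof (rule poly_le_weaken)
    show "poly_le (\<Sum>i\<in>UNIV. a i) (\<lambda>x. mon a (g x))"
      unfolding mon_def using poly_le_power[OF assms(2)] by (intro poly_le_prod) force
  qed (use that in \<open>simp add: midx_def\<close>)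
  then show ?thesis by (auto simp: f intro!: poly_le_sum poly_le_cmult)
qed

lemma poly_le_affine: assumes "poly_le p f" shows "poly_le p (\<lambda>x. f (z + r *\<^sub>R x))"
  by (rule poly_le_compose_coord[OF assms])
    (use poly_le_coord in \<open>auto intro!: poly_le_add poly_le_cmult poly_le_const\<close>)

section \<open>Differentiability and gradients of polynomials\<close>

lemma mon_has_derivative:
  "(mon a has_derivative (\<lambda>h. \<Sum>i\<in>UNIV. of_nat (a i) * h $ i * (x $ i) ^ (a i - 1) * (\<Prod>j\<in>UNIV - {i}. (x $ j) ^ a j))) (at x)"
  unfolding mon_def
  by (rule has_derivative_prod) (auto intro!: derivative_eq_intros bounded_linear_vec_nth bounded_linear_imp_has_derivative simp: mult_ac)

lemma poly_le_differentiable: assumes "poly_le p f" shows "f differentiable (at x)"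
proof -
  obtain c where f: "f = (\<lambda>x. \<Sum>a\<in>midx p. c a * mon a x)"
    using assms by (rule poly_leE)
  have "mon a differentiable (at x)" for a :: "'a \<Rightarrow> nat"
    using mon_has_derivative differentiableI by blast
  then show ?thesis unfolding f using finite_midx by (intro differentiable_sum differentiable_mult) auto
qed

lemma poly_le_continuous: "poly_le p f \<Longrightarrow> continuous_on S f"
  by (intro continuous_at_imp_continuous_on ballI differentiable_imp_continuous_within poly_le_differentiable)

lemma poly_le_borel_measurable: "poly_le p f \<Longrightarrow> f \<in> borel_measurable borel"
  by (intro borel_measurable_continuous_onI poly_le_continuous)

lemma grad_add:
  assumes "f differentiable (at x)" "g differentiable (at x)"
  shows "grad (\<lambda>x. f x + g x) x = grad f x + grad g x"
proof -
  have "((\<lambda>x. f x + g x) has_derivative (\<lambda>h. frechet_derivative f (at x) h + frechet_derivative g (at x) h)) (at x)"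
    using assms by (intro has_derivative_add) (simp_all add: frechet_derivative_works)
  then have "frechet_derivative (\<lambda>x. f x + g x) (at x) = (\<lambda>h. frechet_derivative f (at x) h + frechet_derivative g (at x) h)"
    by (rule frechet_derivative_at[symmetric])
  then show ?thesis by (simp add: grad_def vec_eq_iff)
qed

lemma grad_cmult:
  assumes "f differentiable (at x)"
  shows "grad (\<lambda>x. r * f x) x = r *\<^sub>R grad f x"
proof -
  have "((\<lambda>x. r * f x) has_derivative (\<lambda>h. r * frechet_derivative f (at x) h)) (at x)"
    using assms by (intro has_derivative_mult_right) (simp_all add: frechet_derivative_works)
  then have "frechet_derivative (\<lambda>x. r * f x) (at x) = (\<lambda>h. r * frechet_derivative f (at x) h)"
    by (rule frechet_derivative_at[symmetric])
  then show ?thesis by (simp add: grad_def vec_eq_iff)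
qed

text \<open>Serves continuity of the gradient and the inverse estimate for its components, where any
  degree bound depending on \<open>p\<close> alone would do.\<close>

lemma poly_le_grad: assumes "poly_le p f" shows "poly_le p (\<lambda>x. grad f x $ i)"
proof -
  obtain c where f: "f = (\<lambda>x. \<Sum>a\<in>midx p. c a * mon a x)"
    using assms by (rule poly_leE)
  \<comment> \<open>For \<open>a i = 0\<close> the natural subtraction leaves the exponent
    unchanged, but then the factor \<open>of_nat (a i)\<close> is 0.\<close>
  have gm: "grad (mon a) x $ i = of_nat (a i) * mon (a(i := a i - 1)) x" for a :: "'a \<Rightarrow> nat" and x
  proof -
    have "frechet_derivative (mon a) (at x) =
      (\<lambda>h. \<Sum>i\<in>UNIV. of_nat (a i) * h $ i * (x $ i) ^ (a i - 1) * (\<Prod>j\<in>UNIV - {i}. (x $ j) ^ a j))"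
      by (rule frechet_derivative_at[OF mon_has_derivative, symmetric])
    then have "grad (mon a) x $ i = (\<Sum>l\<in>UNIV. of_nat (a l) * (axis i 1 :: real^'a) $ l * (x $ l) ^ (a l - 1) * (\<Prod>j\<in>UNIV - {l}. (x $ j) ^ a j))"
      by (simp only: grad_def vec_lambda_beta)
    also have "\<dots> = (\<Sum>l\<in>UNIV. if l = i then of_nat (a i) * ((x $ i) ^ (a i - 1) * (\<Prod>j\<in>UNIV - {i}. (x $ j) ^ a j)) else 0)"
      by (rule sum.cong) (simp_all add: axis_def)
    also have "\<dots> = of_nat (a i) * ((x $ i) ^ (a i - 1) * (\<Prod>j\<in>UNIV - {i}. (x $ j) ^ a j))"
      by simp
    also have "(x $ i) ^ (a i - 1) * (\<Prod>j\<in>UNIV - {i}. (x $ j) ^ a j) = mon (a(i := a i - 1)) x"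
      unfolding mon_def by (subst prod.remove[of UNIV i]) auto
    finally show ?thesis .
  qed
  have dm: "mon a differentiable (at x)" for a :: "'a \<Rightarrow> nat" and x
    using mon_has_derivative differentiableI by blast
  have "grad (\<lambda>x. \<Sum>a\<in>A. c a * mon a x) x $ i = (\<Sum>a\<in>A. c a * grad (mon a) x $ i)"
    if "finite A" for A x
    using that
  proof (induction A)
    case empty
    then show ?case by (simp add: grad_def)
  next
    case (insert a A)
    have "grad (\<lambda>x. c a * mon a x + (\<Sum>a\<in>A. c a * mon a x)) x
        = c a *\<^sub>R grad (mon a) x + grad (\<lambda>x. \<Sum>a\<in>A. c a * mon a x) x"
      using insert.hyps dm by (subst grad_add) (auto intro!: differentiable_sum differentiable_mult simp: grad_cmult)
    then show ?case using insert by simp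
  qed
  then have "(\<lambda>x. grad f x $ i) = (\<lambda>x. \<Sum>a\<in>midx p. c a * (of_nat (a i) * mon (a(i := a i - 1)) x))"
    by (simp add: f finite_midx gm)
  moreover have "a(i := a i - 1) \<in> midx p" if "a \<in> midx p" for a
  proof -
    have "(\<Sum>j\<in>UNIV. (a(i := a i - 1)) j) \<le> (\<Sum>j\<in>UNIV. a j)" by (intro sum_mono) auto
    then show ?thesis using that by (simp add: midx_def)
  qed
  ultimately show ?thesis by (auto intro!: poly_le_sum poly_le_cmult poly_le_mono)
qed

section \<open>Polynomials are determined by their values on grids and on open sets\<close>

text \<open>Induction on the set of variables. With the others frozen, collecting powers of the new
  variable gives a polynomial in one variable of degree at most \<open>p\<close> with more than
  \<open>p\<close> roots; each of its coefficients therefore vanishes on the grid and falls under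
  the induction hypothesis.\<close>

lemma grid_poly_zero:
  fixes c :: "('n \<Rightarrow> nat) \<Rightarrow> real" and Y :: "real set"
  assumes "finite S" "finite A" "finite Y" "card Y > p"
    and "\<And>a i. a \<in> A \<Longrightarrow> a i \<le> p" "\<And>a i. a \<in> A \<Longrightarrow> i \<notin> S \<Longrightarrow> a i = 0"
    and "\<And>x. (\<And>i. x i \<in> Y) \<Longrightarrow> (\<Sum>a\<in>A. c a * (\<Prod>i\<in>S. x i ^ a i)) = 0"
  shows "\<forall>a\<in>A. c a = 0"
  using assms(1,2,5-)
proof (induction S arbitrary: A c rule: finite_induct)
  case empty
  obtain y where y: "y \<in> Y" using assms(3,4) by fastforce
  have "A \<subseteq> {\<lambda>_. 0}" using empty by auto
  then consider "A = {}" | "A = {\<lambda>_. 0}" by blast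
  then show ?case using empty(4)[of "\<lambda>_. y"] y by cases auto
next
  case (insert j S)
  have "c a0 = 0" if a0: "a0 \<in> A" for a0
  proof -
    define n where "n = a0 j"
    define B where "B m = {a \<in> A. a j = m}" for m
    have finB: "finite (B m)" for m using insert.prems(1) by (simp add: B_def)
    have z: "(\<Sum>a\<in>B n. c a * (\<Prod>i\<in>S. x i ^ a i)) = 0" if x: "\<And>i. x i \<in> Y" for x
    proof -
      define d where "d m = (\<Sum>a\<in>B m. c a * (\<Prod>i\<in>S. x i ^ a i))" for m
      have "(\<Sum>m\<le>p. d m * y ^ m) = 0" if y: "y \<in> Y" for y
      proof -
        have "(\<Sum>m\<le>p. d m * y ^ m) = (\<Sum>m\<le>p. \<Sum>a\<in>B m. c a * (\<Prod>i\<in>S. x i ^ a i) * y ^ a j)"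
          by (simp add: d_def sum_distrib_right B_def)
        also have "\<dots> = (\<Sum>a\<in>A. c a * (\<Prod>i\<in>S. x i ^ a i) * y ^ a j)"
          unfolding B_def using insert.prems(1,2) by (intro sum.group) auto
        also have "\<dots> = (\<Sum>a\<in>A. c a * (\<Prod>i\<in>insert j S. (x(j := y)) i ^ a i))"
        proof (rule sum.cong[OF refl])
          fix a
          have "(\<Prod>i\<in>S. (x(j := y)) i ^ a i) = (\<Prod>i\<in>S. x i ^ a i)"
            using insert.hyps by (intro prod.cong) auto
          then show "c a * (\<Prod>i\<in>S. x i ^ a i) * y ^ a j = c a * (\<Prod>i\<in>insert j S. (x(j := y)) i ^ a i)"
            using insert.hyps by simp
        qed
        also have "\<dots> = 0" by (rule insert.prems(4)) (use x y in auto)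
        finally show ?thesis .
      qed
      then have sub: "Y \<subseteq> {y. (\<Sum>m\<le>p. d m * y ^ m) = 0}" by blast
      have "d m = 0" if "m \<le> p" for m
      proof (rule ccontr)
        assume "d m \<noteq> 0"
        then have "finite {y. (\<Sum>m\<le>p. d m * y ^ m) = 0} \<and> card {y. (\<Sum>m\<le>p. d m * y ^ m) = 0} \<le> p"
          using polyfun_rootbound[of p d] that by blast
        then show False using card_mono[OF _ sub] assms(4) by linarith
      qed
      then show ?thesis using insert.prems(2)[OF a0, of j] by (simp add: d_def n_def)
    qed
    \<comment> \<open>The exponent of \<open>j\<close> is erased because the induction hypothesis
      wants exponents supported in \<open>S\<close>. Nothing is lost: on \<open>B n\<close> that
      exponent is always \<open>n\<close>.\<close>
    define B' where "B' = (\<lambda>a. a(j := 0)) ` B n"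
    have inj: "inj_on (\<lambda>a. a(j := 0)) (B n)"
    proof (rule inj_onI)
      fix a b assume "a \<in> B n" "b \<in> B n" and e: "a(j := 0) = b(j := 0)"
      then have "a j = b j" by (simp add: B_def)
      moreover have "a i = b i" if "i \<noteq> j" for i using fun_cong[OF e, of i] that by simp
      ultimately show "a = b" by (metis ext)
    qed
    have "\<forall>b\<in>B'. c (b(j := n)) = 0"
    proof (rule insert.IH)
      show "finite B'" using finB by (simp add: B'_def)
      show "b i \<le> p" if "b \<in> B'" for b i using that insert.prems(2) by (auto simp: B'_def B_def)
      show "b i = 0" if "b \<in> B'" "i \<notin> S" for b i using that insert.prems(3) by (auto simp: B'_def B_def)
      fix x :: "'n \<Rightarrow> real" assume x: "\<And>i. x i \<in> Y"
      have "(\<Sum>b\<in>B'. c (b(j := n)) * (\<Prod>i\<in>S. x i ^ b i)) = (\<Sum>a\<in>B n. c a * (\<Prod>i\<in>S. x i ^ a i))"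
        unfolding B'_def
      proof (subst sum.reindex[OF inj], rule sum.cong[OF refl])
        fix a assume a: "a \<in> B n"
        have "(\<Prod>i\<in>S. x i ^ (a(j := 0)) i) = (\<Prod>i\<in>S. x i ^ a i)"
          using insert.hyps by (intro prod.cong) auto
        moreover have "a(j := 0, j := n) = a" using a by (auto simp: B_def)
        ultimately show "((\<lambda>b. c (b(j := n)) * (\<Prod>i\<in>S. x i ^ b i)) \<circ> (\<lambda>a. a(j := 0))) a = c a * (\<Prod>i\<in>S. x i ^ a i)"
          by simp
      qed
      then show "(\<Sum>b\<in>B'. c (b(j := n)) * (\<Prod>i\<in>S. x i ^ b i)) = 0" using z[OF x] by simp
    qed
    moreover have "a0(j := 0) \<in> B'" using a0 by (auto simp: B'_def B_def n_def)
    moreover have "a0(j := 0, j := n) = a0" by (simp add: n_def)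
    ultimately show ?thesis by metis
  qed
  then show ?case by blast
qed

lemma mon_independent:
  fixes c :: "('n::finite \<Rightarrow> nat) \<Rightarrow> real"
  assumes "finite Y" "card Y > p"
    and "\<And>x. (\<And>i. x $ i \<in> Y) \<Longrightarrow> (\<Sum>a\<in>midx p. c a * mon a x) = 0"
    and "a \<in> midx p"
  shows "c a = 0"
proof -
  have "\<forall>a\<in>midx p. c a = 0"
  proof (rule grid_poly_zero[of UNIV])
    fix x :: "'n \<Rightarrow> real" assume "\<And>i. x i \<in> Y"
    then show "(\<Sum>a\<in>midx p. c a * (\<Prod>i\<in>UNIV. x i ^ a i)) = 0"
      using assms(3)[of "\<chi> i. x i"] by (simp add: mon_def)
  qed (use assms finite_midx midx_le in auto)
  then show ?thesis using assms(4) by blast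
qed

text \<open>A grid of integers is shrunk into a ball inside \<open>S\<close>; vanishing there kills
  all coefficients in the rescaled variable, hence the polynomial everywhere.\<close>

lemma poly_le_zero_on_open:
  fixes q :: "real^'n \<Rightarrow> real"
  assumes q: "poly_le p q" and S: "open S" "z \<in> S" "\<And>x. x \<in> S \<Longrightarrow> q x = 0"
  shows "q x = 0"
proof -
  obtain e where e: "e > 0" "ball z e \<subseteq> S" using S openE by blast
  define Y where "Y = real ` {..p}"
  have Y: "finite Y" "card Y > p" by (auto simp: Y_def card_image)
  \<comment> \<open>Grid points have coordinates between 0 and \<open>p\<close>, hence norm at most
    \<open>p * CARD('n)\<close>; this scale moves them into the ball of radius
    \<open>e\<close>.\<close>
  define r where "r = e / (real p * real CARD('n) + 1)"
  have den: "real p * real CARD('n) + 1 > 0" by (simp add: add_nonneg_pos)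
  have r: "r > 0" using e den by (simp add: r_def)
  obtain c where c: "\<And>y. q (z + r *\<^sub>R y) = (\<Sum>a\<in>midx p. c a * mon a y)"
    using poly_le_affine[OF q, of z r] by (auto simp: poly_le_iff)
  have "c a = 0" if "a \<in> midx p" for a
  proof (rule mon_independent[OF Y _ that])
    fix y :: "real^'n" assume y: "\<And>i. y $ i \<in> Y"
    have "norm y \<le> (\<Sum>i\<in>UNIV. \<bar>y $ i\<bar>)" by (rule norm_le_l1_cart)
    also have "\<dots> \<le> (\<Sum>i\<in>(UNIV::'n set). real p)"
    proof (rule sum_mono)
      fix i show "\<bar>y $ i\<bar> \<le> real p" using y[of i] by (auto simp: Y_def)
    qed
    finally have "norm y < real p * real CARD('n) + 1" by (simp add: mult.commute)
    then have "r * norm y < r * (real p * real CARD('n) + 1)" using r by (rule mult_strict_left_mono)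
    then have "r * norm y < e" using den by (simp add: r_def)
    then have "z + r *\<^sub>R y \<in> S" using e r by (intro subsetD[OF e(2)]) (simp add: dist_norm)
    then show "(\<Sum>a\<in>midx p. c a * mon a y) = 0" using S(3)[of "z + r *\<^sub>R y"] by (simp add: c)
  qed
  then have "q (z + r *\<^sub>R ((1/r) *\<^sub>R (x - z))) = 0" unfolding c by simp
  then show ?thesis using r by simp
qed

text \<open>Coefficients are finite linear combinations of point values, so that pointwise regularity
  in time of a curve of polynomials is inherited by its coefficients.\<close>

lemma ex_coef_weights:
  "\<exists>(G :: (real^'n) set) w. finite G \<and>
     (\<forall>a\<in>midx p. \<forall>b\<in>midx p. (\<Sum>g\<in>G. w a g * mon b g) = of_bool (a = b))"
proof -
  define Y where "Y = real ` {..p}"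
  have Y: "finite Y" "card Y > p" by (auto simp: Y_def card_image)
  define G :: "(real^'n) set" where "G = (\<lambda>f. \<chi> i. f i) ` (Pi\<^sub>E UNIV (\<lambda>_. Y))"
  have G: "finite G" unfolding G_def using Y by (intro finite_imageI finite_PiE) auto
  have memG: "x \<in> G" if "\<And>i. x $ i \<in> Y" for x
    unfolding G_def using that by (intro image_eqI[of _ _ "\<lambda>i. x $ i"]) (auto simp: PiE_def extensional_def)
  \<comment> \<open>The weights are sought as values of a polynomial on the grid. Duality then
    becomes a linear system with the Gram matrix of the monomials on \<open>G\<close>, positive
    definite because the grid determines a polynomial of degree at most \<open>p\<close>.\<close>
  have "\<exists>y. \<forall>b\<in>midx p. (\<Sum>j\<in>midx p. (\<Sum>g\<in>G. mon b g * mon j g) * y j) = of_bool (a = b)" for a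
  proof -
    show ?thesis
    proof (rule pd_system_solvable_const[OF finite_midx])
      fix x :: "('n \<Rightarrow> nat) \<Rightarrow> real" assume x: "\<exists>i\<in>midx p. x i \<noteq> 0"
      define q where "q g = (\<Sum>i\<in>midx p. x i * mon i g)" for g
      have "(\<Sum>i\<in>midx p. \<Sum>j\<in>midx p. x i * (\<Sum>g\<in>G. mon i g * mon j g) * x j)
          = (\<Sum>i\<in>midx p. \<Sum>j\<in>midx p. \<Sum>g\<in>G. (x i * mon i g) * (x j * mon j g))"
        by (simp add: sum_distrib_left sum_distrib_right mult_ac)
      also have "\<dots> = (\<Sum>i\<in>midx p. \<Sum>g\<in>G. \<Sum>j\<in>midx p. (x i * mon i g) * (x j * mon j g))"
        by (intro sum.cong refl sum.swap)
      also have "\<dots> = (\<Sum>g\<in>G. q g ^ 2)"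
        unfolding q_def power2_eq_square sum_product by (rule sum.swap)
      finally have e: "(\<Sum>i\<in>midx p. \<Sum>j\<in>midx p. x i * (\<Sum>g\<in>G. mon i g * mon j g) * x j) = (\<Sum>g\<in>G. q g ^ 2)" .
      have "(\<Sum>g\<in>G. q g ^ 2) \<noteq> 0"
      proof
        assume "(\<Sum>g\<in>G. q g ^ 2) = 0"
        then have q0: "\<And>g. g \<in> G \<Longrightarrow> q g = 0" using G by (simp add: sum_nonneg_eq_0_iff)
        have "x a = 0" if "a \<in> midx p" for a
          by (rule mon_independent[OF Y _ that]) (use q0 memG in \<open>auto simp: q_def\<close>)
        then show False using x by blast
      qed
      then show "0 < (\<Sum>i\<in>midx p. \<Sum>j\<in>midx p. x i * (\<Sum>g\<in>G. mon i g * mon j g) * x j)"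
        unfolding e by (simp add: less_le sum_nonneg)
    qed
  qed
  from choice[OF allI[OF this]]
  obtain y where y: "\<forall>a. \<forall>b\<in>midx p. (\<Sum>j\<in>midx p. (\<Sum>g\<in>G. mon b g * mon j g) * y a j) = of_bool (a = b)" ..
  have "(\<Sum>g\<in>G. (\<Sum>j\<in>midx p. y a j * mon j g) * mon b g) = of_bool (a = b)" if "b \<in> midx p" for a b
  proof -
    have "(\<Sum>g\<in>G. (\<Sum>j\<in>midx p. y a j * mon j g) * mon b g) = (\<Sum>g\<in>G. \<Sum>j\<in>midx p. y a j * mon j g * mon b g)"
      by (simp add: sum_distrib_right)
    also have "\<dots> = (\<Sum>j\<in>midx p. \<Sum>g\<in>G. y a j * mon j g * mon b g)" by (rule sum.swap)
    also have "\<dots> = (\<Sum>j\<in>midx p. (\<Sum>g\<in>G. mon b g * mon j g) * y a j)"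
      by (simp add: sum_distrib_left sum_distrib_right mult_ac)
    finally show ?thesis using y that by simp
  qed
  then have "\<forall>a\<in>midx p. \<forall>b\<in>midx p. (\<Sum>g\<in>G. (\<lambda>a g. \<Sum>j\<in>midx p. y a j * mon j g) a g * mon b g) = of_bool (a = b)"
    by simp
  then show ?thesis
    using G by (intro exI[of _ G] exI[of _ "\<lambda>a g. \<Sum>j\<in>midx p. y a j * mon j g"] conjI)
qed

section \<open>Surface measure of boundaries of convex sets\<close>

lemma hausdorff_const_nonneg: "s \<ge> 0 \<Longrightarrow> hausdorff_const s \<ge> 0"
  unfolding hausdorff_const_def by (intro divide_nonneg_pos Gamma_real_pos) auto

text \<open>One finite covering per scale with a bound uniform in \<open>\<delta>\<close> disposes
  of both the infimum over countable coverings and the supremum over scales.\<close>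

lemma hausdorff_outer_le:
  fixes A :: "'a::metric_space set" and C :: "real \<Rightarrow> 'i \<Rightarrow> 'a set"
  assumes s: "s \<ge> 0"
    and fin: "\<And>\<delta>. \<delta> > 0 \<Longrightarrow> finite (I \<delta>)"
    and cov: "\<And>\<delta>. \<delta> > 0 \<Longrightarrow> A \<subseteq> (\<Union>i\<in>I \<delta>. C \<delta> i)"
    and bd: "\<And>\<delta> i. \<delta> > 0 \<Longrightarrow> i \<in> I \<delta> \<Longrightarrow> bounded (C \<delta> i)"
    and dm: "\<And>\<delta> i. \<delta> > 0 \<Longrightarrow> i \<in> I \<delta> \<Longrightarrow> diameter (C \<delta> i) < \<delta>"
    and B: "\<And>\<delta>. \<delta> > 0 \<Longrightarrow> (\<Sum>i\<in>I \<delta>. hausdorff_const s * (diameter (C \<delta> i) / 2) powr s) \<le> B"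
  shows "hausdorff_outer s A \<le> ennreal B"
  unfolding hausdorff_outer_def
proof (rule SUP_least)
  fix \<delta> :: real assume "\<delta> \<in> {0<..}"
  then have d: "\<delta> > 0" by simp
  let ?N = "card (I \<delta>)"
  obtain g where g: "bij_betw g {..<?N} (I \<delta>)"
    using ex_bij_betw_nat_finite[OF fin[OF d]] atLeast0LessThan by metis
  \<comment> \<open>Empty sets pad the finite covering to a sequence; each adds 0, since
    \<open>0 powr s = 0\<close> for every \<open>s\<close>, including \<open>s = 0\<close>.\<close>
  define D where "D n = (if n < ?N then C \<delta> (g n) else {})" for n
  have gI: "g n \<in> I \<delta>" if "n < ?N" for n using g that by (auto simp: bij_betw_def)
  have sub: "A \<subseteq> (\<Union>n. D n)"
  proof
    fix x assume "x \<in> A"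
    then obtain i where i: "i \<in> I \<delta>" "x \<in> C \<delta> i" using cov[OF d] by auto
    then have "i \<in> g ` {..<?N}" using g by (simp add: bij_betw_def)
    then obtain n where "n < ?N" "g n = i" by auto
    then show "x \<in> (\<Union>n. D n)" using i by (auto simp: D_def)
  qed
  have "(\<Sum>n. ennreal (hausdorff_const s * (diameter (D n) / 2) powr s))
      = (\<Sum>n<?N. ennreal (hausdorff_const s * (diameter (D n) / 2) powr s))"
    by (rule suminf_finite) (auto simp: D_def)
  also have "\<dots> = ennreal (\<Sum>n<?N. hausdorff_const s * (diameter (D n) / 2) powr s)"
    using s by (intro sum_ennreal) (auto simp: hausdorff_const_nonneg)
  also have "(\<Sum>n<?N. hausdorff_const s * (diameter (D n) / 2) powr s)
      = (\<Sum>n<?N. hausdorff_const s * (diameter (C \<delta> (g n)) / 2) powr s)"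
    by (intro sum.cong) (auto simp: D_def)
  also have "\<dots> = (\<Sum>i\<in>I \<delta>. hausdorff_const s * (diameter (C \<delta> i) / 2) powr s)"
    by (rule sum.reindex_bij_betw[OF g])
  finally have "(\<Sum>n. ennreal (hausdorff_const s * (diameter (D n) / 2) powr s)) \<le> ennreal B"
    using B[OF d] by (simp add: ennreal_leI)
  moreover have "D \<in> {C. A \<subseteq> (\<Union>i. C i) \<and> (\<forall>i. bounded (C i) \<and> diameter (C i) < \<delta>)}"
    using sub bd[OF d] dm[OF d] gI d by (auto simp: D_def)
  ultimately show "(INF C\<in>{C. A \<subseteq> (\<Union>i. C i) \<and> (\<forall>i. bounded (C i) \<and> diameter (C i) < \<delta>)}.
      \<Sum>i. ennreal (hausdorff_const s * (diameter (C i) / 2) powr s)) \<le> ennreal B"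
    by (rule INF_lower2[rotated])
qed

lemma sets_hausdorff [simp, measurable_cong]: "sets (hausdorff_measure s) = sets borel"
  using sets.sigma_sets_eq[of borel] by (simp add: hausdorff_measure_def sets_measure_of_conv)

lemma space_hausdorff [simp]: "space (hausdorff_measure s) = UNIV"
  by (simp add: hausdorff_measure_def space_measure_of_conv)

text \<open>\<open>measure_of\<close> returns the given set function if that is a measure on the
  generated sigma-algebra, and zero otherwise; the upper bound holds in either case.\<close>

lemma emeasure_hausdorff_le: "emeasure (hausdorff_measure s) A \<le> hausdorff_outer s A"
  unfolding hausdorff_measure_def emeasure_measure_of_conv by simp

text \<open>The nearest-point projection is 1-Lipschitz and, moving outwards along a supporting normal,
  it maps the boundary of a surrounding cube onto the boundary of the convex set.\<close>

lemma frontier_subset_closest_point_image: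
  fixes S :: "(real^'n) set"
  assumes S: "convex S" "closed S" "S \<subseteq> cball z D" and x: "x \<in> frontier S"
  shows "\<exists>p i. closest_point S p = x \<and> \<bar>p $ i - z $ i\<bar> = D \<and> (\<forall>l. \<bar>p $ l - z $ l\<bar> \<le> D)"
proof -
  have xS: "x \<in> S" using x S(2) by (meson frontier_subset_closed subsetD)
  have xi: "x \<notin> interior S" using x by (simp add: frontier_def)
  \<comment> \<open>The vector \<open>a\<close> supports \<open>S\<close> from inside, so the
    outward ray is \<open>x - t *\<^sub>R a\<close>. If the interior is empty, \<open>S\<close> lies
    in a hyperplane, whose normal supports it with equality.\<close>
  obtain a where a: "a \<noteq> 0" "\<And>y. y \<in> S \<Longrightarrow> a \<bullet> x \<le> a \<bullet> y"
  proof (cases "interior S = {}")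
    case False
    then have "x \<notin> rel_interior S" using xi by (simp add: rel_interior_nonempty_interior)
    from supporting_hyperplane_rel_boundary[OF S(1) xS this] that show ?thesis by metis
  next
    case True
    then obtain a b where "a \<noteq> 0" "S \<subseteq> {x. a \<bullet> x = b}"
      using empty_interior_subset_hyperplane[OF S(1)] by metis
    then have "a \<bullet> y = b" if "y \<in> S" for y using that by blast
    then show ?thesis using that[of a] xS \<open>a \<noteq> 0\<close> by simp
  qed
  have cp: "closest_point S (x - t *\<^sub>R a) = x" if "t \<ge> 0" for t
  proof (rule closest_point_unique[OF S(1,2) xS, symmetric], rule ballI)
    fix y assume y: "y \<in> S"
    have "(norm (x - t *\<^sub>R a - x))\<^sup>2 \<le> (norm (x - t *\<^sub>R a - y))\<^sup>2"
    proof -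
      have "(norm (x - t *\<^sub>R a - y))\<^sup>2 = (norm (x - y))\<^sup>2 + 2 * t * (a \<bullet> y - a \<bullet> x) + (norm (t *\<^sub>R a))\<^sup>2"
        unfolding power2_norm_eq_inner by (simp add: inner_diff_left inner_diff_right inner_commute algebra_simps)
      moreover have "t * (a \<bullet> y - a \<bullet> x) \<ge> 0" using that a(2)[OF y] by simp
      ultimately show ?thesis by simp
    qed
    then show "dist (x - t *\<^sub>R a) x \<le> dist (x - t *\<^sub>R a) y"
      by (simp add: dist_norm norm_le_square power2_le_iff_abs_le)
  qed
  have inf0: "infnorm (x - z) \<le> D"
    using infnorm_le_norm[of "x - z"] subsetD[OF S(3) xS] by (simp add: dist_norm norm_minus_commute)
  define f where "f t = infnorm (x - t *\<^sub>R a - z)" for t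
  \<comment> \<open>By the triangle inequality for \<open>infnorm\<close> the ray is no longer
    inside the open cube at \<open>t1\<close>; the intermediate value theorem then yields the
    crossing point.\<close>
  define t1 where "t1 = (D + infnorm (x - z)) / infnorm a"
  have ia: "infnorm a > 0" using a(1) by (simp add: infnorm_pos_lt)
  have D0: "D \<ge> 0" using inf0 infnorm_pos_le[of "x - z"] by linarith
  have t1: "t1 \<ge> 0" using D0 ia infnorm_pos_le[of "x - z"] by (simp add: t1_def)
  have "infnorm (t1 *\<^sub>R a) \<le> infnorm (x - t1 *\<^sub>R a - z) + infnorm (x - z)"
    using infnorm_triangle[of "- (x - t1 *\<^sub>R a - z)" "x - z"] infnorm_sub[of z "x - t1 *\<^sub>R a"] by simp
  moreover have "infnorm (t1 *\<^sub>R a) = D + infnorm (x - z)"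
    using t1 ia D0 infnorm_pos_le[of "x - z"] by (simp add: infnorm_mul t1_def)
  ultimately have "f t1 \<ge> D" by (simp add: f_def)
  moreover have "continuous_on {0..t1} f" unfolding f_def by (intro continuous_intros)
  ultimately obtain t where t: "0 \<le> t" "f t = D"
    using IVT'[of f 0 D t1] inf0 t1 by (auto simp: f_def)
  define p where "p = x - t *\<^sub>R a"
  have M: "D = Max ((\<lambda>i. \<bar>(p - z) \<bullet> i\<bar>) ` Basis)" using t(2) by (simp add: f_def p_def infnorm_Max)
  then have "D \<in> (\<lambda>i. \<bar>(p - z) \<bullet> i\<bar>) ` Basis" by (simp add: Max_in)
  then obtain i where i: "\<bar>p $ i - z $ i\<bar> = D"
    by (auto simp: Basis_vec_def inner_axis)
  have "\<bar>p $ l - z $ l\<bar> \<le> D" for l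
  proof -
    have "\<bar>(p - z) \<bullet> axis l 1\<bar> \<le> D" unfolding M by (intro Max_ge) (auto simp: axis_in_Basis_iff)
    then show ?thesis by (simp add: inner_axis)
  qed
  then show ?thesis using i cp[OF t(1)] unfolding p_def[symmetric]
    by (intro exI[of _ p] exI[of _ i] conjI allI)
qed

lemma ex_grid_cell:
  fixes v D :: real assumes "\<bar>v\<bar> \<le> D" "D > 0" "N > 0"
  shows "\<exists>j<N. - D + 2 * D * real j / real N \<le> v \<and> v \<le> - D + 2 * D * (real j + 1) / real N"
\<comment> \<open>At the right end point the floor would give \<open>N\<close>, one past the last
  cell.\<close>
proof (cases "v = D")
  case True
  then show ?thesis using assms by (intro exI[of _ "N - 1"]) (auto simp: of_nat_diff field_simps)
next
  case False
  define w where "w = (v + D) * N / (2 * D)"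
  have "0 \<le> v + D" "v + D < 2 * D" using assms False by auto
  then have w: "0 \<le> w" "w < N" using assms by (simp_all add: w_def pos_divide_less_eq mult.commute)
  have v: "v = - D + 2 * D * w / N" using assms by (simp add: w_def)
  define j where "j = nat \<lfloor>w\<rfloor>"
  have j: "real j \<le> w" "w \<le> real j + 1" using w by (auto simp: j_def)
  have "j < N" using j(1) w(2) by linarith
  moreover have "- D + 2 * D * real j / real N \<le> v" "v \<le> - D + 2 * D * (real j + 1) / real N"
    unfolding v using j assms by (auto intro!: divide_right_mono mult_left_mono)
  ultimately show ?thesis by blast
qed

text \<open>A cube of half-width \<open>D\<close> has \<open>2 * d\<close> faces with
  \<open>N ^ (d - 1)\<close> cells each. The diameter of a cell is at most
  \<open>d * (2 * D / N)\<close>; half of it to the power \<open>d - 1\<close> cancels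
  \<open>N ^ (d - 1)\<close> and leaves this constant times \<open>D ^ (d - 1)\<close>.\<close>

definition frontier_const :: "nat \<Rightarrow> real" where
  "frontier_const d = 2 * real d * hausdorff_const (real d - 1) * real d ^ (d - 1)"

lemma hausdorff_outer_frontier_convex:
  fixes S :: "(real^'n) set"
  assumes S: "convex S" "closed S" "S \<noteq> {}" "S \<subseteq> cball z D" and D: "D > 0"
  shows "hausdorff_outer (real CARD('n) - 1) (frontier S) \<le> ennreal (frontier_const CARD('n) * D ^ (CARD('n) - 1))"
proof -
  let ?d = "CARD('n)"
  have d: "?d > 0" by simp
  define N where "N \<delta> = nat \<lceil>2 * D * real ?d / \<delta>\<rceil> + 1" for \<delta>
  have N: "N \<delta> > 0" for \<delta> by (simp add: N_def)
  have N\<delta>: "real ?d * (2 * D / N \<delta>) < \<delta>" if "\<delta> > 0" for \<delta>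
  proof -
    have "2 * D * real ?d / \<delta> < N \<delta>" unfolding N_def by linarith
    then show ?thesis using that N[of \<delta>] by (simp add: field_simps)
  qed
  \<comment> \<open>A cell is addressed by the coordinate \<open>i\<close> that is constant on its
    cube face, the side \<open>\<sigma>\<close>, and its grid position \<open>j\<close> in the
    remaining coordinates.\<close>
  define I :: "real \<Rightarrow> ('n \<times> real \<times> ('n \<Rightarrow> nat)) set" where
    "I \<delta> = (SIGMA i:UNIV. {-1, 1} \<times> Pi\<^sub>E (UNIV - {i}) (\<lambda>_. {..<N \<delta>}))" for \<delta>
  define cell :: "real \<Rightarrow> 'n \<times> real \<times> ('n \<Rightarrow> nat) \<Rightarrow> (real^'n) set" where
    "cell \<delta> = (\<lambda>(i, \<sigma>, j). {p. p $ i = z $ i + \<sigma> * D \<and>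
       (\<forall>l. l \<noteq> i \<longrightarrow> - D + 2 * D * real (j l) / real (N \<delta>) \<le> p $ l - z $ l \<and>
                     p $ l - z $ l \<le> - D + 2 * D * (real (j l) + 1) / real (N \<delta>))})" for \<delta>
  define C where "C \<delta> u = closest_point S ` cell \<delta> u" for \<delta> u
  have diam: "diameter (C \<delta> u) \<le> real ?d * (2 * D / N \<delta>)" for \<delta> u
  proof (rule diameter_le)
    show "C \<delta> u \<noteq> {} \<or> 0 \<le> real ?d * (2 * D / N \<delta>)" using D by simp
    fix x y assume "x \<in> C \<delta> u" "y \<in> C \<delta> u"
    then obtain p q where pq: "p \<in> cell \<delta> u" "q \<in> cell \<delta> u" "x = closest_point S p" "y = closest_point S q"
      by (auto simp: C_def)
    obtain i \<sigma> j where u: "u = (i, \<sigma>, j)" by (cases u)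
    have "norm (x - y) \<le> norm (p - q)"
      using closest_point_lipschitz[OF S(1-3), of p q] by (simp add: pq dist_norm)
    also have "\<dots> \<le> (\<Sum>l\<in>UNIV. \<bar>(p - q) $ l\<bar>)" by (rule norm_le_l1_cart)
    also have "\<dots> \<le> (\<Sum>l\<in>(UNIV::'n set). 2 * D / N \<delta>)"
    proof (rule sum_mono)
      fix l
      show "\<bar>(p - q) $ l\<bar> \<le> 2 * D / N \<delta>"
      proof (cases "l = i")
        case True
        then show ?thesis using pq(1,2) D by (auto simp: cell_def u)
      next
        case False
        then have "- D + 2 * D * real (j l) / real (N \<delta>) \<le> p $ l - z $ l"
            "p $ l - z $ l \<le> - D + 2 * D * (real (j l) + 1) / real (N \<delta>)"
            "- D + 2 * D * real (j l) / real (N \<delta>) \<le> q $ l - z $ l"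
            "q $ l - z $ l \<le> - D + 2 * D * (real (j l) + 1) / real (N \<delta>)"
          using pq(1,2) by (auto simp: cell_def u)
        moreover have "2 * D * (real (j l) + 1) / real (N \<delta>) = 2 * D * real (j l) / real (N \<delta>) + 2 * D / N \<delta>"
          by (simp add: algebra_simps add_divide_distrib)
        ultimately show ?thesis by simp
      qed
    qed
    finally show "norm (x - y) \<le> real ?d * (2 * D / N \<delta>)" by simp
  qed
  have cardI: "card (I \<delta>) = ?d * (2 * N \<delta> ^ (?d - 1))" for \<delta>
  proof -
    have "card (I \<delta>) = (\<Sum>i\<in>(UNIV::'n set). card ({-1, 1 :: real} \<times> Pi\<^sub>E (UNIV - {i}) (\<lambda>_. {..<N \<delta>})))"
      unfolding I_def by (rule card_SigmaI) (auto intro!: finite_PiE)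
    then show ?thesis by (simp add: card_cartesian_product card_PiE card_Diff_singleton)
  qed
  show ?thesis
  proof (rule hausdorff_outer_le[where I = I and C = C])
    show "0 \<le> real ?d - 1" using d by linarith
    fix \<delta> :: real assume \<delta>: "\<delta> > 0"
    show "finite (I \<delta>)" unfolding I_def by (intro finite_SigmaI finite_cartesian_product finite_PiE) auto
    show "frontier S \<subseteq> (\<Union>i\<in>I \<delta>. C \<delta> i)"
    proof
      fix x assume "x \<in> frontier S"
      from frontier_subset_closest_point_image[OF S(1,2,4) this]
      obtain p i where p: "closest_point S p = x" "\<bar>p $ i - z $ i\<bar> = D" "\<And>l. \<bar>p $ l - z $ l\<bar> \<le> D" by blast
      have "\<forall>l. \<exists>j<N \<delta>. - D + 2 * D * real j / real (N \<delta>) \<le> p $ l - z $ l \<and>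
          p $ l - z $ l \<le> - D + 2 * D * (real j + 1) / real (N \<delta>)"
        using ex_grid_cell[OF p(3) D N] by blast
      from choice[OF this] obtain j where j: "\<And>l. j l < N \<delta> \<and> - D + 2 * D * real (j l) / real (N \<delta>) \<le> p $ l - z $ l \<and>
          p $ l - z $ l \<le> - D + 2 * D * (real (j l) + 1) / real (N \<delta>)" by blast
      define \<sigma> :: real where "\<sigma> = (if p $ i \<ge> z $ i then 1 else -1)"
      define u where "u = (i, \<sigma>, restrict j (UNIV - {i}))"
      have "u \<in> I \<delta>" using j by (auto simp: u_def I_def \<sigma>_def)
      moreover have "p \<in> cell \<delta> u" using p(2) j by (auto simp: u_def cell_def \<sigma>_def)
      ultimately show "x \<in> (\<Union>i\<in>I \<delta>. C \<delta> i)" using p(1) by (auto simp: C_def)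
    qed
    show "(\<Sum>i\<in>I \<delta>. hausdorff_const (real ?d - 1) * (diameter (C \<delta> i) / 2) powr (real ?d - 1))
        \<le> frontier_const ?d * D ^ (?d - 1)"
    proof -
      have "(diameter (C \<delta> i) / 2) powr (real ?d - 1) \<le> (real ?d * D / N \<delta>) ^ (?d - 1)" if "i \<in> I \<delta>" for i
      proof -
        have "bounded (C \<delta> i)"
        proof -
          have "C \<delta> i \<subseteq> S" using closest_point_in_set[OF S(2,3)] by (auto simp: C_def)
          then show ?thesis using S(4) bounded_subset bounded_cball by metis
        qed
        then have "diameter (C \<delta> i) \<ge> 0" by (rule diameter_ge_0)
        then have "(diameter (C \<delta> i) / 2) powr (real ?d - 1) \<le> (real ?d * D / N \<delta>) powr (real ?d - 1)"
          using diam[of \<delta> i] d by (intro powr_mono2) (auto simp: mult_ac)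
        also have "\<dots> = (real ?d * D / N \<delta>) powr real (?d - 1)" using d by (simp add: of_nat_diff)
        also have "\<dots> = (real ?d * D / N \<delta>) ^ (?d - 1)"
          using d D N by (intro powr_realpow) auto
        finally show ?thesis .
      qed
      then have "(\<Sum>i\<in>I \<delta>. hausdorff_const (real ?d - 1) * (diameter (C \<delta> i) / 2) powr (real ?d - 1))
          \<le> (\<Sum>i\<in>I \<delta>. hausdorff_const (real ?d - 1) * (real ?d * D / N \<delta>) ^ (?d - 1))"
        using d by (intro sum_mono mult_left_mono hausdorff_const_nonneg) auto
      also have "\<dots> = real (card (I \<delta>)) * (hausdorff_const (real ?d - 1) * (real ?d * D / N \<delta>) ^ (?d - 1))"
        by simp
      also have "\<dots> = frontier_const ?d * D ^ (?d - 1)"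
        using N[of \<delta>] by (simp add: cardI frontier_const_def power_mult_distrib power_divide field_simps)
      finally show ?thesis .
    qed
    fix u assume "u \<in> I \<delta>"
    have "C \<delta> u \<subseteq> S" using closest_point_in_set[OF S(2,3)] by (auto simp: C_def)
    then show "bounded (C \<delta> u)" using S(4) bounded_subset bounded_cball by metis
    show "diameter (C \<delta> u) < \<delta>" using diam[of \<delta> u] N\<delta>[OF \<delta>] by linarith
  qed
qed

text \<open>Interior points of a piece lie in \<open>interior (closure k) = k\<close>, so a frontier
  point of \<open>k\<close> is a frontier point of each piece containing it. The bound counts
  pieces, however many faces the boundary of \<open>k\<close> is divided into.\<close>

lemma emeasure_surf_frontier_le:
  fixes k :: "(real^'n) set"
  assumes k: "open k" "interior (closure k) = k" and S: "finite S" "closure k = \<Union>S"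
    and cv: "\<And>s. s \<in> S \<Longrightarrow> convex s \<and> compact s \<and> s \<noteq> {}"
    and D: "closure k \<subseteq> cball z D" "D > 0"
  shows "emeasure surf (frontier k) \<le> ennreal (real (card S) * (frontier_const CARD('n) * D ^ (CARD('n) - 1)))"
proof -
  have fr: "frontier k \<subseteq> (\<Union>s\<in>S. frontier s)"
  proof
    fix x assume x: "x \<in> frontier k"
    then have xc: "x \<in> closure k" "x \<notin> k" using k(1) by (auto simp: frontier_def interior_open)
    then obtain s where s: "s \<in> S" "x \<in> s" using S by auto
    have "x \<notin> interior s"
    proof
      assume "x \<in> interior s"
      moreover have "s \<subseteq> closure k" using s S by auto
      ultimately have "x \<in> interior (closure k)" using interior_mono by blast
      then show False using k xc by simp
    qed
    then show "x \<in> (\<Union>s\<in>S. frontier s)" using s closure_subset by (auto simp: frontier_def)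
  qed
  have fc: "frontier_const CARD('n) \<ge> 0"
    unfolding frontier_const_def by (intro mult_nonneg_nonneg hausdorff_const_nonneg) auto
  have "emeasure surf (frontier k) \<le> emeasure surf (\<Union>s\<in>S. frontier s)"
    using fr S(1) by (intro emeasure_mono) auto
  also have "\<dots> \<le> (\<Sum>s\<in>S. emeasure surf (frontier s))"
    using S(1) by (intro emeasure_subadditive_finite) auto
  also have "\<dots> \<le> (\<Sum>s\<in>S. ennreal (frontier_const CARD('n) * D ^ (CARD('n) - 1)))"
  proof (rule sum_mono)
    fix s assume s: "s \<in> S"
    have "s \<subseteq> cball z D" using s S(2) D(1) by blast
    then have "hausdorff_outer (real CARD('n) - 1) (frontier s) \<le> ennreal (frontier_const CARD('n) * D ^ (CARD('n) - 1))"
      using cv[OF s] D(2) by (intro hausdorff_outer_frontier_convex) (auto intro: compact_imp_closed)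
    then show "emeasure surf (frontier s) \<le> ennreal (frontier_const CARD('n) * D ^ (CARD('n) - 1))"
      using emeasure_hausdorff_le order_trans by blast
  qed
  also have "\<dots> = ennreal (real (card S) * (frontier_const CARD('n) * D ^ (CARD('n) - 1)))"
    using fc D(2) by (simp add: ennreal_mult' ennreal_of_nat_eq_real_of_nat)
  finally show ?thesis .
qed

section \<open>Inverse estimates and mesh geometry\<close>

lemma set_lebesgue_integral_sum:
  fixes f :: "'i \<Rightarrow> 'a \<Rightarrow> real"
  assumes "\<And>i. i \<in> I \<Longrightarrow> set_integrable M A (f i)"
  shows "set_lebesgue_integral M A (\<lambda>x. \<Sum>i\<in>I. f i x) = (\<Sum>i\<in>I. set_lebesgue_integral M A (f i))"
  using assms unfolding set_integrable_def set_lebesgue_integral_def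
  by (simp only: scaleR_sum_right) (rule Bochner_Integration.integral_sum)

lemma set_integrable_lborel_continuous:
  fixes f :: "'a::euclidean_space \<Rightarrow> real"
  assumes "continuous_on UNIV f" "bounded S" "S \<in> sets borel"
  shows "set_integrable lborel S f"
proof (rule set_integrable_subset)
  show "set_integrable lborel (closure S) f"
    unfolding set_integrable_def using assms
    by (intro borel_integrable_compact) (auto intro: continuous_on_subset)
qed (use assms closure_subset in auto)

lemma open_lborel_pos:
  fixes S :: "'a::euclidean_space set"
  assumes "open S" "S \<noteq> {}" shows "S \<notin> null_sets lborel"
proof
  assume "S \<in> null_sets lborel"
  then have "negligible S" by (simp add: negligible_iff_null_sets null_sets_completionI)
  then show False using open_not_negligible assms by blast
qed

lemma set_integral_nonneg_eq_0:
  fixes f :: "'a::euclidean_space \<Rightarrow> real"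
  assumes S: "open S" "bounded S" and f: "continuous_on UNIV f" "\<And>x. f x \<ge> 0"
    and z: "set_lebesgue_integral lborel S f = 0" and x: "x \<in> S"
  shows "f x = 0"
proof (rule ccontr)
  assume fx: "f x \<noteq> 0"
  have int: "integrable lborel (\<lambda>x. indicator S x *\<^sub>R f x)"
    using set_integrable_lborel_continuous[OF f(1) S(2)] S(1) by (simp add: set_integrable_def)
  have "AE x in lborel. indicator S x *\<^sub>R f x = 0"
    using integral_nonneg_eq_0_iff_AE[OF int] z f(2) by (simp add: set_lebesgue_integral_def)
  moreover define U where "U = S \<inter> f -` (- {0})"
  have U: "open U" "x \<in> U" using S x fx f(1) open_vimage[of "- {0}" f]
    by (auto simp: U_def continuous_on_open_vimage)
  ultimately have "AE x in lborel. x \<notin> U" by (auto simp: U_def indicator_def elim!: eventually_mono)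
  then have "U \<in> null_sets lborel" using U(1) by (simp add: AE_iff_null_sets[symmetric])
  then show False using open_lborel_pos U by blast
qed

lemma poly_le_square_int_zero:
  fixes q :: "real^'n \<Rightarrow> real"
  assumes q: "poly_le p q" and S: "open S" "bounded S" "S \<noteq> {}"
    and z: "set_lebesgue_integral lborel S (\<lambda>x. (q x)\<^sup>2) = 0"
  shows "q x = 0"
proof -
  obtain y where y: "y \<in> S" using S by blast
  show ?thesis
  proof (rule poly_le_zero_on_open[OF q S(1) y])
    fix x assume "x \<in> S"
    from set_integral_nonneg_eq_0[OF S(1,2) _ _ z this] show "q x = 0"
      using poly_le_continuous[OF q] by (simp add: continuous_intros)
  qed
qed

text \<open>Riesz representation in L2 of the ball: a Gram system yields \<open>P r\<close> with
  \<open>ip (P d) (P r) = d b\<close>, and Cauchy-Schwarz, obtained here by completing a square,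
  gives the bound. The Gram matrix is definite because a polynomial vanishing on a ball has zero
  coefficients.\<close>

lemma coef_square_le_integral:
  fixes c :: real
  assumes c: "c > 0" and b: "b \<in> (midx p :: ('n::finite \<Rightarrow> nat) set)"
  shows "\<exists>R>0. \<forall>d. (d b)\<^sup>2 \<le> R * set_lebesgue_integral lborel (ball 0 c) (\<lambda>x::real^'n. (\<Sum>a\<in>midx p. d a * mon a x)\<^sup>2)"
proof -
  let ?B = "ball 0 c :: (real^'n) set"
  define ip where "ip f g = set_lebesgue_integral lborel ?B (\<lambda>x. f x * g x)" for f g :: "real^'n \<Rightarrow> real"
  have int: "set_integrable lborel ?B f" if "continuous_on UNIV f" for f :: "real^'n \<Rightarrow> real"
    by (rule set_integrable_lborel_continuous[OF that]) auto
  have cm: "continuous_on UNIV (mon a)" if "a \<in> midx p" for a :: "'n \<Rightarrow> nat"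
    using poly_le_continuous[OF poly_le_mono[OF that]] .
  define P where "P d x = (\<Sum>a\<in>midx p. d a * mon a x)" for d and x :: "real^'n"
  have cP: "continuous_on UNIV (P d)" for d unfolding P_def by (intro continuous_intros cm)
  have ipP: "ip (P d) g = (\<Sum>a\<in>midx p. d a * ip (mon a) g)" if "continuous_on UNIV g" for d g
  proof -
    have "ip (P d) g = set_lebesgue_integral lborel ?B (\<lambda>x. \<Sum>a\<in>midx p. d a * (mon a x * g x))"
      by (simp add: ip_def P_def sum_distrib_right mult.assoc)
    also have "\<dots> = (\<Sum>a\<in>midx p. set_lebesgue_integral lborel ?B (\<lambda>x. d a * (mon a x * g x)))"
      by (intro set_lebesgue_integral_sum int continuous_intros cm that)
    finally show ?thesis by (simp add: ip_def)
  qed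
  have comm: "ip f g = ip g f" for f g by (simp add: ip_def mult.commute)
  define G where "G a b = ip (mon a) (mon b)" for a b
  have PP: "ip (P d) (P d) = (\<Sum>i\<in>midx p. \<Sum>j\<in>midx p. d i * G i j * d j)" for d
  proof -
    have "ip (P d) (P d) = (\<Sum>i\<in>midx p. d i * ip (mon i) (P d))" by (rule ipP[OF cP])
    also have "\<dots> = (\<Sum>i\<in>midx p. d i * (\<Sum>j\<in>midx p. d j * G i j))"
      by (intro sum.cong refl) (simp add: comm[of _ "P d"] ipP cm G_def comm[of "mon _" "mon _"])
    finally show ?thesis by (simp add: sum_distrib_left mult_ac)
  qed
  have pP: "poly_le p (P d)" for d unfolding P_def by (intro poly_le_sum poly_le_cmult poly_le_mono)
  have "\<exists>y. \<forall>i\<in>midx p. (\<Sum>j\<in>midx p. G i j * y j) = of_bool (i = b)"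
  proof (rule pd_system_solvable_const[OF finite_midx])
    fix x :: "('n \<Rightarrow> nat) \<Rightarrow> real" assume x: "\<exists>i\<in>midx p. x i \<noteq> 0"
    have "ip (P x) (P x) \<ge> 0" by (simp add: ip_def set_lebesgue_integral_def indicator_def)
    moreover have "ip (P x) (P x) \<noteq> 0"
    proof
      assume "ip (P x) (P x) = 0"
      then have "P x y = 0" for y
        using poly_le_square_int_zero[OF pP, of ?B x y] c by (simp add: ip_def power2_eq_square)
      then have "x a = 0" if "a \<in> midx p" for a
        using mon_independent[of "real ` {..p}" p x a] that by (simp add: P_def card_image)
      then show False using x by blast
    qed
    ultimately show "0 < (\<Sum>i\<in>midx p. \<Sum>j\<in>midx p. x i * G i j * x j)" unfolding PP by linarith
  qed
  then obtain r where r: "\<forall>i\<in>midx p. (\<Sum>j\<in>midx p. G i j * r j) = of_bool (i = b)" ..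
  have dual: "ip (P d) (P r) = d b" for d
  proof -
    have "ip (P d) (P r) = (\<Sum>i\<in>midx p. d i * ip (mon i) (P r))" by (rule ipP[OF cP])
    also have "\<dots> = (\<Sum>i\<in>midx p. d i * (\<Sum>j\<in>midx p. G i j * r j))"
      by (intro sum.cong refl) (simp add: comm[of _ "P r"] ipP cm G_def comm[of "mon _" "mon _"] mult.commute)
    also have "\<dots> = (\<Sum>i\<in>midx p. d i * of_bool (i = b))" using r by simp
    also have "\<dots> = d b" using b by (simp add: of_bool_def if_distrib finite_midx cong: if_cong)
    finally show ?thesis .
  qed
  have R0: "ip (P r) (P r) \<ge> 0" by (simp add: ip_def set_lebesgue_integral_def indicator_def)
  \<comment> \<open>The added 1 makes the constant positive whether or not \<open>P r\<close>
    vanishes.\<close>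
  define R where "R = ip (P r) (P r) + 1"
  have Rpos: "R > 0" using R0 by (simp add: R_def)
  have "(d b)\<^sup>2 \<le> R * ip (P d) (P d)" for d
  proof -
    \<comment> \<open>The value maximising \<open>2 * l * d b - l\<^sup>2 * R\<close>, with maximum
      \<open>(d b)\<^sup>2 / R\<close>.\<close>
    define l where "l = d b / R"
    define e where "e a = d a - l * r a" for a
    have "P e = (\<lambda>x. P d x - l * P r x)"
      by (simp add: P_def e_def fun_eq_iff left_diff_distrib sum_subtractf sum_distrib_left mult.assoc)
    then have "ip (P e) (P e) = set_lebesgue_integral lborel ?B (\<lambda>x. P d x * P d x - 2 * l * (P d x * P r x) + l\<^sup>2 * (P r x * P r x))"
      unfolding ip_def by (intro arg_cong[where f = "set_lebesgue_integral lborel ?B"] ext)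
        (simp add: algebra_simps power2_eq_square)
    also have "\<dots> = ip (P d) (P d) - 2 * l * ip (P d) (P r) + l\<^sup>2 * ip (P r) (P r)"
      unfolding ip_def
      by (subst set_integral_add; (subst set_integral_diff)?) (auto intro!: int continuous_intros cP)
    finally have "ip (P e) (P e) = ip (P d) (P d) - 2 * l * d b + l\<^sup>2 * (R - 1)"
      by (simp add: dual R_def)
    moreover have "ip (P e) (P e) \<ge> 0" by (simp add: ip_def set_lebesgue_integral_def indicator_def)
    ultimately have "2 * l * d b - l\<^sup>2 * R \<le> ip (P d) (P d)" using zero_le_power2[of l]
      unfolding right_diff_distrib mult_1_right by linarith
    moreover have "2 * l * d b - l\<^sup>2 * R = (d b)\<^sup>2 / R" using Rpos by (simp add: l_def power2_eq_square field_simps)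
    ultimately have "(d b)\<^sup>2 / R \<le> ip (P d) (P d)" by linarith
    then show ?thesis using Rpos by (simp add: pos_divide_le_eq mult.commute)
  qed
  then show ?thesis using Rpos by (intro exI[of _ R]) (simp add: ip_def P_def power2_eq_square)
qed

lemma set_integral_ball_affine:
  fixes f :: "real^'n \<Rightarrow> real"
  assumes f: "f \<in> borel_measurable borel" and h: "h > 0"
  shows "set_lebesgue_integral lborel (ball 0 c) (\<lambda>y. f (z + h *\<^sub>R y))
    = set_lebesgue_integral lborel (ball z (c * h)) f / h ^ CARD('n)"
proof -
  have m: "(\<lambda>x. indicator (ball z (c * h)) x *\<^sub>R f x) \<in> borel_measurable borel"
    using f by (intro borel_measurable_scaleR borel_measurable_indicator) auto
  have "set_lebesgue_integral lborel (ball z (c * h)) f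
      = integral\<^sup>L (density (distr lborel borel (\<lambda>x. z + h *\<^sub>R x)) (\<lambda>_. ennreal (h ^ CARD('n)))) (\<lambda>x. indicator (ball z (c * h)) x *\<^sub>R f x)"
    using lborel_affine[of h z] h by (simp add: set_lebesgue_integral_def)
  also have "\<dots> = integral\<^sup>L (distr lborel borel (\<lambda>x. z + h *\<^sub>R x)) (\<lambda>x. h ^ CARD('n) *\<^sub>R (indicator (ball z (c * h)) x *\<^sub>R f x))"
    using m h by (intro integral_density) auto
  also have "\<dots> = integral\<^sup>L lborel (\<lambda>x. h ^ CARD('n) *\<^sub>R (indicator (ball z (c * h)) (z + h *\<^sub>R x) *\<^sub>R f (z + h *\<^sub>R x)))"
    using m by (intro integral_distr) auto
  also have "\<dots> = h ^ CARD('n) * integral\<^sup>L lborel (\<lambda>x. indicator (ball 0 c) x *\<^sub>R f (z + h *\<^sub>R x))"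
  proof -
    have "indicator (ball z (c * h)) (z + h *\<^sub>R x) = (indicator (ball 0 c) x :: real)" for x
      using h by (auto simp: indicator_def dist_norm mult.commute)
    then show ?thesis by simp
  qed
  finally show ?thesis using h by (simp add: set_lebesgue_integral_def)
qed

text \<open>After rescaling to \<open>h = 1\<close> the coefficients are controlled by the L2 norm
  on the ball of radius \<open>c\<close>, and every monomial is at most 1 in absolute value on the
  unit ball. The power \<open>h ^ CARD('n)\<close> is the Jacobian of the rescaling.\<close>

lemma inverse_estimate:
  fixes c :: real
  assumes c: "c > 0"
  shows "\<exists>C>0. \<forall>(q :: real^'n \<Rightarrow> real) z h x. poly_le p q \<longrightarrow> h > 0 \<longrightarrow> x \<in> cball z h \<longrightarrow>
     (q x)\<^sup>2 \<le> C / h ^ CARD('n) * set_lebesgue_integral lborel (ball z (c * h)) (\<lambda>x. (q x)\<^sup>2)"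
proof -
  let ?M = "midx p :: ('n \<Rightarrow> nat) set"
  have "\<forall>b\<in>?M. \<exists>R>0. \<forall>d. (d b)\<^sup>2 \<le> R * set_lebesgue_integral lborel (ball 0 c) (\<lambda>x::real^'n. (\<Sum>a\<in>?M. d a * mon a x)\<^sup>2)"
    using coef_square_le_integral[OF c] by blast
  from bchoice[OF this] obtain R where R: "\<forall>b\<in>?M. R b > 0 \<and>
      (\<forall>d. (d b)\<^sup>2 \<le> R b * set_lebesgue_integral lborel (ball 0 c) (\<lambda>x::real^'n. (\<Sum>a\<in>?M. d a * mon a x)\<^sup>2))" ..
  define C where "C = real (card ?M) * (\<Sum>b\<in>?M. R b)"
  have zM: "(\<lambda>_. 0) \<in> ?M" by (simp add: midx_def)
  have C: "C > 0" unfolding C_def using R zM finite_midx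
    by (intro mult_pos_pos sum_pos) (auto simp: card_gt_0_iff)
  show ?thesis
  proof (intro exI[of _ C] conjI allI impI C)
    fix q :: "real^'n \<Rightarrow> real" and z x :: "real^'n" and h :: real
    assume q: "poly_le p q" and h: "h > 0" and x: "x \<in> cball z h"
    obtain d where d: "(\<lambda>y. q (z + h *\<^sub>R y)) = (\<lambda>y. \<Sum>a\<in>?M. d a * mon a y)"
      using poly_le_affine[OF q, of z h] by (rule poly_leE)
    define Q where "Q = set_lebesgue_integral lborel (ball 0 c) (\<lambda>y. (q (z + h *\<^sub>R y))\<^sup>2)"
    have dQ: "(d b)\<^sup>2 \<le> R b * Q" if "b \<in> ?M" for b
      unfolding Q_def fun_cong[OF d] using bspec[OF R that] by (elim conjE allE)
    define y where "y = (1 / h) *\<^sub>R (x - z)"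
    have y: "z + h *\<^sub>R y = x" using h by (simp add: y_def)
    have "norm y = norm (x - z) / h" unfolding y_def norm_scaleR using h by simp
    then have ny: "norm y \<le> 1" using x h by (simp add: dist_norm norm_minus_commute)
    have my: "\<bar>mon a y\<bar> \<le> 1" for a
    proof -
      have "\<bar>mon a y\<bar> = (\<Prod>i\<in>UNIV. \<bar>y $ i\<bar> ^ a i)" by (simp add: mon_def abs_prod power_abs)
      also have "\<dots> \<le> 1"
        using order_trans[OF component_le_norm_cart ny] by (intro prod_le_1) (auto intro: power_le_one)
      finally show ?thesis .
    qed
    have "(q x)\<^sup>2 = (\<Sum>a\<in>?M. d a * mon a y)\<^sup>2" using fun_cong[OF d, of y] y by simp
    also have "\<dots> \<le> (\<Sum>a\<in>?M. (d a * mon a y)\<^sup>2) * card ?M" by (rule sum_squared_le_sum_of_squares)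
    also have "\<dots> \<le> (\<Sum>a\<in>?M. R a * Q) * card ?M"
    proof (intro mult_right_mono sum_mono)
      fix a assume a: "a \<in> ?M"
      have "(d a * mon a y)\<^sup>2 \<le> (d a)\<^sup>2 * 1"
        unfolding power_mult_distrib using my[of a] by (intro mult_left_mono) (auto simp: abs_square_le_1)
      then show "(d a * mon a y)\<^sup>2 \<le> R a * Q" using dQ[OF a] by simp
    qed simp
    also have "\<dots> = C * Q" unfolding C_def sum_distrib_right[symmetric] by (simp only: mult_ac)
    also have "Q = set_lebesgue_integral lborel (ball z (c * h)) (\<lambda>x. (q x)\<^sup>2) / h ^ CARD('n)"
      unfolding Q_def using poly_le_borel_measurable[OF q]
      by (intro set_integral_ball_affine[of "\<lambda>x. (q x)\<^sup>2"] h) auto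
    finally show "(q x)\<^sup>2 \<le> C / h ^ CARD('n) * set_lebesgue_integral lborel (ball z (c * h)) (\<lambda>x. (q x)\<^sup>2)"
      by simp
  qed
qed

section \<open>Geometry of admissible meshes\<close>

lemma diameter_open_pos:
  fixes k :: "'a::euclidean_space set"
  assumes k: "open k" "bounded k" "k \<noteq> {}" shows "diameter k > 0"
proof -
  obtain x where x: "x \<in> k" using k by blast
  then obtain e where e: "e > 0" "ball x e \<subseteq> k" using k(1) openE by blast
  obtain b :: 'a where b: "b \<in> Basis" using nonempty_Basis by blast
  define y where "y = x + (e / 2) *\<^sub>R b"
  have d: "dist x y = e / 2" using e b by (simp add: y_def dist_norm)
  then have "y \<in> k" using e by auto
  then have "e / 2 \<le> diameter k" using diameter_bounded_bound[OF k(2) x] d by metis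
  then show ?thesis using e by linarith
qed

lemma admissible_meshD:
  fixes K :: "(real^'n) set set"
  assumes "admissible_mesh Om Cv m Cs \<rho> Cq K"
  shows "finite K \<and> (\<forall>k\<in>K. open k \<and> k \<noteq> {} \<and> k \<subseteq> Om \<and> interior (closure k) = k) \<and>
     (\<forall>k1\<in>K. \<forall>k2\<in>K. k1 \<noteq> k2 \<longrightarrow> k1 \<inter> k2 = {}) \<and>
     (\<forall>k\<in>K. measure lborel k \<ge> Cv * diameter k ^ CARD('n)) \<and>
     (\<forall>k1\<in>K. \<forall>k2\<in>K. diameter k1 \<le> Cq * diameter k2)"
  using assms unfolding admissible_mesh_def by simp

text \<open>Squeezes each element between concentric balls of comparable radius, the setting of the
  inverse estimate. A simplex of the sub-triangulation contains a ball proportional to its own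
  diameter, and this diameter is comparable to that of the element because the simplex carries a
  fixed fraction of its volume.\<close>

lemma admissible_mesh_ball:
  fixes Om :: "(real^'n) set"
  assumes Om: "bounded Om" and const: "Cv > 0" "Cs > 0" "\<rho> > 0"
  shows "\<exists>c1>0. \<forall>K k. admissible_mesh Om Cv m Cs \<rho> Cq K \<longrightarrow> k \<in> K \<longrightarrow>
     diameter k > 0 \<and>
     (\<exists>z. ball z (c1 * diameter k) \<subseteq> k \<and> closure k \<subseteq> cball z (diameter k)) \<and>
     emeasure surf (frontier k) \<le> ennreal (real m * frontier_const CARD('n) * diameter k ^ (CARD('n) - 1))"
proof -
  let ?d = "CARD('n)"
  define V where "V = unit_ball_vol (real ?d)"
  have V: "V > 0" by (simp add: V_def)
  \<comment> \<open>A simplex of diameter below \<open>c2 * ?h\<close> would have volume less than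
    \<open>V * (c2 * ?h) ^ ?d\<close>, which is at most \<open>Cs * Cv * ?h ^ ?d\<close>. The cap at
    1 provides \<open>c2 ^ ?d \<le> c2\<close>.\<close>
  define c2 where "c2 = min 1 (Cs * Cv / V)"
  have c2: "0 < c2" "c2 \<le> 1" using const V by (auto simp: c2_def)
  define c1 where "c1 = \<rho> * c2"
  have c1: "c1 > 0" using const c2 by (simp add: c1_def)
  have fc: "frontier_const ?d \<ge> 0"
    unfolding frontier_const_def by (intro mult_nonneg_nonneg hausdorff_const_nonneg) auto
  show ?thesis
  proof (intro exI[of _ c1] conjI allI impI c1)
    fix K k assume adm: "admissible_mesh Om Cv m Cs \<rho> Cq K" and kK: "k \<in> K"
    let ?h = "diameter k"
    have k: "open k" "k \<noteq> {}" "k \<subseteq> Om" "interior (closure k) = k" "measure lborel k \<ge> Cv * ?h ^ ?d"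
      using admissible_meshD[OF adm] kK by simp_all
    have bk: "bounded k" using Om k(3) bounded_subset by blast
    show h: "?h > 0" by (rule diameter_open_pos[OF k(1) bk k(2)])
    have "\<forall>k\<in>K. \<exists>S. finite S \<and> card S \<le> m \<and> closure k = \<Union>S \<and>
             (\<forall>s\<in>S. shape_reg_simplex \<rho> s \<and> measure lborel s \<ge> Cs * measure lborel k) \<and>
             (\<forall>s1\<in>S. \<forall>s2\<in>S. s1 \<noteq> s2 \<longrightarrow> interior s1 \<inter> interior s2 = {})"
      using adm unfolding admissible_mesh_def by (elim conjE)
    from bspec[OF this kK] obtain S where S: "finite S" "card S \<le> m" "closure k = \<Union>S"
      and S4: "\<forall>s\<in>S. shape_reg_simplex \<rho> s \<and> measure lborel s \<ge> Cs * measure lborel k"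
      by (elim exE conjE)
    note S = S bspec[OF S4]
    have sx: "convex s \<and> compact s \<and> s \<noteq> {}" if "s \<in> S" for s
    proof -
      have "int ?d simplex s" using S(4)[OF that] by (simp add: shape_reg_simplex_def)
      then show ?thesis using convex_simplex compact_simplex simplex_empty[of "int ?d"] by force
    qed
    have "closure k \<noteq> {}" using k by simp
    then obtain s where s: "s \<in> S" using S(3) by auto
    obtain z where z: "ball z (\<rho> * diameter s) \<subseteq> s" using S(4)[OF s] by (auto simp: shape_reg_simplex_def)
    have bs: "bounded s" using sx[OF s] compact_imp_bounded by blast
    have ds: "diameter s \<ge> c2 * ?h"
    proof (rule ccontr)
      assume "\<not> ?thesis"
      then have lt: "diameter s < c2 * ?h" by simp
      obtain w where w: "w \<in> s" using sx[OF s] by blast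
      have "s \<subseteq> cball w (diameter s)" using diameter_bounded_bound[OF bs w] by auto
      then have "measure lborel s \<le> measure lborel (cball w (diameter s))"
        using sx[OF s] by (intro measure_mono_fmeasurable fmeasurable_compact) (auto intro: borel_compact)
      also have "\<dots> = V * diameter s ^ ?d"
        using content_cball[of "diameter s" w] diameter_ge_0[OF bs] by (simp add: V_def)
      also have "\<dots> < V * (c2 * ?h) ^ ?d"
        using V lt diameter_ge_0[OF bs] by (intro mult_strict_left_mono power_strict_mono) auto
      also have "\<dots> \<le> V * (c2 * ?h ^ ?d)"
      proof -
        have "c2 ^ ?d \<le> c2 ^ 1" using c2 by (intro power_decreasing) (auto simp: Suc_le_eq)
        then show ?thesis using V h by (simp add: power_mult_distrib)
      qed
      also have "\<dots> \<le> Cs * Cv * ?h ^ ?d"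
      proof -
        have "V * c2 \<le> V * (Cs * Cv / V)" using V by (intro mult_left_mono) (auto simp: c2_def)
        then have "V * c2 \<le> Cs * Cv" using V by simp
        then show ?thesis using h mult_right_mono[of "V * c2" "Cs * Cv" "?h ^ ?d"] by (simp add: mult.assoc)
      qed
      also have "\<dots> \<le> Cs * measure lborel k" using const k(5) by (simp add: mult.assoc)
      finally show False using S(4)[OF s] by simp
    qed
    have bk': "ball z (c1 * ?h) \<subseteq> k"
    proof -
      have "ball z (c1 * ?h) \<subseteq> ball z (\<rho> * diameter s)"
        using ds const by (intro subset_ball) (simp add: c1_def)
      also have "\<dots> \<subseteq> interior s" by (rule interior_maximal[OF z open_ball])
      also have "\<dots> \<subseteq> interior (closure k)" using s S(3) by (intro interior_mono) auto
      finally show ?thesis using k by simp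
    qed
    have "z \<in> k" using bk' c1 h by (meson centre_in_ball mult_pos_pos subsetD)
    then have zc: "z \<in> closure k" using closure_subset by blast
    have sub: "closure k \<subseteq> cball z ?h"
      using diameter_bounded_bound[OF bounded_closure[OF bk] zc] by (auto simp: diameter_closure[OF bk])
    show "\<exists>z. ball z (c1 * ?h) \<subseteq> k \<and> closure k \<subseteq> cball z ?h" using bk' sub by blast
    have "emeasure surf (frontier k) \<le> ennreal (real (card S) * (frontier_const ?d * ?h ^ (?d - 1)))"
      by (rule emeasure_surf_frontier_le[OF k(1,4) S(1,3) sx sub h])
    also have "\<dots> \<le> ennreal (real m * frontier_const ?d * ?h ^ (?d - 1))"
      using S(2) fc h by (intro ennreal_leI) (auto simp: mult.assoc intro!: mult_right_mono)
    finally show "emeasure surf (frontier k) \<le> ennreal (real m * frontier_const ?d * ?h ^ (?d - 1))" .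
  qed
qed

text \<open>A packing argument: the neighbours are disjoint, each has volume at least
  \<open>Cv * (?h / Cq) ^ ?d\<close> by quasi-uniformity, and all lie in one ball of radius
  \<open>(1 + Cq) * ?h\<close>. The powers of the diameter cancel in the quotient.\<close>

lemma admissible_mesh_neighbours:
  fixes Om :: "(real^'n) set"
  assumes Om: "bounded Om" and const: "Cv > 0" "Cq \<ge> 1"
  shows "\<exists>N::nat. \<forall>K k. admissible_mesh Om Cv m Cs \<rho> Cq K \<longrightarrow> k \<in> K \<longrightarrow>
     card {k'\<in>K. closure k \<inter> closure k' \<noteq> {}} \<le> N"
proof -
  let ?d = "CARD('n)"
  define V where "V = unit_ball_vol (real ?d)"
  have V: "V > 0" by (simp add: V_def)
  define N where "N = nat \<lceil>V * (1 + Cq) ^ ?d * Cq ^ ?d / Cv\<rceil>"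
  show ?thesis
  proof (intro exI[of _ N] allI impI)
    fix K k assume adm: "admissible_mesh Om Cv m Cs \<rho> Cq K" and kK: "k \<in> K"
    let ?h = "diameter k"
    have el: "open k'" "bounded k'" "measure lborel k' \<ge> Cv * diameter k' ^ ?d" "diameter k' \<le> Cq * ?h" "?h \<le> Cq * diameter k'"
      if "k' \<in> K" for k'
    proof -
      have "open k' \<and> k' \<subseteq> Om" and 1: "measure lborel k' \<ge> Cv * diameter k' ^ ?d" "diameter k' \<le> Cq * ?h" "?h \<le> Cq * diameter k'"
        using admissible_meshD[OF adm] kK that by simp_all
      then show "open k'" "bounded k'" using Om bounded_subset by blast+
      show "measure lborel k' \<ge> Cv * diameter k' ^ ?d" "diameter k' \<le> Cq * ?h" "?h \<le> Cq * diameter k'" by fact+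
    qed
    have "k \<noteq> {}" using admissible_meshD[OF adm] kK by simp
    then have h: "?h > 0" using diameter_open_pos el(1,2)[OF kK] by blast
    define A where "A = {k'\<in>K. closure k \<inter> closure k' \<noteq> {}}"
    have finA: "finite A" and disj: "\<And>k1 k2. k1 \<in> K \<Longrightarrow> k2 \<in> K \<Longrightarrow> k1 \<noteq> k2 \<Longrightarrow> k1 \<inter> k2 = {}"
      using admissible_meshD[OF adm] by (simp_all add: A_def)
    obtain z where z: "z \<in> k" using \<open>k \<noteq> {}\<close> by blast
    have sub: "k' \<subseteq> cball z ((1 + Cq) * ?h)" if "k' \<in> A" for k'
    proof
      fix x assume x: "x \<in> k'"
      obtain y where y: "y \<in> closure k" "y \<in> closure k'" using \<open>k' \<in> A\<close> by (auto simp: A_def)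
      have k': "k' \<in> K" using that by (simp add: A_def)
      have "dist z y \<le> ?h"
        using diameter_bounded_bound[OF bounded_closure[OF el(2)[OF kK]], of z y] y z closure_subset
        by (auto simp: diameter_closure[OF el(2)[OF kK]])
      moreover have "dist y x \<le> diameter k'"
        using diameter_bounded_bound[OF bounded_closure[OF el(2)[OF k']], of y x] y x closure_subset
        by (auto simp: diameter_closure[OF el(2)[OF k']])
      ultimately have "dist z x \<le> ?h + Cq * ?h" using el(4)[OF k'] dist_triangle[of z x y] by linarith
      then show "x \<in> cball z ((1 + Cq) * ?h)" by (simp add: distrib_right)
    qed
    have "real (card A) * (Cv * (?h / Cq) ^ ?d) = (\<Sum>k'\<in>A. Cv * (?h / Cq) ^ ?d)" by simp
    also have "\<dots> \<le> (\<Sum>k'\<in>A. measure lborel k')"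
    proof (rule sum_mono)
      fix k' assume "k' \<in> A"
      then have k': "k' \<in> K" by (simp add: A_def)
      have "(?h / Cq) ^ ?d \<le> diameter k' ^ ?d"
        using el(5)[OF k'] const h by (intro power_mono) (auto simp: field_simps)
      then have "Cv * (?h / Cq) ^ ?d \<le> Cv * diameter k' ^ ?d" using const by simp
      then show "Cv * (?h / Cq) ^ ?d \<le> measure lborel k'" using el(3)[OF k'] by linarith
    qed
    also have "\<dots> = measure lborel (\<Union>k'\<in>A. k')"
    proof (rule measure_finite_Union[OF finA, symmetric])
      show "(\<lambda>x. x) ` A \<subseteq> sets lborel" using el(1) by (auto simp: A_def)
      show "disjoint_family_on (\<lambda>k'. k') A" using disj by (auto simp: disjoint_family_on_def A_def)
      show "emeasure lborel k' \<noteq> \<infinity>" if "k' \<in> A" for k'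
        using emeasure_bounded_finite[OF el(2)] that by (simp add: A_def less_top[symmetric])
    qed
    also have "\<dots> \<le> measure lborel (cball z ((1 + Cq) * ?h))"
      using sub el(1) by (intro measure_mono_fmeasurable fmeasurable_compact)
        (auto simp: A_def intro!: borel_open open_UN)
    also have "\<dots> = V * ((1 + Cq) * ?h) ^ ?d"
      using content_cball[of "(1 + Cq) * ?h" z] const h by (simp add: V_def)
    finally have "(real (card A) * Cv / Cq ^ ?d) * ?h ^ ?d \<le> (V * (1 + Cq) ^ ?d) * ?h ^ ?d"
      by (simp add: power_mult_distrib power_divide)
    then have "real (card A) * Cv / Cq ^ ?d \<le> V * (1 + Cq) ^ ?d"
      by (rule mult_right_le_imp_le) (use h in simp)
    then have "real (card A) \<le> V * (1 + Cq) ^ ?d * Cq ^ ?d / Cv"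
      using const by (simp add: field_simps)
    then show "card A \<le> N" unfolding N_def by linarith
  qed
qed

section \<open>The discrete space and its bilinear forms\<close>

text \<open>The property from which \<open>onormal\<close> selects a vector, named so that the
  choice can be shown to be forced.\<close>

definition locally_flat :: "(real^'n) set \<Rightarrow> real^'n \<Rightarrow> real^'n \<Rightarrow> bool" where
  "locally_flat k x n \<longleftrightarrow> norm n = 1 \<and> (\<exists>e>0. ball x e \<inter> k = ball x e \<inter> {y. (y - x) \<bullet> n < 0})"

lemma onormal_locally_flat:
  "onormal k x = (if \<exists>n. locally_flat k x n then SOME n. locally_flat k x n else 0)"
  unfolding onormal_def locally_flat_def by (rule refl)

lemma locally_flat_onormal: "\<exists>n. locally_flat k x n \<Longrightarrow> locally_flat k x (onormal k x)"
  unfolding onormal_locally_flat by (simp only: if_True simp_thms) (rule someI_ex)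

lemma norm_onormal_le: "norm (onormal k x) \<le> 1"
proof (cases "\<exists>n. locally_flat k x n")
  case True
  from locally_flat_onormal[OF this] show ?thesis by (simp add: locally_flat_def)
qed (simp add: onormal_locally_flat)

lemma locally_flatE:
  assumes "locally_flat k x n"
  obtains e where "e > 0" "n \<bullet> n = 1" "\<And>w. dist x w < e \<Longrightarrow> w \<in> k \<longleftrightarrow> (w - x) \<bullet> n < 0"
proof -
  obtain e where e: "e > 0" "ball x e \<inter> k = ball x e \<inter> {y. (y - x) \<bullet> n < 0}" and n: "n \<bullet> n = 1"
    using assms by (auto simp: locally_flat_def norm_eq_1)
  have "w \<in> k \<longleftrightarrow> (w - x) \<bullet> n < 0" if "dist x w < e" for w
  proof -
    have "w \<in> ball x e \<inter> k \<longleftrightarrow> w \<in> ball x e \<inter> {y. (y - x) \<bullet> n < 0}" by (simp only: e(2))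
    then show ?thesis using that by simp
  qed
  then show ?thesis using that e(1) n by blast
qed

text \<open>Moving from \<open>x\<close> along \<open>n' - n\<close> enters the half-space of
  \<open>n\<close> and leaves that of \<open>n'\<close>, so two distinct unit normals would place
  one nearby point both inside and outside \<open>k\<close>.\<close>

lemma locally_flat_unique:
  assumes "locally_flat k x n" "locally_flat k x n'" shows "n = n'"
proof (rule ccontr)
  assume ne: "n \<noteq> n'"
  obtain e where e: "e > 0" "\<And>w. dist x w < e \<Longrightarrow> w \<in> k \<longleftrightarrow> (w - x) \<bullet> n < 0" and n: "n \<bullet> n = 1"
    using locally_flatE[OF assms(1)] by metis
  obtain e' where e': "e' > 0" "\<And>w. dist x w < e' \<Longrightarrow> w \<in> k \<longleftrightarrow> (w - x) \<bullet> n' < 0" and n': "n' \<bullet> n' = 1"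
    using locally_flatE[OF assms(2)] by metis
  have "0 < (n - n') \<bullet> (n - n')" using ne by simp
  then have lt: "n \<bullet> n' < 1" using n n' by (simp add: inner_diff_left inner_diff_right inner_commute)
  define s where "s = min e e' / (2 * norm (n' - n))"
  define y where "y = x + s *\<^sub>R (n' - n)"
  have nn: "norm (n' - n) > 0" using ne by simp
  have s: "s > 0" using e(1) e'(1) nn by (simp add: s_def)
  have "dist x y = min e e' / 2" using s nn by (simp add: y_def dist_norm) (simp add: s_def)
  then have b: "dist x y < e" "dist x y < e'" using e(1) e'(1) by auto
  have "(y - x) \<bullet> n = s * (n \<bullet> n' - 1)"
    by (simp add: y_def inner_diff_left n inner_commute[of n' n])
  then have "(y - x) \<bullet> n < 0" using s lt by (simp add: mult_pos_neg)
  then have "y \<in> k" using e(2)[OF b(1)] by simp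
  moreover have "(y - x) \<bullet> n' = s * (1 - n \<bullet> n')"
    by (simp add: y_def inner_diff_left n')
  then have "\<not> (y - x) \<bullet> n' < 0" using s lt by (simp add: not_less)
  ultimately show False using e'(2)[OF b(2)] by simp
qed

lemma onormal_eqI: "locally_flat k x n \<Longrightarrow> onormal k x = n"
  by (rule locally_flat_unique[OF locally_flat_onormal]) (rule exI)

lemma locally_flat_frontier:
  assumes "locally_flat k x n" shows "x \<in> frontier k"
proof -
  obtain e where e: "e > 0" "\<And>w. dist x w < e \<Longrightarrow> w \<in> k \<longleftrightarrow> (w - x) \<bullet> n < 0" and n: "n \<bullet> n = 1"
    using locally_flatE[OF assms] by metis
  have "x \<notin> k" using e(2)[of x] e(1) by simp
  moreover have "x \<in> closure k"
    unfolding closure_approachable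
  proof (intro allI impI)
    fix d :: real assume d: "d > 0"
    define y where "y = x - (min d e / 2) *\<^sub>R n"
    have "dist x y = min d e / 2" using d e(1) n by (simp add: y_def dist_norm norm_eq_1)
    then have y: "dist x y < e" "dist y x < d" using d e(1) by (auto simp: dist_commute)
    have "(y - x) \<bullet> n = - (min d e / 2)" using n by (simp add: y_def)
    then have "(y - x) \<bullet> n < 0" using d e(1) by simp
    then show "\<exists>y\<in>k. dist y x < d" using e(2)[OF y(1)] y(2) by blast
  qed
  moreover have "interior k \<subseteq> k" by (rule interior_subset)
  ultimately show ?thesis unfolding frontier_def by blast
qed

text \<open>Near a flat point the frontier is part of the hyperplane, so the half-space description
  can be recentred at any such frontier point with the same normal.\<close>

lemma locally_flat_nearby:
  assumes k: "open k" and fl: "locally_flat k x n"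
  shows "\<exists>e>0. \<forall>y\<in>ball x e \<inter> frontier k. locally_flat k y n"
proof -
  obtain e where e: "e > 0" "\<And>w. dist x w < e \<Longrightarrow> w \<in> k \<longleftrightarrow> (w - x) \<bullet> n < 0" and n: "n \<bullet> n = 1"
    using locally_flatE[OF fl] by metis
  have "locally_flat k y n" if y: "dist x y < e" "y \<in> frontier k" for y
  proof -
    have yk: "y \<notin> k" "y \<in> closure k" using y(2) k by (auto simp: frontier_def interior_open)
    have "\<not> (y - x) \<bullet> n < 0" using yk(1) e(2)[OF y(1)] by simp
    moreover have "\<not> (y - x) \<bullet> n > 0"
    proof
      assume gt: "(y - x) \<bullet> n > 0"
      \<comment> \<open>The part of the ball strictly beyond the hyperplane is open and misses
        \<open>k\<close>, hence it misses \<open>closure k\<close> as well.\<close>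
      define U where "U = ball x e \<inter> {y. x \<bullet> n < y \<bullet> n}"
      have opU: "open U" unfolding U_def
        by (intro open_Int open_ball open_Collect_less continuous_intros)
      have "y \<in> U" using y gt by (simp add: U_def inner_diff_left)
      then have "U \<inter> closure k \<noteq> {}" using yk(2) by blast
      then have "U \<inter> k \<noteq> {}" using open_Int_closure_eq_empty[OF opU] by simp
      then obtain w where w: "w \<in> k" "w \<in> U" by blast
      have "dist x w < e" using w(2) by (simp add: U_def)
      then have "(w - x) \<bullet> n < 0" using e(2) w(1) by simp
      then show False using w(2) by (simp add: U_def inner_diff_left)
    qed
    ultimately have z: "(y - x) \<bullet> n = 0" by simp
    have d: "e - dist x y > 0" using y(1) by simp
    have "w \<in> ball y (e - dist x y) \<inter> k \<longleftrightarrow> w \<in> ball y (e - dist x y) \<inter> {w. (w - y) \<bullet> n < 0}" for w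
    proof -
      have "(w - y) \<bullet> n = (w - x) \<bullet> n" using z by (simp add: inner_diff_left)
      moreover have "dist x w < e" if "dist y w < e - dist x y"
        using that dist_triangle[of x w y] by linarith
      ultimately show ?thesis using e(2)[of w] by auto
    qed
    then have "ball y (e - dist x y) \<inter> k = ball y (e - dist x y) \<inter> {w. (w - y) \<bullet> n < 0}" by blast
    then show ?thesis using n d unfolding locally_flat_def norm_eq_1 by blast
  qed
  then show ?thesis using e(1) by auto
qed

text \<open>The flat points form the intersection of an open set with the frontier, hence a Borel
  set; on it the normal is locally constant, and elsewhere it is 0.\<close>

lemma borel_measurable_onormal:
  fixes k :: "(real^'n) set"
  assumes k: "open k" shows "onormal k \<in> borel_measurable borel"
proof -
  define D where "D = {x. \<exists>n. locally_flat k x n}"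
  define U where "U = \<Union>{ball x e | x e. \<exists>n. \<forall>y\<in>ball x e \<inter> frontier k. locally_flat k y n}"
  have D: "D = U \<inter> frontier k"
  proof
    show "D \<subseteq> U \<inter> frontier k"
    proof
      fix x assume "x \<in> D"
      then obtain n where n: "locally_flat k x n" by (auto simp: D_def)
      then show "x \<in> U \<inter> frontier k"
      proof -
        obtain e where e: "e > 0" "\<forall>y\<in>ball x e \<inter> frontier k. locally_flat k y n"
          using locally_flat_nearby[OF k n] by blast
        then have "x \<in> U" unfolding U_def by (intro UnionI[of "ball x e"]) auto
        then show ?thesis using locally_flat_frontier[OF n] by blast
      qed
    qed
  qed (auto simp: U_def D_def)
  have "open U" unfolding U_def by (intro open_Union) auto
  then have Db: "D \<in> sets borel" unfolding D by auto
  have "continuous_on D (onormal k)"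
    unfolding continuous_on_iff
  proof (intro ballI allI impI)
    fix x e assume x: "x \<in> D" and e: "(e::real) > 0"
    obtain n where n: "locally_flat k x n" using x by (auto simp: D_def)
    obtain d where d: "d > 0" "\<And>y. y \<in> ball x d \<inter> frontier k \<Longrightarrow> locally_flat k y n"
      using locally_flat_nearby[OF k n] by blast
    have "dist (onormal k y) (onormal k x) < e" if "y \<in> D" "dist y x < d" for y
    proof -
      have "locally_flat k y n" using d(2)[of y] that D by (auto simp: dist_commute)
      then show ?thesis using e by (simp add: onormal_eqI[OF n] onormal_eqI[of k y n])
    qed
    then show "\<exists>d>0. \<forall>y\<in>D. dist y x < d \<longrightarrow> dist (onormal k y) (onormal k x) < e" using d(1) by blast
  qed
  then have "(\<lambda>x. if x \<in> D then onormal k x else 0) \<in> borel_measurable borel"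
    by (intro borel_measurable_continuous_on_if Db) auto
  moreover have "(\<lambda>x. if x \<in> D then onormal k x else 0) = onormal k"
    by (auto simp: D_def onormal_locally_flat fun_eq_iff)
  ultimately show ?thesis by simp
qed

text \<open>Face terms are integrable because they are products of Borel functions that are bounded
  on bounded sets; this class of functions is closed under the operations needed.\<close>

definition locally_bounded_borel :: "('a::euclidean_space \<Rightarrow> 'b::euclidean_space) \<Rightarrow> bool" where
  "locally_bounded_borel g \<longleftrightarrow> g \<in> borel_measurable borel \<and> (\<forall>S. bounded S \<longrightarrow> bounded (g ` S))"

lemma locally_bounded_borel_continuous:
  assumes "continuous_on UNIV g" shows "locally_bounded_borel g"
  unfolding locally_bounded_borel_def
proof (intro conjI allI impI)
  show "g \<in> borel_measurable borel" by (rule borel_measurable_continuous_onI[OF assms])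
  fix S :: "'a set" assume "bounded S"
  then have "compact (closure S)" by (simp add: compact_closure)
  then have "bounded (g ` closure S)"
    using assms by (intro compact_imp_bounded compact_continuous_image) (auto intro: continuous_on_subset)
  then show "bounded (g ` S)" by (rule bounded_subset) (use closure_subset in blast)
qed

lemma locally_bounded_borel_onormal: "open k \<Longrightarrow> locally_bounded_borel (onormal k)"
  unfolding locally_bounded_borel_def using borel_measurable_onormal norm_onormal_le
  by (auto intro!: boundedI)

lemma locally_bounded_borelE:
  assumes "locally_bounded_borel f" "bounded S"
  obtains B where "B > 0" "\<And>x. x \<in> S \<Longrightarrow> norm (f x) \<le> B"
proof -
  have "bounded (f ` S)" using assms by (simp add: locally_bounded_borel_def)
  then obtain B where "B > 0" "\<forall>y\<in>f ` S. norm y \<le> B" unfolding bounded_pos by blast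
  then show ?thesis using that by blast
qed

lemma locally_bounded_borel_add:
  assumes "locally_bounded_borel f" "locally_bounded_borel g"
  shows "locally_bounded_borel (\<lambda>x. f x + g x)"
  using assms unfolding locally_bounded_borel_def by (auto intro!: bounded_plus_comp)

lemma locally_bounded_borel_scaleR:
  assumes "locally_bounded_borel f" "locally_bounded_borel g"
  shows "locally_bounded_borel (\<lambda>x. f x *\<^sub>R g x)"
  unfolding locally_bounded_borel_def
proof (intro conjI allI impI)
  show "(\<lambda>x. f x *\<^sub>R g x) \<in> borel_measurable borel"
    using assms by (auto simp: locally_bounded_borel_def)
  fix S :: "'a set" assume S: "bounded S"
  obtain B where B: "B > 0" "\<And>x. x \<in> S \<Longrightarrow> norm (f x) \<le> B"
    using locally_bounded_borelE[OF assms(1) S] by blast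
  obtain C where C: "C > 0" "\<And>x. x \<in> S \<Longrightarrow> norm (g x) \<le> C"
    using locally_bounded_borelE[OF assms(2) S] by blast
  show "bounded ((\<lambda>x. f x *\<^sub>R g x) ` S)"
  proof (rule boundedI)
    fix y assume "y \<in> (\<lambda>x. f x *\<^sub>R g x) ` S"
    then obtain x where x: "x \<in> S" "y = f x *\<^sub>R g x" by blast
    have "norm (f x) * norm (g x) \<le> B * C"
      using B(1) by (intro mult_mono B(2) C(2) x(1)) auto
    then show "norm y \<le> B * C" by (simp add: x)
  qed
qed

lemma locally_bounded_borel_const: "locally_bounded_borel (\<lambda>_. c)"
  by (intro locally_bounded_borel_continuous continuous_intros)

lemma locally_bounded_borel_inner:
  assumes "locally_bounded_borel f" "locally_bounded_borel g"
  shows "locally_bounded_borel (\<lambda>x. f x \<bullet> g x)"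
  unfolding locally_bounded_borel_def
proof (intro conjI allI impI)
  show "(\<lambda>x. f x \<bullet> g x) \<in> borel_measurable borel"
    using assms by (auto simp: locally_bounded_borel_def)
  fix S :: "'a set" assume S: "bounded S"
  obtain B where B: "B > 0" "\<And>x. x \<in> S \<Longrightarrow> norm (f x) \<le> B"
    using locally_bounded_borelE[OF assms(1) S] by blast
  obtain C where C: "C > 0" "\<And>x. x \<in> S \<Longrightarrow> norm (g x) \<le> C"
    using locally_bounded_borelE[OF assms(2) S] by blast
  show "bounded ((\<lambda>x. f x \<bullet> g x) ` S)"
  proof (rule boundedI)
    fix y assume "y \<in> (\<lambda>x. f x \<bullet> g x) ` S"
    then obtain x where x: "x \<in> S" "y = f x \<bullet> g x" by blast
    have "norm (f x) * norm (g x) \<le> B * C"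
      using B(1) by (intro mult_mono B(2) C(2) x(1)) auto
    then show "norm y \<le> B * C" using Cauchy_Schwarz_ineq2[of "f x" "g x"] by (simp add: x)
  qed
qed

lemma locally_bounded_borel_integrable_surf:
  fixes f :: "real^'n \<Rightarrow> real"
  assumes f: "locally_bounded_borel f" and F: "F \<in> sets borel" "bounded F" "emeasure surf F < \<infinity>"
  shows "set_integrable surf F f"
proof -
  obtain B where "B > 0" "\<And>x. x \<in> F \<Longrightarrow> norm (f x) \<le> B"
    using locally_bounded_borelE[OF f F(2)] by blast
  then show ?thesis
    using f F unfolding set_integrable_def
    by (intro integrableI_bounded_set_indicator[where B = B]) (auto simp: locally_bounded_borel_def)
qed

lemma poly_le_grad_continuous:
  fixes f :: "real^'n \<Rightarrow> real"
  assumes "poly_le p f" shows "continuous_on S (grad f)"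
proof -
  have "continuous_on S (\<lambda>x. \<chi> i. grad f x $ i)"
    using poly_le_grad[OF assms] by (intro continuous_on_vec_lambda poly_le_continuous)
  then show ?thesis by simp
qed

lemma Vh_add: "Vh p K u \<Longrightarrow> Vh p K v \<Longrightarrow> Vh p K (\<lambda>k x. u k x + v k x)"
  by (simp add: Vh_def poly_le_add)

lemma Vh_cmult: "Vh p K u \<Longrightarrow> Vh p K (\<lambda>k x. r * u k x)"
  by (simp add: Vh_def poly_le_cmult)

lemma Vh_sum: "(\<And>i. i \<in> I \<Longrightarrow> Vh p K (u i)) \<Longrightarrow> Vh p K (\<lambda>k x. \<Sum>i\<in>I. u i k x)"
  by (simp add: Vh_def poly_le_sum)

section \<open>Face sums and bilinear forms on a fixed mesh\<close>

text \<open>What the algebra of the forms needs of a mesh. Of the surface measure only its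
  finiteness on element boundaries is recorded; its size enters later, with the stability
  estimate.\<close>

locale dg_mesh =
  fixes Om :: "(real^'n) set" and K :: "(real^'n) set set" and p :: nat
  assumes finite_K: "finite K"
    and open_Om: "open Om"
    and el: "\<And>k. k \<in> K \<Longrightarrow> open k" "\<And>k. k \<in> K \<Longrightarrow> k \<noteq> {}" "\<And>k. k \<in> K \<Longrightarrow> bounded k" "\<And>k. k \<in> K \<Longrightarrow> k \<subseteq> Om"
    and disjoint: "\<And>k1 k2. k1 \<in> K \<Longrightarrow> k2 \<in> K \<Longrightarrow> k1 \<noteq> k2 \<Longrightarrow> k1 \<inter> k2 = {}"
    and frontier_finite: "\<And>k. k \<in> K \<Longrightarrow> emeasure surf (frontier k) < \<infinity>"
begin

lemma interior_face_subset:
  assumes "k1 \<in> K" "k2 \<in> K" "k1 \<noteq> k2"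
  shows "closure k1 \<inter> closure k2 \<subseteq> frontier k1" "closure k1 \<inter> closure k2 \<subseteq> frontier k2"
proof -
  have "k1 \<inter> closure k2 = {}" "k2 \<inter> closure k1 = {}"
    using disjoint[OF assms] el(1)[OF assms(1)] el(1)[OF assms(2)]
    by (simp_all add: open_Int_closure_eq_empty inf_commute)
  then show "closure k1 \<inter> closure k2 \<subseteq> frontier k1" "closure k1 \<inter> closure k2 \<subseteq> frontier k2"
    using el(1) assms by (auto simp: frontier_def interior_open)
qed

lemma boundary_face_subset:
  assumes "k \<in> K" shows "closure k \<inter> frontier Om \<subseteq> frontier k"
  using el(1,4)[OF assms] open_Om by (auto simp: frontier_def interior_open)

lemma face_emeasure_le:
  assumes "k \<in> K" "F \<subseteq> frontier k"
  shows "emeasure surf F \<le> emeasure surf (frontier k)" "emeasure surf F < \<infinity>" "bounded F"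
proof -
  show 1: "emeasure surf F \<le> emeasure surf (frontier k)" using assms by (intro emeasure_mono) auto
  show "emeasure surf F < \<infinity>" using 1 frontier_finite[OF assms(1)] by (rule order_le_less_trans)
  show "bounded F" using assms bounded_closure[OF el(3)] bounded_subset by (metis Diff_subset frontier_def)
qed

text \<open>Integrals of non-integrable functions default to 0, so additivity and monotonicity of
  \<open>face_sum\<close> need integrability on every face.\<close>

definition fint :: "((real^'n) set \<Rightarrow> (real^'n) set \<Rightarrow> real^'n \<Rightarrow> real)
    \<Rightarrow> ((real^'n) set \<Rightarrow> real^'n \<Rightarrow> real) \<Rightarrow> bool" where
  "fint fi fb \<longleftrightarrow> (\<forall>k1\<in>K. \<forall>k2\<in>K. k1 \<noteq> k2 \<longrightarrow> set_integrable surf (closure k1 \<inter> closure k2) (fi k1 k2)) \<and>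
     (\<forall>k\<in>K. set_integrable surf (closure k \<inter> frontier Om) (fb k))"

lemma fintI:
  assumes "\<And>k1 k2. k1 \<in> K \<Longrightarrow> k2 \<in> K \<Longrightarrow> locally_bounded_borel (fi k1 k2)"
    and "\<And>k. k \<in> K \<Longrightarrow> locally_bounded_borel (fb k)"
  shows "fint fi fb"
  unfolding fint_def
proof (intro conjI ballI impI)
  fix k1 k2 assume k: "k1 \<in> K" "k2 \<in> K" "k1 \<noteq> k2"
  show "set_integrable surf (closure k1 \<inter> closure k2) (fi k1 k2)"
    using face_emeasure_le[OF k(1) interior_face_subset(1)[OF k]] assms(1)[OF k(1,2)]
    by (intro locally_bounded_borel_integrable_surf) auto
next
  fix k assume k: "k \<in> K"
  show "set_integrable surf (closure k \<inter> frontier Om) (fb k)"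
    using face_emeasure_le[OF k boundary_face_subset[OF k]] assms(2)[OF k]
    by (intro locally_bounded_borel_integrable_surf) auto
qed

lemma fintD:
  assumes "fint fi fb"
  shows "k1 \<in> K \<Longrightarrow> k2 \<in> K \<Longrightarrow> k1 \<noteq> k2 \<Longrightarrow> set_integrable surf (closure k1 \<inter> closure k2) (fi k1 k2)"
    and "k \<in> K \<Longrightarrow> set_integrable surf (closure k \<inter> frontier Om) (fb k)"
  using assms by (simp_all add: fint_def)

lemma face_sum_add:
  assumes "fint fi fb" "fint gi gb"
  shows "face_sum Om K (\<lambda>k1 k2 x. fi k1 k2 x + gi k1 k2 x) (\<lambda>k x. fb k x + gb k x)
    = face_sum Om K fi fb + face_sum Om K gi gb"
proof -
  let ?P = "{(k1, k2). k1 \<in> K \<and> k2 \<in> K \<and> k1 \<noteq> k2}"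
  let ?I = "\<lambda>f. (\<Sum>(k1, k2)\<in>?P. set_lebesgue_integral surf (closure k1 \<inter> closure k2) (f k1 k2) / 2)"
  let ?B = "\<lambda>f. (\<Sum>k\<in>K. set_lebesgue_integral surf (closure k \<inter> frontier Om) (f k))"
  have "?I (\<lambda>k1 k2 x. fi k1 k2 x + gi k1 k2 x) = ?I fi + ?I gi"
    unfolding sum.distrib[symmetric]
  proof (intro sum.cong refl, clarify)
    fix k1 k2 assume "k1 \<in> K" "k2 \<in> K" "k1 \<noteq> k2"
    then have "set_integrable surf (closure k1 \<inter> closure k2) (fi k1 k2)"
      "set_integrable surf (closure k1 \<inter> closure k2) (gi k1 k2)"
      using assms by (simp_all add: fintD)
    then show "(\<integral>x\<in>closure k1 \<inter> closure k2. (fi k1 k2 x + gi k1 k2 x) \<partial>surf) / 2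
        = (\<integral>x\<in>closure k1 \<inter> closure k2. fi k1 k2 x \<partial>surf) / 2 + (\<integral>x\<in>closure k1 \<inter> closure k2. gi k1 k2 x \<partial>surf) / 2"
      by (simp add: set_integral_add add_divide_distrib)
  qed
  moreover have "?B (\<lambda>k x. fb k x + gb k x) = ?B fb + ?B gb"
    unfolding sum.distrib[symmetric]
    using assms by (intro sum.cong refl set_integral_add(2)) (simp_all add: fintD)
  ultimately show ?thesis by (simp add: face_sum_def)
qed

lemma face_sum_cmult:
  "face_sum Om K (\<lambda>k1 k2 x. r * fi k1 k2 x) (\<lambda>k x. r * fb k x) = r * face_sum Om K fi fb"
  by (simp add: face_sum_def distrib_left sum_distrib_left case_prod_beta)

lemma face_sum_mono:
  assumes "fint fi fb" "fint gi gb"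
    and "\<And>k1 k2 x. k1 \<in> K \<Longrightarrow> k2 \<in> K \<Longrightarrow> k1 \<noteq> k2 \<Longrightarrow> x \<in> closure k1 \<inter> closure k2 \<Longrightarrow> fi k1 k2 x \<le> gi k1 k2 x"
    and "\<And>k x. k \<in> K \<Longrightarrow> x \<in> closure k \<inter> frontier Om \<Longrightarrow> fb k x \<le> gb k x"
  shows "face_sum Om K fi fb \<le> face_sum Om K gi gb"
  unfolding face_sum_def
proof (intro add_mono sum_mono, clarify)
  fix k1 k2 assume "k1 \<in> K" "k2 \<in> K" "k1 \<noteq> k2"
  then show "(\<integral>x\<in>closure k1 \<inter> closure k2. fi k1 k2 x \<partial>surf) / 2 \<le> (\<integral>x\<in>closure k1 \<inter> closure k2. gi k1 k2 x \<partial>surf) / 2"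
    using assms by (intro divide_right_mono set_integral_mono fintD) auto
next
  fix k assume "k \<in> K"
  then show "(\<integral>x\<in>closure k \<inter> frontier Om. fb k x \<partial>surf) \<le> (\<integral>x\<in>closure k \<inter> frontier Om. gb k x \<partial>surf)"
    using assms by (intro set_integral_mono fintD) auto
qed

lemma face_sum_cong:
  assumes "\<And>k1 k2 x. k1 \<in> K \<Longrightarrow> k2 \<in> K \<Longrightarrow> fi k1 k2 x = gi k1 k2 x"
    and "\<And>k x. k \<in> K \<Longrightarrow> fb k x = gb k x"
  shows "face_sum Om K fi fb = face_sum Om K gi gb"
proof -
  have "fi k1 k2 = gi k1 k2" "fb k1 = gb k1" if "k1 \<in> K" "k2 \<in> K" for k1 k2
    using assms that by auto
  then show ?thesis unfolding face_sum_def by (intro arg_cong2[where f = "(+)"] sum.cong) auto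
qed

text \<open>The consistency form enters \<open>ah\<close> twice, with its arguments exchanged.\<close>

definition cons_form :: "real \<Rightarrow> ((real^'n) set \<Rightarrow> real^'n \<Rightarrow> real) \<Rightarrow> ((real^'n) set \<Rightarrow> real^'n \<Rightarrow> real) \<Rightarrow> real" where
  "cons_form c u v = face_sum Om K (\<lambda>k1 k2 x. (c^2 *\<^sub>R avg_grad u k1 k2 x) \<bullet> jump v k1 k2 x)
     (\<lambda>k x. (c^2 *\<^sub>R grad (u k) x) \<bullet> bjump v k x)"

definition pen_form :: "real \<Rightarrow> real \<Rightarrow> ((real^'n) set \<Rightarrow> real^'n \<Rightarrow> real) \<Rightarrow> ((real^'n) set \<Rightarrow> real^'n \<Rightarrow> real) \<Rightarrow> real" where
  "pen_form c \<beta> u v = face_sum Om K (\<lambda>k1 k2 x. chi_int c \<beta> p k1 k2 * (jump u k1 k2 x \<bullet> jump v k1 k2 x))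
     (\<lambda>k x. chi_bd c \<beta> p k * (bjump u k x \<bullet> bjump v k x))"

lemma ah_eq: "ah c \<beta> p Om K u v = c^2 * grad_ip K u v - cons_form c u v - cons_form c v u + pen_form c \<beta> u v"
  by (simp add: ah_def cons_form_def pen_form_def inner_commute)

lemma lbb:
  assumes "Vh p K u" "k \<in> K"
  shows "locally_bounded_borel (u k)" "locally_bounded_borel (grad (u k))" "locally_bounded_borel (bjump u k)"
proof -
  have q: "poly_le p (u k)" using assms by (simp add: Vh_def)
  show 1: "locally_bounded_borel (u k)" by (intro locally_bounded_borel_continuous poly_le_continuous[OF q])
  show "locally_bounded_borel (grad (u k))"
    by (intro locally_bounded_borel_continuous poly_le_grad_continuous[OF q])
  show "locally_bounded_borel (bjump u k)"
    unfolding bjump_def[abs_def]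
    by (intro locally_bounded_borel_scaleR locally_bounded_borel_onormal 1 el(1)[OF assms(2)])
qed

lemma lbb_jump:
  assumes "Vh p K u" "k1 \<in> K" "k2 \<in> K"
  shows "locally_bounded_borel (jump u k1 k2)" "locally_bounded_borel (avg_grad u k1 k2)"
  unfolding jump_def[abs_def] avg_grad_def[abs_def]
  by (intro locally_bounded_borel_add locally_bounded_borel_scaleR locally_bounded_borel_const
      locally_bounded_borel_onormal lbb assms el(1))+

lemma fint_cons:
  assumes "Vh p K u" "Vh p K v"
  shows "fint (\<lambda>k1 k2 x. (c^2 *\<^sub>R avg_grad u k1 k2 x) \<bullet> jump v k1 k2 x) (\<lambda>k x. (c^2 *\<^sub>R grad (u k) x) \<bullet> bjump v k x)"
  by (intro fintI locally_bounded_borel_inner locally_bounded_borel_scaleR locally_bounded_borel_const lbb lbb_jump assms)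

lemma fint_pen:
  assumes "Vh p K u" "Vh p K v"
  shows "fint (\<lambda>k1 k2 x. chi_int c \<beta> p k1 k2 * (jump u k1 k2 x \<bullet> jump v k1 k2 x))
     (\<lambda>k x. chi_bd c \<beta> p k * (bjump u k x \<bullet> bjump v k x))"
  unfolding real_scaleR_def[symmetric]
  by (intro fintI locally_bounded_borel_inner locally_bounded_borel_scaleR locally_bounded_borel_const lbb lbb_jump assms)

text \<open>The third clause is needed because a mesh function is defined on all sets, not only on
  elements: it lets a functional descend to the finite-dimensional space of restrictions to
  \<open>K\<close>.\<close>

definition vlin :: "(((real^'n) set \<Rightarrow> real^'n \<Rightarrow> real) \<Rightarrow> real) \<Rightarrow> bool" where
  "vlin L \<longleftrightarrow> (\<forall>u v. Vh p K u \<longrightarrow> Vh p K v \<longrightarrow> L (\<lambda>k x. u k x + v k x) = L u + L v) \<and>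
     (\<forall>r u. Vh p K u \<longrightarrow> L (\<lambda>k x. r * u k x) = r * L u) \<and>
     (\<forall>u v. (\<forall>k\<in>K. u k = v k) \<longrightarrow> L u = L v)"

lemma vlinD:
  assumes "vlin L"
  shows "Vh p K u \<Longrightarrow> Vh p K v \<Longrightarrow> L (\<lambda>k x. u k x + v k x) = L u + L v"
    and "Vh p K u \<Longrightarrow> L (\<lambda>k x. r * u k x) = r * L u"
    and "(\<And>k. k \<in> K \<Longrightarrow> u k = v k) \<Longrightarrow> L u = L v"
  using assms unfolding vlin_def by blast+

lemma vlin_lincomb2:
  assumes L: "vlin L" and M: "vlin M" shows "vlin (\<lambda>u. r * L u + s * M u)"
  unfolding vlin_def
proof (intro conjI allI impI)
  fix u v :: "(real^'n) set \<Rightarrow> real^'n \<Rightarrow> real" and q :: real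
  show "r * L u + s * M u = r * L v + s * M v" if "\<forall>k\<in>K. u k = v k"
    using vlinD(3)[OF L, of u v] vlinD(3)[OF M, of u v] that by simp
  assume u: "Vh p K u"
  show "r * L (\<lambda>k x. q * u k x) + s * M (\<lambda>k x. q * u k x) = q * (r * L u + s * M u)"
    using vlinD(2)[OF L u] vlinD(2)[OF M u] by (simp add: distrib_left)
  assume v: "Vh p K v"
  show "r * L (\<lambda>k x. u k x + v k x) + s * M (\<lambda>k x. u k x + v k x) = (r * L u + s * M u) + (r * L v + s * M v)"
    using vlinD(1)[OF L u v] vlinD(1)[OF M u v] by (simp add: distrib_left)
qed

lemma vlin_lincomb:
  assumes "vlin L" "vlin M" shows "vlin (\<lambda>u. L u + M u)" "vlin (\<lambda>u. L u - M u)" "vlin (\<lambda>u. r * L u)"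
  using vlin_lincomb2[OF assms, of 1 1] vlin_lincomb2[OF assms, of 1 "-1"] vlin_lincomb2[OF assms, of r 0]
  by simp_all

lemma vlin_sum:
  assumes L: "vlin L" and I: "finite I" "\<And>i. i \<in> I \<Longrightarrow> Vh p K (b i)"
  shows "L (\<lambda>k x. \<Sum>i\<in>I. y i * b i k x) = (\<Sum>i\<in>I. y i * L (b i))"
  using I
proof (induction I)
  case empty
  have "Vh p K (\<lambda>_ _. 0)" by (simp add: Vh_def poly_le_0)
  then show ?case using vlinD(2)[OF L, of "\<lambda>_ _. 0" 0] by simp
next
  case (insert i I)
  have "L (\<lambda>k x. y i * b i k x + (\<Sum>i\<in>I. y i * b i k x)) = L (\<lambda>k x. y i * b i k x) + L (\<lambda>k x. \<Sum>i\<in>I. y i * b i k x)"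
    using insert.prems by (intro vlinD(1)[OF L] Vh_cmult Vh_sum) auto
  then show ?case using insert by (simp add: vlinD(2)[OF L])
qed

definition vbil where
  "vbil B \<longleftrightarrow> (\<forall>v. Vh p K v \<longrightarrow> vlin (\<lambda>u. B u v)) \<and> (\<forall>u. Vh p K u \<longrightarrow> vlin (\<lambda>v. B u v))"

lemma jump_lin:
  "jump (\<lambda>k x. u k x + v k x) k1 k2 x = jump u k1 k2 x + jump v k1 k2 x"
  "jump (\<lambda>k x. r * u k x) k1 k2 x = r *\<^sub>R jump u k1 k2 x"
  "bjump (\<lambda>k x. u k x + v k x) k x = bjump u k x + bjump v k x"
  "bjump (\<lambda>k x. r * u k x) k x = r *\<^sub>R bjump u k x"
  by (simp_all add: jump_def bjump_def algebra_simps)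

lemma Vh_differentiable: "Vh p K u \<Longrightarrow> k \<in> K \<Longrightarrow> u k differentiable (at x)"
  using poly_le_differentiable[of p "u k"] by (simp add: Vh_def)

lemma grad_lin:
  assumes "Vh p K u" "k \<in> K"
  shows "Vh p K v \<Longrightarrow> grad (\<lambda>x. u k x + v k x) x = grad (u k) x + grad (v k) x"
    "grad (\<lambda>x. r * u k x) x = r *\<^sub>R grad (u k) x"
  using assms by (auto intro!: grad_add grad_cmult Vh_differentiable)

lemma avg_grad_lin:
  assumes "Vh p K u" "k1 \<in> K" "k2 \<in> K"
  shows "Vh p K v \<Longrightarrow> avg_grad (\<lambda>k x. u k x + v k x) k1 k2 x = avg_grad u k1 k2 x + avg_grad v k1 k2 x"
    "avg_grad (\<lambda>k x. r * u k x) k1 k2 x = r *\<^sub>R avg_grad u k1 k2 x"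
  using assms by (simp_all add: avg_grad_def grad_lin algebra_simps)

lemma vbil_cons: "vbil (cons_form c)"
  unfolding vbil_def vlin_def
proof (intro conjI allI impI)
  fix v u u' :: "(real^'n) set \<Rightarrow> real^'n \<Rightarrow> real" and r
  assume v: "Vh p K v" and u: "Vh p K u"
  show "cons_form c (\<lambda>k x. r * u k x) v = r * cons_form c u v"
    unfolding cons_form_def face_sum_cmult[symmetric]
    by (rule face_sum_cong) (simp_all add: avg_grad_lin grad_lin u)
  show "cons_form c v (\<lambda>k x. r * u k x) = r * cons_form c v u"
    unfolding cons_form_def face_sum_cmult[symmetric]
    by (rule face_sum_cong) (simp_all add: jump_lin)
  assume u': "Vh p K u'"
  show "cons_form c (\<lambda>k x. u k x + u' k x) v = cons_form c u v + cons_form c u' v"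
    unfolding cons_form_def face_sum_add[OF fint_cons[OF u v] fint_cons[OF u' v], symmetric]
    by (rule face_sum_cong) (simp_all add: avg_grad_lin grad_lin u u' inner_add_left scaleR_add_right distrib_left)
  show "cons_form c v (\<lambda>k x. u k x + u' k x) = cons_form c v u + cons_form c v u'"
    unfolding cons_form_def face_sum_add[OF fint_cons[OF v u] fint_cons[OF v u'], symmetric]
    by (rule face_sum_cong) (simp_all add: jump_lin inner_add_right distrib_left)
next
  fix v u u' :: "(real^'n) set \<Rightarrow> real^'n \<Rightarrow> real"
  assume "\<forall>k\<in>K. u k = u' k"
  then show "cons_form c u v = cons_form c u' v" "cons_form c v u = cons_form c v u'"
    unfolding cons_form_def by (intro face_sum_cong; simp add: avg_grad_def jump_def bjump_def)+
qed

lemma vbil_pen: "vbil (pen_form c \<beta>)"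
  unfolding vbil_def vlin_def
proof (intro conjI allI impI)
  fix v u u' :: "(real^'n) set \<Rightarrow> real^'n \<Rightarrow> real" and r
  assume v: "Vh p K v" and u: "Vh p K u"
  show "pen_form c \<beta> (\<lambda>k x. r * u k x) v = r * pen_form c \<beta> u v"
    unfolding pen_form_def face_sum_cmult[symmetric]
    by (rule face_sum_cong) (simp_all add: jump_lin)
  show "pen_form c \<beta> v (\<lambda>k x. r * u k x) = r * pen_form c \<beta> v u"
    unfolding pen_form_def face_sum_cmult[symmetric]
    by (rule face_sum_cong) (simp_all add: jump_lin)
  assume u': "Vh p K u'"
  show "pen_form c \<beta> (\<lambda>k x. u k x + u' k x) v = pen_form c \<beta> u v + pen_form c \<beta> u' v"
    unfolding pen_form_def face_sum_add[OF fint_pen[OF u v] fint_pen[OF u' v], symmetric]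
    by (rule face_sum_cong) (simp_all add: jump_lin inner_add_left distrib_left)
  show "pen_form c \<beta> v (\<lambda>k x. u k x + u' k x) = pen_form c \<beta> v u + pen_form c \<beta> v u'"
    unfolding pen_form_def face_sum_add[OF fint_pen[OF v u] fint_pen[OF v u'], symmetric]
    by (rule face_sum_cong) (simp_all add: jump_lin inner_add_right distrib_left)
next
  fix v u u' :: "(real^'n) set \<Rightarrow> real^'n \<Rightarrow> real"
  assume "\<forall>k\<in>K. u k = u' k"
  then show "pen_form c \<beta> u v = pen_form c \<beta> u' v" "pen_form c \<beta> v u = pen_form c \<beta> v u'"
    unfolding pen_form_def by (intro face_sum_cong; simp add: jump_def bjump_def)+
qed

lemma el_integrable:
  fixes f :: "real^'n \<Rightarrow> real"
  assumes "k \<in> K" "continuous_on UNIV f" shows "set_integrable lborel k f"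
  using el[OF assms(1)] by (intro set_integrable_lborel_continuous assms) auto

lemma Vh_continuous: "Vh p K u \<Longrightarrow> k \<in> K \<Longrightarrow> continuous_on UNIV (u k)"
  using poly_le_continuous[of p "u k"] by (simp add: Vh_def)

lemma Vh_grad_continuous: "Vh p K u \<Longrightarrow> k \<in> K \<Longrightarrow> continuous_on UNIV (grad (u k))"
  using poly_le_grad_continuous[of p "u k"] by (simp add: Vh_def)

lemma grad_integrable:
  "Vh p K u \<Longrightarrow> Vh p K v \<Longrightarrow> k \<in> K \<Longrightarrow> set_integrable lborel k (\<lambda>x. grad (u k) x \<bullet> grad (v k) x)"
  by (intro el_integrable continuous_intros Vh_grad_continuous)

lemma vbil_grad: "vbil (grad_ip K)"
  unfolding vbil_def vlin_def
proof (intro conjI allI impI)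
  fix v u u' :: "(real^'n) set \<Rightarrow> real^'n \<Rightarrow> real" and r
  assume v: "Vh p K v" and u: "Vh p K u"
  show "grad_ip K (\<lambda>k x. r * u k x) v = r * grad_ip K u v" "grad_ip K v (\<lambda>k x. r * u k x) = r * grad_ip K v u"
    unfolding grad_ip_def sum_distrib_left by (auto intro!: sum.cong simp: grad_lin[OF u])
  assume u': "Vh p K u'"
  show "grad_ip K (\<lambda>k x. u k x + u' k x) v = grad_ip K u v + grad_ip K u' v"
    "grad_ip K v (\<lambda>k x. u k x + u' k x) = grad_ip K v u + grad_ip K v u'"
    unfolding grad_ip_def sum.distrib[symmetric]
    using u v u'
    by (auto intro!: sum.cong set_integral_add grad_integrable simp: grad_lin(1)[OF u _ u'] inner_add_left inner_add_right)
next
  fix v u u' :: "(real^'n) set \<Rightarrow> real^'n \<Rightarrow> real"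
  assume "\<forall>k\<in>K. u k = u' k"
  then show "grad_ip K u v = grad_ip K u' v" "grad_ip K v u = grad_ip K v u'"
    unfolding grad_ip_def by (auto intro!: sum.cong)
qed

lemma vbil_ah: "vbil (ah c \<beta> p Om K)"
proof -
  have "vlin (\<lambda>u. ah c \<beta> p Om K u v)" "vlin (\<lambda>u. ah c \<beta> p Om K v u)" if "Vh p K v" for v
    unfolding ah_eq using vbil_cons[of c] vbil_pen[of c \<beta>] vbil_grad that unfolding vbil_def
    by (auto intro!: vlin_lincomb)
  then show ?thesis by (simp add: vbil_def)
qed

text \<open>Linearity in the weight is included so that a weight depending on time can be expanded
  in the basis like the other two arguments.\<close>

lemma wip_lin:
  assumes "Vh p K u" "Vh p K v"
  shows "vlin (\<lambda>w. wip K w u v)" "vlin (\<lambda>w. wip K u w v)" "vlin (\<lambda>w. wip K u v w)"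
proof -
  have i: "set_integrable lborel k (\<lambda>x. f k x * g k x * h k x)" if "Vh p K f" "Vh p K g" "Vh p K h" "k \<in> K" for f g h k
    using that by (intro el_integrable continuous_intros Vh_continuous)
  have add: "set_lebesgue_integral lborel k f = set_lebesgue_integral lborel k g + set_lebesgue_integral lborel k h"
    if "set_integrable lborel k g" "set_integrable lborel k h" "\<And>x. f x = g x + h x"
    for f g h :: "real^'n \<Rightarrow> real" and k
  proof -
    have "f = (\<lambda>x. g x + h x)" using that(3) by blast
    then show ?thesis using that(1,2) by simp
  qed
  have cm: "set_lebesgue_integral lborel k f = r * set_lebesgue_integral lborel k g"
    if "\<And>x. f x = r * g x" for f g :: "real^'n \<Rightarrow> real" and k r
  proof -
    have "f = (\<lambda>x. r * g x)" using that by blast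
    then show ?thesis by simp
  qed
  show "vlin (\<lambda>w. wip K w u v)" "vlin (\<lambda>w. wip K u w v)" "vlin (\<lambda>w. wip K u v w)"
    unfolding vlin_def wip_def sum.distrib[symmetric] sum_distrib_left
    by (intro conjI allI impI sum.cong refl; (rule add[OF i i] cm)?; simp add: assms algebra_simps)+
qed

lemma vbil_wip: "Vh p K w \<Longrightarrow> vbil (wip K w)"
  using wip_lin by (simp add: vbil_def)

lemma wip_commute: "wip K w u v = wip K w v u"
  by (simp add: wip_def mult_ac)

end

section \<open>Coordinates of mesh functions and their dependence on time\<close>

text \<open>One fixed choice of points and weights makes \<open>coef\<close> a finite combination of
  point values, linear in the function and as regular in time as those values.\<close>

definition coef_weights :: "nat \<Rightarrow> (real^'n) set \<times> (('n \<Rightarrow> nat) \<Rightarrow> real^'n \<Rightarrow> real)" where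
  "coef_weights p = (SOME (G, w). finite G \<and>
     (\<forall>a\<in>midx p. \<forall>b\<in>midx p. (\<Sum>g\<in>G. w a g * mon b g) = of_bool (a = b)))"

definition coef :: "nat \<Rightarrow> (real^'n \<Rightarrow> real) \<Rightarrow> ('n \<Rightarrow> nat) \<Rightarrow> real" where
  "coef p q a = (\<Sum>g\<in>fst (coef_weights p). snd (coef_weights p) a g * q g)"

lemma coef_weights_dual:
  fixes a b :: "'n::finite \<Rightarrow> nat"
  assumes "a \<in> midx p" "b \<in> midx p"
  shows "coef p (mon b) a = of_bool (a = b)"
proof -
  have "\<exists>Gw. case Gw of (G :: (real^'n) set, w) \<Rightarrow> finite G \<and>
     (\<forall>a\<in>midx p. \<forall>b\<in>midx p. (\<Sum>g\<in>G. w a g * mon b g) = of_bool (a = b))"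
    using ex_coef_weights[where 'n = 'n, of p] by auto
  from someI_ex[OF this]
  have "case coef_weights p of (G :: (real^'n) set, w) \<Rightarrow> finite G \<and>
     (\<forall>a\<in>midx p. \<forall>b\<in>midx p. (\<Sum>g\<in>G. w a g * mon b g) = of_bool (a = b))"
    by (simp only: coef_weights_def)
  then show ?thesis using assms by (simp add: coef_def case_prod_beta)
qed

lemma poly_le_coef:
  assumes "poly_le p q" shows "q x = (\<Sum>a\<in>midx p. coef p q a * mon a x)"
proof -
  obtain c where c: "q = (\<lambda>x. \<Sum>a\<in>midx p. c a * mon a x)" using assms by (rule poly_leE)
  have "coef p q a = c a" if a: "a \<in> midx p" for a
  proof -
    have "coef p q a = (\<Sum>g\<in>fst (coef_weights p). \<Sum>b\<in>midx p. c b * (snd (coef_weights p) a g * mon b g))"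
      by (simp add: coef_def c sum_distrib_left mult_ac)
    also have "\<dots> = (\<Sum>b\<in>midx p. c b * coef p (mon b) a)"
      unfolding coef_def sum_distrib_left by (rule sum.swap)
    also have "\<dots> = (\<Sum>b\<in>midx p. c b * of_bool (a = b))"
      using a by (intro sum.cong refl) (simp add: coef_weights_dual)
    also have "\<dots> = c a" using a by (simp add: of_bool_def if_distrib finite_midx cong: if_cong)
    finally show ?thesis .
  qed
  then show ?thesis by (simp add: c)
qed

definition bas :: "(real^'n) set \<times> ('n \<Rightarrow> nat) \<Rightarrow> (real^'n) set \<Rightarrow> real^'n \<Rightarrow> real" where
  "bas i k x = (if k = fst i then mon (snd i) x else 0)"

definition C0Vh where
  "C0Vh p K T f \<longleftrightarrow> (\<forall>t\<in>{0..T}. Vh p K (f t)) \<and> (\<forall>k\<in>K. \<forall>x. continuous_on {0..T} (\<lambda>t::real. f t k x))"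

lemma C1Vh_imp_C0Vh:
  assumes "C1Vh p K T f" shows "C0Vh p K T f" "C0Vh p K T (tder T f)"
proof -
  have "continuous_on {0..T} (\<lambda>t. f t k x)" if "k \<in> K" for k x
    unfolding continuous_on_eq_continuous_within
  proof
    fix t assume "t \<in> {0..T}"
    then have "((\<lambda>s. f s k x) has_vector_derivative tder T f t k x) (at t within {0..T})"
      using assms that by (simp add: C1Vh_def)
    then show "continuous (at t within {0..T}) (\<lambda>t. f t k x)" by (rule has_vector_derivative_continuous)
  qed
  then show "C0Vh p K T f" using assms by (simp add: C0Vh_def C1Vh_def)
  show "C0Vh p K T (tder T f)" using assms by (simp add: C0Vh_def C1Vh_def)
qed

lemma C0Vh_coef_continuous:
  "C0Vh p K T f \<Longrightarrow> k \<in> K \<Longrightarrow> continuous_on {0..T} (\<lambda>t. coef p (f t k) a)"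
  unfolding coef_def by (intro continuous_intros) (simp add: C0Vh_def)

lemma C1Vh_coef_deriv:
  assumes "C1Vh p K T f" "k \<in> K" "t \<in> {0..T}"
  shows "((\<lambda>t. coef p (f t k) a) has_real_derivative coef p (tder T f t k) a) (at t within {0..T})"
proof -
  have "((\<lambda>s. f s k x) has_real_derivative tder T f t k x) (at t within {0..T})" for x
    using assms by (simp add: C1Vh_def has_real_derivative_iff_has_vector_derivative)
  then show ?thesis unfolding coef_def by (intro DERIV_sum DERIV_cmult)
qed

lemma tder_eqI:
  assumes "T > 0" "t \<in> {0..T}" "((\<lambda>s. f s k x) has_vector_derivative d) (at t within {0..T})"
  shows "tder T f t k x = d"
  unfolding tder_def using assms by (rule vector_derivative_within_closed_interval)

lemma Vh_tilde: "Vh p K (psi t) \<Longrightarrow> Vh p K (tder T psi t) \<Longrightarrow> Vh p K (tilde T b c psi t)"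
  unfolding tilde_def[abs_def] by (intro Vh_add Vh_cmult)

context dg_mesh begin

definition Idx :: "((real^'n) set \<times> ('n \<Rightarrow> nat)) set" where "Idx = K \<times> midx p"

lemma finite_Idx: "finite Idx"
  unfolding Idx_def using finite_K by (simp add: finite_midx)

lemma Vh_bas: "i \<in> Idx \<Longrightarrow> Vh p K (bas i)"
  unfolding Vh_def
proof
  fix k assume "i \<in> Idx" "k \<in> K"
  then show "poly_le p (bas i k)"
    by (cases "k = fst i") (auto simp: bas_def[abs_def] Idx_def intro: poly_le_mono poly_le_0)
qed

definition cf :: "((real^'n) set \<Rightarrow> real^'n \<Rightarrow> real) \<Rightarrow> (real^'n) set \<times> ('n \<Rightarrow> nat) \<Rightarrow> real" where
  "cf u i = coef p (u (fst i)) (snd i)"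

lemma bas_sum:
  assumes "k \<in> K" shows "(\<Sum>i\<in>Idx. y i * bas i k x) = (\<Sum>a\<in>midx p. y (k, a) * mon a x)"
proof -
  have "(\<Sum>i\<in>Idx. y i * bas i k x) = (\<Sum>k'\<in>K. \<Sum>a\<in>midx p. y (k', a) * bas (k', a) k x)"
    unfolding Idx_def by (simp add: sum.cartesian_product)
  also have "\<dots> = (\<Sum>k'\<in>K. if k' = k then (\<Sum>a\<in>midx p. y (k, a) * mon a x) else 0)"
    by (intro sum.cong refl) (auto simp: bas_def)
  finally show ?thesis using finite_K assms by simp
qed

lemma Vh_expand:
  assumes "Vh p K u" "k \<in> K" shows "u k = (\<lambda>x. \<Sum>i\<in>Idx. cf u i * bas i k x)"
  using poly_le_coef[of p "u k"] assms by (auto simp: bas_sum cf_def Vh_def)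

lemma Vh_lincomb: "Vh p K (\<lambda>k x. \<Sum>i\<in>Idx. y i * bas i k x)"
  by (intro Vh_sum Vh_cmult Vh_bas)

lemma vlin_expand:
  assumes "vlin L" "Vh p K u" shows "L u = (\<Sum>i\<in>Idx. cf u i * L (bas i))"
proof -
  have "L u = L (\<lambda>k x. \<Sum>i\<in>Idx. cf u i * bas i k x)"
    by (rule vlinD(3)[OF assms(1)]) (rule Vh_expand[OF assms(2)])
  also have "\<dots> = (\<Sum>i\<in>Idx. cf u i * L (bas i))"
    by (rule vlin_sum[OF assms(1) finite_Idx Vh_bas])
  finally show ?thesis .
qed

text \<open>Separates time from space: the form acts on fixed basis functions, and all time
  dependence sits in finitely many coefficients. Continuity and the product rule in time then follow
  without interchanging limits and integrals.\<close>

lemma vbil_expand: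
  assumes "vbil B" "Vh p K u" "Vh p K v"
  shows "B u v = (\<Sum>i\<in>Idx. \<Sum>j\<in>Idx. cf u i * cf v j * B (bas i) (bas j))"
proof -
  have "B u v = (\<Sum>i\<in>Idx. cf u i * B (bas i) v)"
    using assms by (intro vlin_expand) (auto simp: vbil_def)
  also have "\<dots> = (\<Sum>i\<in>Idx. cf u i * (\<Sum>j\<in>Idx. cf v j * B (bas i) (bas j)))"
    using assms Vh_bas by (intro sum.cong refl arg_cong2[where f = "(*)"] vlin_expand) (auto simp: vbil_def)
  finally show ?thesis by (simp add: sum_distrib_left mult_ac)
qed

lemma cf_continuous: "C0Vh p K T f \<Longrightarrow> i \<in> Idx \<Longrightarrow> continuous_on {0..T} (\<lambda>t. cf (f t) i)"
  unfolding cf_def by (rule C0Vh_coef_continuous) (auto simp: Idx_def)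

lemma cf_deriv: "C1Vh p K T f \<Longrightarrow> i \<in> Idx \<Longrightarrow> t \<in> {0..T} \<Longrightarrow>
    ((\<lambda>t. cf (f t) i) has_real_derivative cf (tder T f t) i) (at t within {0..T})"
  unfolding cf_def by (rule C1Vh_coef_deriv) (auto simp: Idx_def)

lemma vbil_continuous:
  assumes "vbil B" "C0Vh p K T u" "C0Vh p K T v"
  shows "continuous_on {0..T} (\<lambda>t. B (u t) (v t))"
proof -
  have "continuous_on {0..T} (\<lambda>t. \<Sum>i\<in>Idx. \<Sum>j\<in>Idx. cf (u t) i * cf (v t) j * B (bas i) (bas j))"
    by (intro continuous_intros cf_continuous assms)
  then show ?thesis
    by (rule continuous_on_eq) (use assms in \<open>simp add: vbil_expand[symmetric] C0Vh_def\<close>)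
qed

lemma vbil_deriv:
  assumes B: "vbil B" and u: "C1Vh p K T u" and v: "C1Vh p K T v" and t: "t \<in> {0..T}"
  shows "((\<lambda>t. B (u t) (v t)) has_real_derivative B (tder T u t) (v t) + B (u t) (tder T v t)) (at t within {0..T})"
proof -
  have V: "Vh p K (u s)" "Vh p K (v s)" "Vh p K (tder T u s)" "Vh p K (tder T v s)" if "s \<in> {0..T}" for s
    using u v that by (auto simp: C1Vh_def)
  have "((\<lambda>t. \<Sum>i\<in>Idx. \<Sum>j\<in>Idx. cf (u t) i * cf (v t) j * B (bas i) (bas j)) has_real_derivative
      (\<Sum>i\<in>Idx. \<Sum>j\<in>Idx. (cf (u t) i * cf (tder T v t) j + cf (tder T u t) i * cf (v t) j) * B (bas i) (bas j)))
      (at t within {0..T})"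
    by (intro DERIV_sum DERIV_cmult_right DERIV_mult' cf_deriv u v t)
  also have "(\<Sum>i\<in>Idx. \<Sum>j\<in>Idx. (cf (u t) i * cf (tder T v t) j + cf (tder T u t) i * cf (v t) j) * B (bas i) (bas j))
      = B (tder T u t) (v t) + B (u t) (tder T v t)"
    using V[OF t] by (simp add: vbil_expand[OF B] distrib_right sum.distrib)
  finally show ?thesis
    unfolding has_field_derivative_def by (rule has_derivative_transform[OF t, rotated]) (simp add: vbil_expand[OF B] V)
qed

lemma wip_expand:
  assumes "Vh p K w" "Vh p K u" "Vh p K v"
  shows "wip K w u v = (\<Sum>l\<in>Idx. cf w l * wip K (bas l) u v)"
  using assms by (intro vlin_expand wip_lin)

lemma wip_continuous:
  assumes "C0Vh p K T w" "C0Vh p K T u" "C0Vh p K T v"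
  shows "continuous_on {0..T} (\<lambda>t. wip K (w t) (u t) (v t))"
proof -
  have "continuous_on {0..T} (\<lambda>t. \<Sum>l\<in>Idx. cf (w t) l * wip K (bas l) (u t) (v t))"
    by (intro continuous_intros cf_continuous vbil_continuous vbil_wip Vh_bas assms)
  then show ?thesis
    by (rule continuous_on_eq) (use assms in \<open>simp add: wip_expand[symmetric] C0Vh_def\<close>)
qed

lemma wip_deriv:
  assumes w: "C1Vh p K T w" and u: "C1Vh p K T u" and v: "C1Vh p K T v" and t: "t \<in> {0..T}"
  shows "((\<lambda>t. wip K (w t) (u t) (v t)) has_real_derivative
     wip K (tder T w t) (u t) (v t) + wip K (w t) (tder T u t) (v t) + wip K (w t) (u t) (tder T v t)) (at t within {0..T})"
proof -
  have V: "Vh p K (u s)" "Vh p K (v s)" "Vh p K (w s)" "Vh p K (tder T u s)" "Vh p K (tder T v s)" "Vh p K (tder T w s)"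
    if "s \<in> {0..T}" for s
    using u v w that by (auto simp: C1Vh_def)
  have "((\<lambda>t. \<Sum>l\<in>Idx. cf (w t) l * wip K (bas l) (u t) (v t)) has_real_derivative
     (\<Sum>l\<in>Idx. cf (w t) l * (wip K (bas l) (tder T u t) (v t) + wip K (bas l) (u t) (tder T v t))
        + cf (tder T w t) l * wip K (bas l) (u t) (v t))) (at t within {0..T})"
    by (intro DERIV_sum DERIV_mult' cf_deriv vbil_deriv vbil_wip Vh_bas u v w t)
  also have "(\<Sum>l\<in>Idx. cf (w t) l * (wip K (bas l) (tder T u t) (v t) + wip K (bas l) (u t) (tder T v t))
        + cf (tder T w t) l * wip K (bas l) (u t) (v t))
     = wip K (tder T w t) (u t) (v t) + wip K (w t) (tder T u t) (v t) + wip K (w t) (u t) (tder T v t)"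
    using V[OF t] by (simp add: wip_expand distrib_left sum.distrib)
  finally show ?thesis
    unfolding has_field_derivative_def by (rule has_derivative_transform[OF t, rotated]) (simp add: wip_expand V)
qed

lemma wip_mono:
  assumes "Vh p K w" "Vh p K w'" "Vh p K u" "\<And>k x. k \<in> K \<Longrightarrow> x \<in> k \<Longrightarrow> w k x \<le> w' k x"
  shows "wip K w u u \<le> wip K w' u u"
  unfolding wip_def
proof (intro sum_mono set_integral_mono)
  fix k x assume k: "k \<in> K"
  show "set_integrable lborel k (\<lambda>x. w k x * u k x * u k x)" "set_integrable lborel k (\<lambda>x. w' k x * u k x * u k x)"
    using k assms by (intro el_integrable continuous_intros Vh_continuous; simp)+
  assume "x \<in> k"
  then show "w k x * u k x * u k x \<le> w' k x * u k x * u k x"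
    using assms(4)[OF k] mult_right_mono[of "w k x" "w' k x" "u k x * u k x"] by (simp add: mult.assoc)
qed

lemma wip_nonneg:
  assumes "\<And>k x. k \<in> K \<Longrightarrow> x \<in> k \<Longrightarrow> w k x \<ge> 0" shows "wip K w u u \<ge> 0"
  unfolding wip_def set_lebesgue_integral_def
proof (intro sum_nonneg Bochner_Integration.integral_nonneg)
  fix k x assume k: "k \<in> K"
  show "0 \<le> indicat_real k x *\<^sub>R (w k x * u k x * u k x)"
  proof (cases "x \<in> k")
    case True
    then show ?thesis using assms[OF k True] by (simp add: mult.assoc)
  qed simp
qed

text \<open>On each element the integral dominates \<open>a0\<close> times the integral of the
  square. A polynomial vanishing on a nonempty open set vanishes identically, which is why
  \<open>x\<close> may lie outside \<open>k\<close>.\<close>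

lemma wip_eq_0:
  assumes w: "Vh p K w" "\<And>k x. k \<in> K \<Longrightarrow> x \<in> k \<Longrightarrow> w k x \<ge> a0" "a0 > 0"
    and u: "Vh p K u" and z: "wip K w u u \<le> 0" and k: "k \<in> K"
  shows "u k x = 0"
proof -
  have nn: "set_lebesgue_integral lborel k (\<lambda>x. w k x * u k x * u k x) \<ge> 0" if "k \<in> K" for k
    unfolding set_lebesgue_integral_def
  proof (intro Bochner_Integration.integral_nonneg)
    fix x show "0 \<le> indicat_real k x *\<^sub>R (w k x * u k x * u k x)"
    proof (cases "x \<in> k")
      case True
      then show ?thesis using w(2)[OF that True] w(3) by (simp add: mult.assoc)
    qed simp
  qed
  have "set_lebesgue_integral lborel k (\<lambda>x. a0 * (u k x)\<^sup>2) \<le> set_lebesgue_integral lborel k (\<lambda>x. w k x * u k x * u k x)"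
  proof (intro set_integral_mono)
    show "set_integrable lborel k (\<lambda>x. a0 * (u k x)\<^sup>2)" "set_integrable lborel k (\<lambda>x. w k x * u k x * u k x)"
      using k u w(1) by (intro el_integrable continuous_intros Vh_continuous; simp)+
    fix x assume "x \<in> k"
    then show "a0 * (u k x)\<^sup>2 \<le> w k x * u k x * u k x"
      using w(2)[OF k] mult_right_mono[of a0 "w k x" "(u k x)\<^sup>2"] by (simp add: mult.assoc power2_eq_square)
  qed
  also have "\<dots> \<le> wip K w u u"
    unfolding wip_def using nn finite_K k by (intro member_le_sum) auto
  finally have "a0 * set_lebesgue_integral lborel k (\<lambda>x. (u k x)\<^sup>2) \<le> 0" using z by simp
  then have "set_lebesgue_integral lborel k (\<lambda>x. (u k x)\<^sup>2) \<le> 0" using w(3) by (simp add: mult_le_0_iff)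
  moreover have "set_lebesgue_integral lborel k (\<lambda>x. (u k x)\<^sup>2) \<ge> 0"
    by (simp add: set_lebesgue_integral_def)
  ultimately have "set_lebesgue_integral lborel k (\<lambda>x. (u k x)\<^sup>2) = 0" by simp
  then show ?thesis using poly_le_square_int_zero[of p "u k" k x] u el[OF k] k by (simp add: Vh_def)
qed

lemma grad_ip_nonneg: "grad_ip K u u \<ge> 0"
  unfolding grad_ip_def set_lebesgue_integral_def by (intro sum_nonneg Bochner_Integration.integral_nonneg) simp

lemma pen_form_nonneg: "\<beta> \<ge> 0 \<Longrightarrow> pen_form c \<beta> u u \<ge> 0"
  unfolding pen_form_def face_sum_def set_lebesgue_integral_def
  using diameter_ge_0[OF el(3)]
  by (intro add_nonneg_nonneg sum_nonneg Bochner_Integration.integral_nonneg)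
    (auto simp: chi_int_def chi_bd_def le_max_iff_disj
      intro!: divide_nonneg_nonneg Bochner_Integration.integral_nonneg mult_nonneg_nonneg)

end

section \<open>The semi-discrete wave equation\<close>

lemma C1Vh_Vh: "C1Vh p K T f \<Longrightarrow> t \<in> {0..T} \<Longrightarrow> Vh p K (f t) \<and> Vh p K (tder T f t)"
  by (simp add: C1Vh_def)

lemma C1Vh_lincomb:
  assumes T: "T > 0" and f: "C1Vh p K T f" and g: "C1Vh p K T g"
  shows "C1Vh p K T (\<lambda>t k x. f t k x + r * g t k x)"
    and "k \<in> K \<Longrightarrow> t \<in> {0..T} \<Longrightarrow> tder T (\<lambda>t k x. f t k x + r * g t k x) t k = (\<lambda>x. tder T f t k x + r * tder T g t k x)"
proof -
  let ?h = "\<lambda>t k x. f t k x + r * g t k x"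
  have d: "((\<lambda>s. ?h s k x) has_vector_derivative tder T f t k x + r * tder T g t k x) (at t within {0..T})"
    if "k \<in> K" "t \<in> {0..T}" for k t x
    using f g that unfolding C1Vh_def by (auto intro!: derivative_eq_intros)
  have e: "tder T ?h t k = (\<lambda>x. tder T f t k x + r * tder T g t k x)" if "k \<in> K" "t \<in> {0..T}" for k t
    by (rule ext, rule tder_eqI[OF T that(2)], rule d[OF that])
  then show "k \<in> K \<Longrightarrow> t \<in> {0..T} \<Longrightarrow> tder T ?h t k = (\<lambda>x. tder T f t k x + r * tder T g t k x)" .
  show "C1Vh p K T ?h"
    unfolding C1Vh_def
  proof (intro conjI ballI allI)
    fix t assume t: "t \<in> {0..T}"
    show "Vh p K (?h t)" using f g t by (intro Vh_add Vh_cmult) (auto simp: C1Vh_def)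
    have "Vh p K (\<lambda>k x. tder T f t k x + r * tder T g t k x)"
      using f g t by (intro Vh_add Vh_cmult) (auto simp: C1Vh_def)
    then show "Vh p K (tder T ?h t)" using e t by (simp add: Vh_def)
  next
    fix k x t assume "k \<in> K" "t \<in> {0..T}"
    then show "((\<lambda>s. ?h s k x) has_vector_derivative tder T ?h t k x) (at t within {0..T})"
      using d e by simp
  next
    fix k x assume k: "k \<in> K"
    have "continuous_on {0..T} (\<lambda>t. tder T f t k x + r * tder T g t k x)"
      using f g k by (intro continuous_intros) (auto simp: C1Vh_def)
    then show "continuous_on {0..T} (\<lambda>t. tder T ?h t k x)"
      by (rule continuous_on_eq) (simp add: e k)
  qed
qed

text \<open>Formulas for \<open>tder\<close> are available only on elements of \<open>K\<close> and
  for times in \<open>{0..T}\<close>. Regularity is therefore transported between functions that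
  agree just there.\<close>

lemma C1Vh_cong:
  assumes f: "C1Vh p K T f" and eq: "\<And>t k. t \<in> {0..T} \<Longrightarrow> k \<in> K \<Longrightarrow> g t k = f t k" and T: "T > 0"
  shows "C1Vh p K T g" and "k \<in> K \<Longrightarrow> t \<in> {0..T} \<Longrightarrow> tder T g t k = tder T f t k"
proof -
  have d: "((\<lambda>s. g s k x) has_vector_derivative tder T f t k x) (at t within {0..T})" if "k \<in> K" "t \<in> {0..T}" for k t x
  proof -
    have "((\<lambda>s. f s k x) has_vector_derivative tder T f t k x) (at t within {0..T})"
      using f that by (simp add: C1Vh_def)
    then show ?thesis by (rule has_vector_derivative_transform[OF that(2), rotated]) (simp add: eq that)
  qed
  have e: "tder T g t k = tder T f t k" if "k \<in> K" "t \<in> {0..T}" for k t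
    by (rule ext, rule tder_eqI[OF T that(2)], rule d[OF that])
  then show "k \<in> K \<Longrightarrow> t \<in> {0..T} \<Longrightarrow> tder T g t k = tder T f t k" .
  have c: "continuous_on {0..T} (\<lambda>t. tder T g t k x)" if "k \<in> K" for k x
  proof -
    have "continuous_on {0..T} (\<lambda>t. tder T f t k x)" using f that by (simp add: C1Vh_def)
    then show ?thesis by (rule continuous_on_eq) (simp add: e that)
  qed
  show "C1Vh p K T g"
    using f d e c unfolding C1Vh_def by (simp add: Vh_def eq)
qed

lemma tilde_eq: "tilde T b c psi = (\<lambda>t k x. psi t k x + b / c\<^sup>2 * tder T psi t k x)"
  by (simp add: tilde_def fun_eq_iff)

lemma has_derivative_within_Icc_interior:
  assumes "(f has_real_derivative d) (at t within {a..b})" "a < t" "t < b"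
  shows "(f has_vector_derivative d) (at t)"
  using assms by (simp add: at_within_Icc_at has_real_derivative_iff_has_vector_derivative)

text \<open>A continuous form of Gronwall's lemma in which the smallness of the coefficient replaces the
  exponential: evaluate the integrated inequality at a maximum point.\<close>

lemma absorbed_gronwall:
  fixes G G' g :: "real \<Rightarrow> real"
  assumes T: "T > 0" and G: "continuous_on {0..T} G" "\<And>t. t \<in> {0..T} \<Longrightarrow> G t \<ge> 0"
    and G': "\<And>t. 0 < t \<Longrightarrow> t < T \<Longrightarrow> (G has_vector_derivative G' t) (at t)"
    and le: "\<And>t. 0 < t \<Longrightarrow> t < T \<Longrightarrow> G' t \<le> g t * G t"
    and g: "g integrable_on {0..T}" "\<And>t. t \<in> {0..T} \<Longrightarrow> g t \<ge> 0" "integral {0..T} g \<le> \<gamma>" "\<gamma> < 1"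
    and t: "t \<in> {0..T}"
  shows "(1 - \<gamma>) * G t \<le> G 0"
proof -
  obtain s where s: "s \<in> {0..T}" "\<And>t. t \<in> {0..T} \<Longrightarrow> G t \<le> G s"
    using continuous_attains_sup[OF compact_Icc _ G(1)] T by auto
  have "(G' has_integral (G s - G 0)) {0..s}"
    using s T by (intro fundamental_theorem_of_calculus_interior G' continuous_on_subset[OF G(1)]) auto
  \<comment> \<open>The differential inequality is available only at interior times, so both
    integrals are moved to the open interval.\<close>
  then have i1: "(G' has_integral (G s - G 0)) {0<..<s}"
    by (simp add: has_integral_Icc_iff_Ioo)
  have gi: "g integrable_on {0..s}" using integrable_on_subinterval[OF g(1), of 0 s] s by auto
  have "((\<lambda>t. g t * G s) has_integral (integral {0..s} g * G s)) {0..s}"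
    by (intro has_integral_mult_left integrable_integral gi)
  then have i2: "((\<lambda>t. g t * G s) has_integral (integral {0..s} g * G s)) {0<..<s}"
    by (simp add: has_integral_Icc_iff_Ioo)
  have "G s - G 0 \<le> integral {0..s} g * G s"
  proof (rule has_integral_le[OF i1 i2])
    fix t assume t: "t \<in> {0<..<s}"
    have "g t * G t \<le> g t * G s" using s t g(2) by (intro mult_left_mono) auto
    then show "G' t \<le> g t * G s" using le[of t] t s by simp
  qed
  also have "\<dots> \<le> \<gamma> * G s"
  proof (intro mult_right_mono G(2) s(1))
    have "integral {0..s} g \<le> integral {0..T} g"
      using s g(2) by (intro integral_subset_le gi g(1)) auto
    then show "integral {0..s} g \<le> \<gamma>" using g(3) by linarith
  qed
  finally have "(1 - \<gamma>) * G s \<le> G 0" by (simp add: left_diff_distrib)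
  moreover have "(1 - \<gamma>) * G t \<le> (1 - \<gamma>) * G s" using s(2)[OF t] g(4) by (intro mult_left_mono) auto
  ultimately show ?thesis by linarith
qed

text \<open>Superlevel sets of a supremum of continuous functions are unions of open sets, so
  measurability holds for uncountable families too. Integrability matters because
  \<open>integral\<close> is 0 for a non-integrable function, and a bound on it would then say
  nothing.\<close>

lemma integrable_cSUP_bounded:
  fixes f :: "'i \<Rightarrow> real \<Rightarrow> real"
  assumes A: "A \<noteq> {}" and f: "\<And>i. i \<in> A \<Longrightarrow> continuous_on {0..T} (f i)"
    and B: "\<And>i t. i \<in> A \<Longrightarrow> t \<in> {0..T} \<Longrightarrow> 0 \<le> f i t \<and> f i t \<le> B" and T: "T > 0"
  shows "(\<lambda>t. SUP i\<in>A. f i t) integrable_on {0..T}"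
proof -
  define cl where "cl t = max 0 (min T t)" for t :: real
  have cl: "cl t \<in> {0..T}" "t \<in> {0..T} \<Longrightarrow> cl t = t" for t
    using T by (auto simp: cl_def)
  have ccl: "continuous_on UNIV cl" unfolding cl_def by (intro continuous_intros)
  define h where "h t = (SUP i\<in>A. f i (cl t))" for t
  have bdd: "bdd_above ((\<lambda>i. f i (cl t)) ` A)" for t using B cl(1) by (auto intro!: bdd_aboveI2)
  have hb: "0 \<le> h t" "h t \<le> B" for t
  proof -
    obtain i where i: "i \<in> A" using A by blast
    have "0 \<le> f i (cl t)" using B[OF i cl(1)] by blast
    also have "\<dots> \<le> h t" unfolding h_def by (rule cSUP_upper[OF i bdd])
    finally show "0 \<le> h t" .
    show "h t \<le> B" unfolding h_def using B cl(1) by (intro cSUP_least[OF A]) blast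
  qed
  have m: "h \<in> borel_measurable borel"
  proof (rule borel_measurableI_greater)
    fix y
    have "y < h t \<longleftrightarrow> (\<exists>i\<in>A. y < f i (cl t))" for t
      unfolding h_def by (rule less_cSUP_iff[OF A bdd])
    then have "{t. y < h t} = (\<Union>i\<in>A. {t. y < f i (cl t)})" by blast
    moreover have "open \<dots>"
    proof (intro open_UN ballI open_Collect_less continuous_intros)
      fix i assume "i \<in> A"
      show "continuous_on UNIV (\<lambda>t. f i (cl t))"
        by (rule continuous_on_compose2[OF f[OF \<open>i \<in> A\<close>] ccl]) (use cl in auto)
    qed
    ultimately show "{t \<in> space borel. y < h t} \<in> sets borel" by simp
  qed
  have "set_integrable lborel {0..T} h"
    unfolding set_integrable_def using hb m T
    by (intro integrableI_bounded_set_indicator[where B = B]) (auto simp: emeasure_lborel_Icc_eq)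
  then have "h integrable_on {0..T}" by (rule set_borel_integral_eq_integral(1))
  then show ?thesis
    by (rule integrable_eq) (simp add: h_def cl)
qed

context dg_mesh begin

lemma vlin_zero:
  assumes "vlin L" "Vh p K u" "\<And>k. k \<in> K \<Longrightarrow> u k = (\<lambda>x. 0)" shows "L u = 0"
proof -
  have "L u = L (\<lambda>k x. 0 * u k x)" using assms(3) by (intro vlinD(3)[OF assms(1)]) auto
  also have "\<dots> = 0" using vlinD(2)[OF assms(1,2), of 0] by simp
  finally show ?thesis .
qed

lemma ah_commute: "ah c \<beta> p Om K u v = ah c \<beta> p Om K v u"
proof -
  have "pen_form c \<beta> u v = pen_form c \<beta> v u" by (simp add: pen_form_def inner_commute)
  moreover have "grad_ip K u v = grad_ip K v u" by (simp add: grad_ip_def inner_commute)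
  ultimately show ?thesis by (simp add: ah_eq)
qed

text \<open>Expansion in the basis turns pointwise continuity in time into joint continuity on the
  compact set of times and points.\<close>

lemma C0Vh_bounded:
  assumes "C0Vh p K T f" "k \<in> K"
  shows "\<exists>B. \<forall>t\<in>{0..T}. \<forall>x\<in>closure k. \<bar>f t k x\<bar> \<le> B"
proof -
  define F where "F tx = (\<Sum>i\<in>Idx. cf (f (fst tx)) i * bas i k (snd tx))" for tx :: "real \<times> (real^'n)"
  have "continuous_on ({0..T} \<times> closure k) F"
    unfolding F_def
  proof (intro continuous_intros)
    fix i assume i: "i \<in> Idx"
    show "continuous_on ({0..T} \<times> closure k) (\<lambda>tx. cf (f (fst tx)) i)"
      by (rule continuous_on_compose2[OF cf_continuous[OF assms(1) i]]) (auto intro: continuous_intros)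
    show "continuous_on ({0..T} \<times> closure k) (\<lambda>tx. bas i k (snd tx))"
      by (rule continuous_on_compose2[OF Vh_continuous[OF Vh_bas[OF i] assms(2)]]) (auto intro: continuous_intros)
  qed
  moreover have "compact ({0..T} \<times> closure k)"
    using el(3)[OF assms(2)] by (intro compact_Times) (auto simp: compact_closure)
  ultimately have "bounded (F ` ({0..T} \<times> closure k))"
    by (intro compact_imp_bounded compact_continuous_image)
  then obtain B where B: "\<And>tx. tx \<in> {0..T} \<times> closure k \<Longrightarrow> \<bar>F tx\<bar> \<le> B"
    by (auto simp: bounded_iff)
  have "\<bar>f t k x\<bar> \<le> B" if "t \<in> {0..T}" "x \<in> closure k" for t x
  proof -
    have "f t k x = F (t, x)"
      using assms that fun_cong[OF Vh_expand[of "f t" k], of x] by (simp add: F_def C0Vh_def)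
    then show ?thesis using B[of "(t, x)"] that by simp
  qed
  then show ?thesis by blast
qed

end

text \<open>The stability of the interior penalty form enters only through the bound on its
  consistency term.\<close>

locale dg_wave = dg_mesh Om K p for Om :: "(real^'n) set" and K p +
  fixes c b \<beta> T a0 \<gamma> :: real and al :: "real \<Rightarrow> (real^'n) set \<Rightarrow> real^'n \<Rightarrow> real"
  assumes K_ne: "K \<noteq> {}" and c: "c > 0" and b: "b \<ge> 0" and beta: "\<beta> \<ge> 0" and T: "T > 0" and a0: "a0 > 0"
    and al: "C1Vh p K T al"
    and al_bounds: "\<And>t k x. t \<in> {0..T} \<Longrightarrow> k \<in> K \<Longrightarrow> x \<in> closure k \<Longrightarrow> a0 \<le> al t k x"
    and al_var: "integral {0..T} (\<lambda>t. SUP kx\<in>(SIGMA k:K. k). \<bar>tder T al t (fst kx) (snd kx) / al t (fst kx) (snd kx)\<bar>) \<le> \<gamma>"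
    and gamma: "\<gamma> < 1"
    and cons_bound: "\<And>u. Vh p K u \<Longrightarrow> \<bar>cons_form c u u\<bar> \<le> (c\<^sup>2 * grad_ip K u u + pen_form c \<beta> u u) / 4"
begin

definition dgnorm2 where "dgnorm2 u = c\<^sup>2 * grad_ip K u u + pen_form c \<beta> u u"

lemma dgnorm2_nonneg: "dgnorm2 u \<ge> 0"
  unfolding dgnorm2_def using grad_ip_nonneg pen_form_nonneg beta by (intro add_nonneg_nonneg) auto

text \<open>For equal arguments the consistency form is subtracted twice, each time with absolute
  value at most a quarter of \<open>dgnorm2\<close>.\<close>

lemma ah_coercive:
  assumes "Vh p K u"
  shows "dgnorm2 u / 2 \<le> ah c \<beta> p Om K u u" "ah c \<beta> p Om K u u \<le> 3 / 2 * dgnorm2 u"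
proof -
  have "cons_form c u u \<le> dgnorm2 u / 4" "- cons_form c u u \<le> dgnorm2 u / 4"
    using abs_le_D1[OF cons_bound[OF assms]] abs_le_D2[OF cons_bound[OF assms]] by (simp_all only: dgnorm2_def)
  moreover have "ah c \<beta> p Om K u u = dgnorm2 u - 2 * cons_form c u u" by (simp add: ah_eq dgnorm2_def)
  ultimately show "dgnorm2 u / 2 \<le> ah c \<beta> p Om K u u" "ah c \<beta> p Om K u u \<le> 3 / 2 * dgnorm2 u"
    by simp_all
qed

lemma energy_eq:
  "energy p Om K c b \<beta> T al psi t = wip K (al t) (tder T psi t) (tder T psi t)
     + b / c\<^sup>2 * integral {0..t} (\<lambda>s. wip K (al s) (tder T (tder T psi) s) (tder T (tder T psi) s))
     + dgnorm2 (tilde T b c psi t)"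
  by (simp add: energy_def dgnorm2_def pen_form_def)

lemma al_pos: "t \<in> {0..T} \<Longrightarrow> k \<in> K \<Longrightarrow> x \<in> k \<Longrightarrow> a0 \<le> al t k x"
  using al_bounds closure_subset by blast

definition al_rate where
  "al_rate t = (SUP kx\<in>(SIGMA k:K. k). \<bar>tder T al t (fst kx) (snd kx) / al t (fst kx) (snd kx)\<bar>)"

lemma al_rate_props:
  "al_rate integrable_on {0..T}" "t \<in> {0..T} \<Longrightarrow> al_rate t \<ge> 0"
  "t \<in> {0..T} \<Longrightarrow> k \<in> K \<Longrightarrow> x \<in> k \<Longrightarrow> tder T al t k x \<le> al_rate t * al t k x"
proof -
  define f where "f kx t = \<bar>tder T al t (fst kx) (snd kx) / al t (fst kx) (snd kx)\<bar>" for kx t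
  let ?A = "SIGMA k:K. k"
  have "\<exists>B. \<forall>t\<in>{0..T}. \<forall>x\<in>closure k. \<bar>tder T al t k x\<bar> \<le> B" if "k \<in> K" for k
    using C0Vh_bounded[OF C1Vh_imp_C0Vh(2)[OF al] that] .
  then have "\<forall>k\<in>K. \<exists>B. \<forall>t\<in>{0..T}. \<forall>x\<in>closure k. \<bar>tder T al t k x\<bar> \<le> B" by blast
  from bchoice[OF this] obtain B where
    B: "\<forall>k\<in>K. \<forall>t\<in>{0..T}. \<forall>x\<in>closure k. \<bar>tder T al t k x\<bar> \<le> B k" ..
  define D where "D = (\<Sum>k\<in>K. \<bar>B k\<bar>) / a0"
  \<comment> \<open>A bound uniform in time and space: a supremum of reals dominates its family only
    if the family is bounded above.\<close>
  have fB: "0 \<le> f kx t \<and> f kx t \<le> D" if kx: "kx \<in> ?A" and t: "t \<in> {0..T}" for kx t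
  proof -
    obtain k x where k: "kx = (k, x)" "k \<in> K" "x \<in> k" using kx by auto
    have "x \<in> closure k" using k closure_subset by blast
    then have "\<bar>tder T al t k x\<bar> \<le> B k" using B k t by blast
    also have "\<dots> \<le> \<bar>B k\<bar>" by simp
    also have "\<dots> \<le> (\<Sum>k\<in>K. \<bar>B k\<bar>)" using finite_K k by (intro member_le_sum) auto
    finally have "\<bar>tder T al t k x\<bar> / al t k x \<le> (\<Sum>k\<in>K. \<bar>B k\<bar>) / a0"
      using al_pos[OF t k(2,3)] a0 by (intro frac_le sum_nonneg) auto
    then show ?thesis using al_pos[OF t k(2,3)] a0 by (simp add: f_def k D_def abs_divide)
  qed
  have A: "?A \<noteq> {}" using K_ne el(2) by blast
  have fc: "continuous_on {0..T} (f kx)" if kx: "kx \<in> ?A" for kx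
  proof -
    obtain k x where k: "kx = (k, x)" "k \<in> K" "x \<in> k" using kx by auto
    have "continuous_on {0..T} (\<lambda>t. tder T al t k x)" "continuous_on {0..T} (\<lambda>t. al t k x)"
      using C1Vh_imp_C0Vh[OF al] k(2) by (simp_all add: C0Vh_def)
    moreover have "\<forall>t\<in>{0..T}. al t k x \<noteq> 0" using al_pos k a0 by fastforce
    ultimately show ?thesis unfolding f_def k by (auto intro!: continuous_intros)
  qed
  have rate: "al_rate = (\<lambda>t. SUP kx\<in>?A. f kx t)" by (simp add: al_rate_def f_def fun_eq_iff)
  show "al_rate integrable_on {0..T}"
    unfolding rate by (rule integrable_cSUP_bounded[OF A fc fB T])
  have up: "f kx t \<le> al_rate t" if "kx \<in> ?A" "t \<in> {0..T}" for kx t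
    unfolding rate using fB that(2) by (intro cSUP_upper that(1)) (auto intro!: bdd_aboveI2)
  show "al_rate t \<ge> 0" if "t \<in> {0..T}"
  proof -
    obtain kx where "kx \<in> ?A" using A by blast
    then show ?thesis using up[of kx t] fB[of kx t] that by linarith
  qed
  show "tder T al t k x \<le> al_rate t * al t k x" if "t \<in> {0..T}" "k \<in> K" "x \<in> k"
  proof -
    have pos: "al t k x > 0" using al_pos[OF that] a0 by linarith
    have "(k, x) \<in> ?A" using that by simp
    from up[OF this that(1)] have "\<bar>tder T al t k x / al t k x\<bar> \<le> al_rate t" by (simp add: f_def)
    then have "tder T al t k x / al t k x \<le> al_rate t" by linarith
    then show ?thesis using pos by (simp add: pos_divide_le_eq)
  qed
qed

text \<open>\<open>G\<close> is built like the energy, but with \<open>ah\<close> in place of the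
  mesh norm. Lower coercivity gives the factor 4 between the energy and \<open>G\<close>, upper
  coercivity gives \<open>G 0\<close> at most the initial energy, and
  \<open>absorbed_gronwall\<close> contributes \<open>1 / (1 - \<gamma>)\<close>.\<close>

lemma energy_estimate:
  assumes sol: "is_solution p Om K c b \<beta> T al psi0 psi1 psi" and t: "t \<in> {0..T}"
  shows "energy p Om K c b \<beta> T al psi t \<le> 4 / (1 - \<gamma>) * energy p Om K c b \<beta> T al psi 0"
proof -
  define d1 where "d1 = tder T psi"
  define d2 where "d2 = tder T d1"
  define til where "til = tilde T b c psi"
  have C: "C1Vh p K T psi" "C1Vh p K T d1" using sol by (auto simp: is_solution_def C2Vh_def d1_def)
  have til: "C1Vh p K T til" "\<And>k t. k \<in> K \<Longrightarrow> t \<in> {0..T} \<Longrightarrow> tder T til t k = (\<lambda>x. d1 t k x + b / c\<^sup>2 * d2 t k x)"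
    using C1Vh_lincomb[OF T C, where r = "b / c\<^sup>2"] by (simp_all add: til_def tilde_eq d1_def d2_def)
  define D where "D s = wip K (al s) (d2 s) (d2 s)" for s
  define W where "W s = wip K (al s) (d1 s) (d1 s)" for s
  define A where "A s = ah c \<beta> p Om K (til s) (til s)" for s
  define G where "G s = W s / 2 + A s / 2 + b / c\<^sup>2 * integral {0..s} D" for s
  have D_cont: "continuous_on {0..T} D"
    unfolding D_def d2_def by (intro wip_continuous C1Vh_imp_C0Vh al C)
  have Vt: "Vh p K (al s)" "Vh p K (tder T al s)" "Vh p K (d1 s)" "Vh p K (d2 s)" "Vh p K (til s)" "Vh p K (tder T til s)"
    if "s \<in> {0..T}" for s
    using C1Vh_Vh[OF al that] C1Vh_Vh[OF C(2) that] C1Vh_Vh[OF til(1) that] by (simp_all add: d2_def)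
  have nn: "al s k x \<ge> 0" if "s \<in> {0..T}" "k \<in> K" "x \<in> k" for s k x
    using al_pos[OF that] a0 by linarith
  have W0: "W s \<ge> 0" and D0: "D s \<ge> 0" if "s \<in> {0..T}" for s
    unfolding W_def D_def using nn that by (auto intro!: wip_nonneg)
  have A0: "A s \<ge> dgnorm2 (til s) / 2" "A s \<le> 3/2 * dgnorm2 (til s)" if "s \<in> {0..T}" for s
    using ah_coercive[OF Vt(5)[OF that]] by (simp_all add: A_def)
  have I0: "integral {0..s} D \<ge> 0" if "s \<in> {0..T}" for s
    using D0 that by (intro integral_nonneg integrable_continuous_real continuous_on_subset[OF D_cont]) auto
  have bc: "b / c\<^sup>2 \<ge> 0" using b by simp
  have deriv: "(G has_real_derivative (wip K (tder T al s) (d1 s) (d1 s) + 2 * wip K (al s) (d2 s) (d1 s)) / 2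
        + 2 * ah c \<beta> p Om K (til s) (tder T til s) / 2 + b / c\<^sup>2 * D s) (at s within {0..T})"
    if s: "s \<in> {0..T}" for s
  proof -
    have dW: "(W has_real_derivative wip K (tder T al s) (d1 s) (d1 s) + 2 * wip K (al s) (d2 s) (d1 s)) (at s within {0..T})"
      using wip_deriv[OF al C(2) C(2) s] unfolding W_def d2_def
      by (simp add: wip_commute[of "al s" "d1 s" "tder T d1 s"] add.commute)
    have dA: "(A has_real_derivative 2 * ah c \<beta> p Om K (til s) (tder T til s)) (at s within {0..T})"
      using vbil_deriv[OF vbil_ah til(1) til(1) s, of c \<beta>] unfolding A_def
      by (simp add: ah_commute[of c \<beta> "tder T til s" "til s"])
    have dI: "((\<lambda>s. integral {0..s} D) has_real_derivative D s) (at s within {0..T})"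
      using integral_has_vector_derivative[OF D_cont s]
      by (simp add: has_real_derivative_iff_has_vector_derivative)
    show ?thesis unfolding G_def
      by (intro DERIV_add DERIV_cdivide DERIV_cmult dW dA dI)
  qed
  have G_cont: "continuous_on {0..T} G"
    using DERIV_continuous[OF deriv] by (simp add: continuous_on_eq_continuous_within)
  \<comment> \<open>With the time derivative of \<open>til\<close> as test function the mass term
    splits into half the derivative of the kinetic energy, up to the term in
    \<open>tder T al\<close>, and the dissipation \<open>b / c\<^sup>2 * D s\<close>.\<close>
  have test: "wip K (al s) (d2 s) (d1 s) + b / c\<^sup>2 * D s + ah c \<beta> p Om K (til s) (tder T til s) = 0"
    if s: "0 < s" "s < T" for s
  proof -
    have sT: "s \<in> {0..T}" using s by simp
    have "wip K (al s) (d2 s) (tder T til s) + ah c \<beta> p Om K (til s) (tder T til s) = 0"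
      using sol s Vt(6)[OF sT] unfolding is_solution_def d1_def d2_def til_def by simp
    moreover have "wip K (al s) (d2 s) (tder T til s) = wip K (al s) (d2 s) (\<lambda>k x. d1 s k x + b / c\<^sup>2 * d2 s k x)"
      by (rule vlinD(3)[OF wip_lin(3)[OF Vt(1,4)[OF sT]]]) (simp only: til(2)[OF _ sT])
    moreover have "\<dots> = wip K (al s) (d2 s) (d1 s) + b / c\<^sup>2 * D s"
      using vlinD(1)[OF wip_lin(3)[OF Vt(1,4)[OF sT]] Vt(3)[OF sT] Vh_cmult[OF Vt(4)[OF sT]], of "b / c\<^sup>2"]
        vlinD(2)[OF wip_lin(3)[OF Vt(1,4)[OF sT]] Vt(4)[OF sT], of "b / c\<^sup>2"]
      by (simp add: D_def)
    ultimately show ?thesis by simp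
  qed
  have G_nonneg: "G s \<ge> 0" and W_le: "W s \<le> 2 * G s" if "s \<in> {0..T}" for s
  proof -
    have "b / c\<^sup>2 * integral {0..s} D \<ge> 0" using bc I0[OF that] by (rule mult_nonneg_nonneg)
    then show "G s \<ge> 0" "W s \<le> 2 * G s"
      using W0[OF that] A0(1)[OF that] dgnorm2_nonneg[of "til s"] by (simp_all add: G_def)
  qed
  \<comment> \<open>The tested equation cancels out of the derivative of \<open>G\<close>; only the
    term with the time derivative of \<open>al\<close> survives.\<close>
  have aux: "(a + 2 * w) / 2 + 2 * x / 2 + y = a / 2" if "w + y + x = 0" for a w x y :: real
    using that by (simp add: field_simps)
  have main: "(1 - \<gamma>) * G t \<le> G 0"
  proof (rule absorbed_gronwall[OF T G_cont G_nonneg _ _ al_rate_props(1,2) _ gamma t])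
    fix s assume s: "0 < s" "s < T"
    then have sT: "s \<in> {0..T}" by simp
    have e: "(wip K (tder T al s) (d1 s) (d1 s) + 2 * wip K (al s) (d2 s) (d1 s)) / 2
        + 2 * ah c \<beta> p Om K (til s) (tder T til s) / 2 + b / c\<^sup>2 * D s = wip K (tder T al s) (d1 s) (d1 s) / 2"
      by (rule aux[OF test[OF s]])
    show "(G has_vector_derivative wip K (tder T al s) (d1 s) (d1 s) / 2) (at s)"
      using has_derivative_within_Icc_interior[OF deriv[OF sT] s] unfolding e .
    have "wip K (tder T al s) (d1 s) (d1 s) \<le> wip K (\<lambda>k x. al_rate s * al s k x) (d1 s) (d1 s)"
      using al_rate_props(3)[OF sT] by (intro wip_mono Vt[OF sT] Vh_cmult) auto
    also have "\<dots> = al_rate s * W s"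
      unfolding W_def by (rule vlinD(2)[OF wip_lin(1)[OF Vt(3,3)[OF sT]] Vt(1)[OF sT]])
    also have "\<dots> \<le> al_rate s * (2 * G s)"
      using W_le[OF sT] al_rate_props(2)[OF sT] by (rule mult_left_mono)
    finally show "wip K (tder T al s) (d1 s) (d1 s) / 2 \<le> al_rate s * G s" by simp
  next
    show "integral {0..T} al_rate \<le> \<gamma>" using al_var by (simp add: al_rate_def[abs_def])
  qed
  have z: "0 \<in> {0..T}" using T by simp
  have "energy p Om K c b \<beta> T al psi t \<le> 4 * G t"
  proof -
    have "b / c\<^sup>2 * integral {0..t} D \<ge> 0" using bc I0[OF t] by (rule mult_nonneg_nonneg)
    moreover have "energy p Om K c b \<beta> T al psi t = W t + b / c\<^sup>2 * integral {0..t} D + dgnorm2 (til t)"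
      unfolding energy_eq W_def D_def[abs_def] til_def d1_def d2_def by simp
    ultimately show ?thesis using W0[OF t] A0(1)[OF t] by (simp add: G_def)
  qed
  also have "G t \<le> G 0 / (1 - \<gamma>)" using main gamma by (simp add: pos_le_divide_eq mult.commute)
  \<comment> \<open>The integral over \<open>{0..0}\<close> vanishes, and \<open>A 0 / 2\<close> is
    at most 3/4 of the squared mesh norm.\<close>
  also have "G 0 \<le> energy p Om K c b \<beta> T al psi 0"
  proof -
    have "energy p Om K c b \<beta> T al psi 0 = W 0 + dgnorm2 (til 0)"
      unfolding energy_eq W_def D_def[abs_def] til_def d1_def d2_def by simp
    then show ?thesis using W0[OF z] A0(2)[OF z] dgnorm2_nonneg[of "til 0"] by (simp add: G_def)
  qed
  finally show ?thesis using gamma by (simp add: divide_right_mono)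
qed

text \<open>The difference solves the problem with zero data, so its energy is never positive. The
  kinetic part is definite and forces the time derivative to vanish, so the difference keeps its
  initial value 0.\<close>

lemma solution_unique:
  assumes psi: "is_solution p Om K c b \<beta> T al psi0 psi1 psi" and phi: "is_solution p Om K c b \<beta> T al psi0 psi1 phi"
    and t: "t \<in> {0..T}" and k: "k \<in> K"
  shows "psi t k = phi t k"
proof -
  define d where "d = (\<lambda>t k x. psi t k x + (- 1) * phi t k x)"
  have C: "C1Vh p K T psi" "C1Vh p K T (tder T psi)" "C1Vh p K T phi" "C1Vh p K T (tder T phi)"
    using psi phi by (auto simp: is_solution_def C2Vh_def)
  have d: "C1Vh p K T d" "\<And>k t. k \<in> K \<Longrightarrow> t \<in> {0..T} \<Longrightarrow> tder T d t k = (\<lambda>x. tder T psi t k x + (- 1) * tder T phi t k x)"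
    unfolding d_def by (rule C1Vh_lincomb[OF T C(1,3)]; assumption)+
  \<comment> \<open>\<open>tder T d\<close> is known to equal this explicit difference only on
    \<open>K\<close> and \<open>{0..T}\<close>; the second derivative is computed for
    \<open>d'\<close> and transferred by \<open>C1Vh_cong\<close>.\<close>
  define d' where "d' = (\<lambda>t k x. tder T psi t k x + (- 1) * tder T phi t k x)"
  have d': "C1Vh p K T d'" "\<And>k t. k \<in> K \<Longrightarrow> t \<in> {0..T} \<Longrightarrow> tder T d' t k = (\<lambda>x. tder T (tder T psi) t k x + (- 1) * tder T (tder T phi) t k x)"
    unfolding d'_def by (rule C1Vh_lincomb[OF T C(2,4)]; assumption)+
  have dd: "C1Vh p K T (tder T d)" "\<And>k t. k \<in> K \<Longrightarrow> t \<in> {0..T} \<Longrightarrow> tder T (tder T d) t k = tder T d' t k"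
    using C1Vh_cong[OF d'(1), of "tder T d"] d(2) T by (simp_all add: d'_def)
  have zT: "0 \<in> {0..T}" using T by simp
  have sol: "is_solution p Om K c b \<beta> T al (\<lambda>k x. 0) (\<lambda>k x. 0) d"
    unfolding is_solution_def C2Vh_def
  proof (intro conjI ballI allI impI d(1) dd(1))
    fix k assume k: "k \<in> K"
    have "psi 0 k = phi 0 k" "tder T psi 0 k = tder T phi 0 k"
      using psi phi k by (simp_all add: is_solution_def)
    then show "d 0 k = (\<lambda>x. 0)" "tder T d 0 k = (\<lambda>x. 0)" using d(2)[OF k zT] by (simp_all add: d_def)
  next
    fix s v assume s: "s \<in> {0<..T}" and v: "Vh p K v"
    then have sT: "s \<in> {0..T}" by simp
    have V: "Vh p K (al s)" "Vh p K (tder T (tder T psi) s)" "Vh p K (tder T (tder T phi) s)"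
      "Vh p K (tilde T b c psi s)" "Vh p K (tilde T b c phi s)"
      using C1Vh_Vh[OF al sT] C1Vh_Vh[OF C(1) sT] C1Vh_Vh[OF C(2) sT] C1Vh_Vh[OF C(3) sT] C1Vh_Vh[OF C(4) sT]
      by (simp_all add: Vh_tilde)
    have lin: "L (\<lambda>k x. u k x + (- 1) * w k x) = L u - L w" if "vlin L" "Vh p K u" "Vh p K w" for L u w
      using vlinD(1)[OF that(1,2) Vh_cmult[OF that(3)], of "-1"] vlinD(2)[OF that(1,3), of "-1"] by simp
    have "wip K (al s) (tder T (tder T d) s) v
        = wip K (al s) (\<lambda>k x. tder T (tder T psi) s k x + (- 1) * tder T (tder T phi) s k x) v"
      by (rule vlinD(3)[OF wip_lin(2)[OF V(1) v]]) (simp only: dd(2)[OF _ sT] d'(2)[OF _ sT])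
    also have "\<dots> = wip K (al s) (tder T (tder T psi) s) v - wip K (al s) (tder T (tder T phi) s) v"
      by (rule lin[OF wip_lin(2)[OF V(1) v] V(2,3)])
    finally have 1: "wip K (al s) (tder T (tder T d) s) v
      = wip K (al s) (tder T (tder T psi) s) v - wip K (al s) (tder T (tder T phi) s) v" .
    have vl: "vlin (\<lambda>u. ah c \<beta> p Om K u v)" using vbil_ah v by (simp add: vbil_def)
    have "ah c \<beta> p Om K (tilde T b c d s) v = ah c \<beta> p Om K (\<lambda>k x. tilde T b c psi s k x + (- 1) * tilde T b c phi s k x) v"
      by (rule vlinD(3)[OF vl]) (simp only: tilde_eq d(2)[OF _ sT], simp add: d_def fun_eq_iff algebra_simps)
    also have "\<dots> = ah c \<beta> p Om K (tilde T b c psi s) v - ah c \<beta> p Om K (tilde T b c phi s) v"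
      by (rule lin[OF vl V(4,5)])
    finally have 2: "ah c \<beta> p Om K (tilde T b c d s) v = ah c \<beta> p Om K (tilde T b c psi s) v - ah c \<beta> p Om K (tilde T b c phi s) v" .
    show "wip K (al s) (tder T (tder T d) s) v + ah c \<beta> p Om K (tilde T b c d s) v = 0"
    proof -
      have "wip K (al s) (tder T (tder T psi) s) v + ah c \<beta> p Om K (tilde T b c psi s) v = 0"
        "wip K (al s) (tder T (tder T phi) s) v + ah c \<beta> p Om K (tilde T b c phi s) v = 0"
        using psi phi s v by (simp_all add: is_solution_def)
      then show ?thesis using 1 2 by simp
    qed
  qed
  have d0: "d 0 k = (\<lambda>x. 0)" "tder T d 0 k = (\<lambda>x. 0)" if "k \<in> K" for k
    using sol that by (simp_all add: is_solution_def)
  have V0: "Vh p K (al 0)" "Vh p K (tder T d 0)" "Vh p K (tilde T b c d 0)"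
    using C1Vh_Vh[OF al zT] C1Vh_Vh[OF d(1) zT] by (simp_all add: Vh_tilde)
  have "energy p Om K c b \<beta> T al d 0 = 0"
  proof -
    have "wip K (al 0) (tder T d 0) (tder T d 0) = 0"
      using V0 d0 by (intro vlin_zero[OF wip_lin(3)]) auto
    moreover have tz: "tilde T b c d 0 k = (\<lambda>x. 0)" if "k \<in> K" for k
      using d0[OF that] by (simp add: tilde_eq)
    then have "grad_ip K (tilde T b c d 0) (tilde T b c d 0) = 0" "pen_form c \<beta> (tilde T b c d 0) (tilde T b c d 0) = 0"
      using vlin_zero[of "grad_ip K (tilde T b c d 0)"] vlin_zero[of "pen_form c \<beta> (tilde T b c d 0)"] V0(3) vbil_grad vbil_pen[of c \<beta>]
      by (simp_all add: vbil_def)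
    ultimately show ?thesis by (simp add: energy_eq dgnorm2_def)
  qed
  then have E: "energy p Om K c b \<beta> T al d s \<le> 0" if "s \<in> {0..T}" for s
    using energy_estimate[OF sol that] by simp
  have tz: "tder T d s k x = 0" if s: "s \<in> {0..T}" for s x
  proof (rule wip_eq_0[of "al s" a0 "tder T d s"])
    have nn: "al r k x \<ge> 0" if "r \<in> {0..T}" "k \<in> K" "x \<in> k" for r k x
      using al_pos[OF that] a0 by linarith
    have "integral {0..s} (\<lambda>s. wip K (al s) (tder T (tder T d) s) (tder T (tder T d) s)) \<ge> 0"
    proof (intro integral_nonneg integrable_continuous_real)
      show "continuous_on {0..s} (\<lambda>s. wip K (al s) (tder T (tder T d) s) (tder T (tder T d) s))"
        using s by (intro continuous_on_subset[OF wip_continuous[OF C1Vh_imp_C0Vh(1)[OF al] C1Vh_imp_C0Vh(2)[OF dd(1)] C1Vh_imp_C0Vh(2)[OF dd(1)]]]) auto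
    qed (use nn s in \<open>auto intro!: wip_nonneg\<close>)
    then have "b / c\<^sup>2 * integral {0..s} (\<lambda>s. wip K (al s) (tder T (tder T d) s) (tder T (tder T d) s)) \<ge> 0"
      using b by (intro mult_nonneg_nonneg) auto
    then show "wip K (al s) (tder T d s) (tder T d s) \<le> 0"
      using E[OF s] dgnorm2_nonneg[of "tilde T b c d s"] by (simp add: energy_eq)
  qed (use al d(1) s al_pos a0 k in \<open>auto simp: C1Vh_def\<close>)
  have "d t k x = 0" for x
  proof -
    have "((\<lambda>s. d s k x) has_vector_derivative 0) (at s within {0..T})" if s: "s \<in> {0..T}" for s
    proof -
      have "((\<lambda>s. d s k x) has_vector_derivative tder T d s k x) (at s within {0..T})"
        using d(1) k s by (simp add: C1Vh_def)
      then show ?thesis by (simp only: tz[OF s])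
    qed
    then obtain q where q: "\<And>s. s \<in> {0..T} \<Longrightarrow> d s k x = q"
      using has_vector_derivative_zero_constant[of "{0..T}" "\<lambda>s. d s k x"] by (metis convex_real_interval(5))
    show ?thesis using q[OF t] q[OF zT] d0(1)[OF k] by simp
  qed
  then show ?thesis by (simp add: d_def fun_eq_iff)
qed

text \<open>In coordinates this is a first-order system for coefficients and velocities, flagged
  \<open>False\<close> and \<open>True\<close>. The mass matrix varies in time with
  \<open>al\<close>, so it is inverted for all times at once by \<open>pd_system_solvable\<close>,
  which keeps the system continuous.\<close>

lemma solution_exists:
  assumes psi0: "Vh p K psi0" and psi1: "Vh p K psi1"
  shows "\<exists>psi. is_solution p Om K c b \<beta> T al psi0 psi1 psi"
proof -
  define comb where "comb y k x = (\<Sum>i\<in>Idx. y i * bas i k x)" for y k x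
  have Vcomb: "Vh p K (comb y)" for y unfolding comb_def[abs_def] by (rule Vh_lincomb)
  have comb_lin: "L (comb y) = (\<Sum>i\<in>Idx. y i * L (bas i))" if "vlin L" for L y
    unfolding comb_def[abs_def] by (rule vlin_sum[OF that finite_Idx Vh_bas])
  define M where "M i j t = wip K (al t) (bas i) (bas j)" for i j t
  have Val: "Vh p K (al t)" if "t \<in> {0..T}" for t using al that by (simp add: C1Vh_def)
  have C0bas: "C0Vh p K T (\<lambda>t. bas i)" if "i \<in> Idx" for i using Vh_bas[OF that] by (simp add: C0Vh_def)
  have Mc: "continuous_on {0..T} (M i j)" if "i \<in> Idx" "j \<in> Idx" for i j
    unfolding M_def by (intro wip_continuous C1Vh_imp_C0Vh al C0bas that)
  have Mpd: "0 < (\<Sum>i\<in>Idx. \<Sum>j\<in>Idx. x i * M i j t * x j)" if t: "t \<in> {0..T}" and x: "\<exists>i\<in>Idx. x i \<noteq> 0" for t x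
  proof -
    have "wip K (al t) (comb x) (comb x) = (\<Sum>i\<in>Idx. x i * wip K (al t) (bas i) (comb x))"
      by (rule comb_lin[OF wip_lin(2)[OF Val[OF t] Vcomb]])
    also have "\<dots> = (\<Sum>i\<in>Idx. x i * (\<Sum>j\<in>Idx. x j * M i j t))"
      unfolding M_def by (intro sum.cong refl arg_cong2[where f = "(*)"] comb_lin wip_lin Val t Vh_bas)
    also have "\<dots> = (\<Sum>i\<in>Idx. \<Sum>j\<in>Idx. x i * M i j t * x j)"
      by (simp add: sum_distrib_left mult_ac)
    finally have e: "wip K (al t) (comb x) (comb x) = (\<Sum>i\<in>Idx. \<Sum>j\<in>Idx. x i * M i j t * x j)" .
    have "\<not> wip K (al t) (comb x) (comb x) \<le> 0"
    proof
      assume le: "wip K (al t) (comb x) (comb x) \<le> 0"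
      obtain k a where ka: "k \<in> K" "a \<in> midx p" "x (k, a) \<noteq> 0" using x by (auto simp: Idx_def)
      have "comb x k y = 0" for y
        by (rule wip_eq_0[OF Val[OF t] al_pos[OF t] a0 Vcomb le ka(1)])
      then have "(\<Sum>a\<in>midx p. x (k, a) * mon a y) = 0" for y by (simp add: comb_def bas_sum[OF ka(1)])
      then have "x (k, a) = 0"
        using mon_independent[of "real ` {..p}" p "\<lambda>a. x (k, a)" a] ka(2) by (simp add: card_image)
      then show False using ka(3) by simp
    qed
    then show ?thesis using e by simp
  qed
  \<comment> \<open>For each \<open>l\<close> this is column \<open>l\<close> of the inverse mass
    matrix, with \<open>R l i\<close> its entry in row \<open>i\<close>.\<close>
  have "\<exists>R. (\<forall>i\<in>Idx. continuous_on {0..T} (R i)) \<and> (\<forall>t\<in>{0..T}. \<forall>i\<in>Idx. (\<Sum>j\<in>Idx. M i j t * R j t) = of_bool (i = l))" for l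
    by (rule pd_system_solvable[OF finite_Idx Mc _ Mpd]) auto
  from choice[OF allI[OF this]] obtain R where R: "\<forall>l. (\<forall>i\<in>Idx. continuous_on {0..T} (R l i)) \<and>
      (\<forall>t\<in>{0..T}. \<forall>i\<in>Idx. (\<Sum>j\<in>Idx. M i j t * R l j t) = of_bool (i = l))" ..
  have Rc: "continuous_on {0..T} (R l i)" if "i \<in> Idx" for l i using R that by blast
  have RM: "(\<Sum>j\<in>Idx. M i j t * R l j t) = of_bool (i = l)" if "t \<in> {0..T}" "i \<in> Idx" for t i l using R that by blast
  define S where "S i j = ah c \<beta> p Om K (bas i) (bas j)" for i j
  \<comment> \<open>Minus the inverse mass matrix times the matrix of \<open>ah\<close>: applied to
    the coefficients of \<open>tilde\<close> it returns those of the second time derivative.\<close>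
  define Q where "Q i m t = - (\<Sum>l\<in>Idx. R l i t * S m l)" for i m t
  have Qc: "continuous_on {0..T} (Q i m)" if "i \<in> Idx" for i m
    unfolding Q_def by (intro continuous_intros Rc that)
  \<comment> \<open>Row \<open>(i, False)\<close> reads off the velocity. Row
    \<open>(i, True)\<close> applies \<open>Q\<close> to coefficient plus
    \<open>b / c\<^sup>2\<close> times velocity, the coordinates of \<open>tilde\<close>.\<close>
  define A where "A u w t = (if snd u then Q (fst u) (fst w) t * (if snd w then b / c\<^sup>2 else 1)
      else of_bool (fst w = fst u \<and> snd w))" for u w t
  let ?J = "Idx \<times> (UNIV :: bool set)"
  have Ac: "continuous_on {0..T} (A u w)" if "u \<in> ?J" "w \<in> ?J" for u w
    using Qc[of "fst u" "fst w"] that c unfolding A_def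
    by (cases "snd u") (auto intro!: continuous_intros)
  have "finite ?J" using finite_Idx by simp
  from linear_ode_solvable[where A = A and I = ?J, OF T this Ac]
  obtain y where y: "\<forall>u\<in>?J. y u 0 = (if snd u then cf psi1 (fst u) else cf psi0 (fst u)) \<and>
      (\<forall>t\<in>{0..T}. (y u has_vector_derivative (\<Sum>w\<in>?J. A u w t * y w t)) (at t within {0..T}))" by (rule exE)
  define z where "z i t = (\<Sum>m\<in>Idx. Q i m t * (y (m, False) t + b / c\<^sup>2 * y (m, True) t))" for i t
  have sumJ: "(\<Sum>w\<in>?J. f w) = (\<Sum>m\<in>Idx. f (m, False) + f (m, True))" for f :: "_ \<Rightarrow> real"
  proof -
    have "(\<Sum>w\<in>?J. f w) = (\<Sum>m\<in>Idx. \<Sum>q\<in>UNIV. f (m, q))"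
      unfolding sum.cartesian_product by (rule sum.cong) auto
    then show ?thesis by (simp add: UNIV_bool)
  qed
  have dF: "(y (i, False) has_vector_derivative y (i, True) t) (at t within {0..T})" if i: "i \<in> Idx" and t: "t \<in> {0..T}" for i t
  proof -
    have "(\<Sum>w\<in>?J. A (i, False) w t * y w t) = (\<Sum>m\<in>Idx. if m = i then y (i, True) t else 0)"
      unfolding sumJ by (intro sum.cong) (auto simp: A_def)
    also have "\<dots> = y (i, True) t" using i finite_Idx by simp
    finally have e: "(\<Sum>w\<in>?J. A (i, False) w t * y w t) = y (i, True) t" .
    have "(i, False) \<in> ?J" using i by simp
    from bspec[OF y this] t
    have "(y (i, False) has_vector_derivative (\<Sum>w\<in>?J. A (i, False) w t * y w t)) (at t within {0..T})" by blast
    then show ?thesis unfolding e .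
  qed
  have dT: "(y (i, True) has_vector_derivative z i t) (at t within {0..T})" if i: "i \<in> Idx" and t: "t \<in> {0..T}" for i t
  proof -
    have e: "(\<Sum>w\<in>?J. A (i, True) w t * y w t) = z i t"
      unfolding sumJ z_def by (intro sum.cong) (auto simp: A_def algebra_simps)
    have "(i, True) \<in> ?J" using i by simp
    from bspec[OF y this] t
    have "(y (i, True) has_vector_derivative (\<Sum>w\<in>?J. A (i, True) w t * y w t)) (at t within {0..T})" by blast
    then show ?thesis unfolding e .
  qed
  have yc: "continuous_on {0..T} (y (i, q))" if "i \<in> Idx" for i q
    unfolding continuous_on_eq_continuous_within
  proof
    fix t assume t: "t \<in> {0..T}"
    show "continuous (at t within {0..T}) (y (i, q))"
      using has_vector_derivative_continuous[OF dF[OF that t]] has_vector_derivative_continuous[OF dT[OF that t]]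
      by (cases q) simp_all
  qed
  have zc: "continuous_on {0..T} (z i)" if "i \<in> Idx" for i
    unfolding z_def by (intro continuous_intros Qc yc that)
  define psi where "psi t = comb (\<lambda>i. y (i, False) t)" for t
  have t1: "tder T psi t = comb (\<lambda>i. y (i, True) t)" if t: "t \<in> {0..T}" for t
    unfolding fun_eq_iff
  proof (intro allI)
    fix k x
    have "((\<lambda>t. psi t k x) has_vector_derivative comb (\<lambda>i. y (i, True) t) k x) (at t within {0..T})"
      unfolding psi_def comb_def using dF t
      by (intro has_vector_derivative_sum has_vector_derivative_mult_left) auto
    then show "tder T psi t k x = comb (\<lambda>i. y (i, True) t) k x" by (rule tder_eqI[OF T t])
  qed
  have d1: "((\<lambda>t. psi t k x) has_vector_derivative tder T psi t k x) (at t within {0..T})" if "t \<in> {0..T}" for t k x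
    unfolding t1[OF that] unfolding psi_def comb_def using dF that
    by (intro has_vector_derivative_sum has_vector_derivative_mult_left) auto
  have d2': "((\<lambda>t. tder T psi t k x) has_vector_derivative comb (\<lambda>i. z i t) k x) (at t within {0..T})" if t: "t \<in> {0..T}" for t k x
  proof -
    have "((\<lambda>t. comb (\<lambda>i. y (i, True) t) k x) has_vector_derivative comb (\<lambda>i. z i t) k x) (at t within {0..T})"
      unfolding comb_def using dT t by (intro has_vector_derivative_sum has_vector_derivative_mult_left) auto
    then show ?thesis by (rule has_vector_derivative_transform[OF t, rotated]) (simp add: t1)
  qed
  have t2: "tder T (tder T psi) t = comb (\<lambda>i. z i t)" if t: "t \<in> {0..T}" for t
    by (rule ext, rule ext, rule tder_eqI[OF T t], rule d2'[OF t])
  have C2: "C2Vh p K T psi"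
    unfolding C2Vh_def C1Vh_def
  proof (intro conjI ballI allI)
    fix t assume t: "t \<in> {0..T}"
    show "Vh p K (psi t)" "Vh p K (tder T psi t)" "Vh p K (tder T psi t)" "Vh p K (tder T (tder T psi) t)"
      unfolding t1[OF t] t2[OF t] by (simp_all add: psi_def Vcomb)
  next
    fix k x t assume t: "t \<in> {0..T}"
    show "((\<lambda>s. psi s k x) has_vector_derivative tder T psi t k x) (at t within {0..T})" by (rule d1[OF t])
    show "((\<lambda>s. tder T psi s k x) has_vector_derivative tder T (tder T psi) t k x) (at t within {0..T})"
      unfolding t2[OF t] by (rule d2'[OF t])
  next
    fix k x
    have "continuous_on {0..T} (\<lambda>t. comb (\<lambda>i. y (i, True) t) k x)"
      unfolding comb_def by (intro continuous_intros yc)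
    then show "continuous_on {0..T} (\<lambda>t. tder T psi t k x)"
      by (rule continuous_on_eq) (simp add: t1)
    have "continuous_on {0..T} (\<lambda>t. comb (\<lambda>i. z i t) k x)"
      unfolding comb_def by (intro continuous_intros zc)
    then show "continuous_on {0..T} (\<lambda>t. tder T (tder T psi) t k x)"
      by (rule continuous_on_eq) (simp add: t2)
  qed
  have init: "psi 0 k = psi0 k" "tder T psi 0 k = psi1 k" if k: "k \<in> K" for k
  proof -
    have z: "0 \<in> {0..T}" using T by simp
    have "y (i, False) 0 = cf psi0 i" "y (i, True) 0 = cf psi1 i" if "i \<in> Idx" for i
      using bspec[OF y, of "(i, False)"] bspec[OF y, of "(i, True)"] that by simp_all
    then show "psi 0 k = psi0 k" "tder T psi 0 k = psi1 k"
      unfolding t1[OF z] Vh_expand[OF psi0 k] Vh_expand[OF psi1 k] by (simp_all add: psi_def comb_def fun_eq_iff)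
  qed
  have eq: "wip K (al t) (tder T (tder T psi) t) v + ah c \<beta> p Om K (tilde T b c psi t) v = 0"
    if t: "t \<in> {0..T}" and v: "Vh p K v" for t v
  proof -
    define yt where "yt m = y (m, False) t + b / c\<^sup>2 * y (m, True) t" for m
    have tl: "tilde T b c psi t = comb yt"
      unfolding tilde_eq t1[OF t] unfolding psi_def comb_def yt_def sum_distrib_left sum.distrib[symmetric]
      by (intro ext sum.cong refl) (simp only: distrib_right mult.assoc)
    \<comment> \<open>Basis functions suffice as test functions by linearity. The triple sum is
      reordered so that summation over \<open>i\<close> pairs the mass matrix with its
      inverse.\<close>
    have base: "wip K (al t) (comb (\<lambda>i. z i t)) (bas j) + ah c \<beta> p Om K (comb yt) (bas j) = 0" if j: "j \<in> Idx" for j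
    proof -
      have "wip K (al t) (comb (\<lambda>i. z i t)) (bas j) = (\<Sum>i\<in>Idx. z i t * wip K (al t) (bas i) (bas j))"
        by (rule comb_lin[OF wip_lin(2)[OF Val[OF t] Vh_bas[OF j]]])
      also have "\<dots> = (\<Sum>i\<in>Idx. z i t * M j i t)"
        unfolding M_def by (intro sum.cong refl arg_cong2[where f = "(*)"] wip_commute)
      also have "\<dots> = - (\<Sum>i\<in>Idx. \<Sum>m\<in>Idx. \<Sum>l\<in>Idx. (S m l * yt m) * (M j i t * R l i t))"
      proof -
        have "z i t = - (\<Sum>m\<in>Idx. (\<Sum>l\<in>Idx. R l i t * S m l) * yt m)" for i
          by (simp only: z_def Q_def yt_def mult_minus_left sum_negf)
        then show ?thesis by (simp add: sum_distrib_left sum_distrib_right sum_negf mult_ac)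
      qed
      also have "(\<Sum>i\<in>Idx. \<Sum>m\<in>Idx. \<Sum>l\<in>Idx. (S m l * yt m) * (M j i t * R l i t))
          = (\<Sum>m\<in>Idx. \<Sum>i\<in>Idx. \<Sum>l\<in>Idx. (S m l * yt m) * (M j i t * R l i t))" by (rule sum.swap)
      also have "\<dots> = (\<Sum>m\<in>Idx. \<Sum>l\<in>Idx. \<Sum>i\<in>Idx. (S m l * yt m) * (M j i t * R l i t))"
        by (intro sum.cong refl sum.swap)
      also have "\<dots> = (\<Sum>m\<in>Idx. \<Sum>l\<in>Idx. (S m l * yt m) * of_bool (j = l))"
        unfolding sum_distrib_left[symmetric] by (simp add: RM[OF t j])
      also have "\<dots> = (\<Sum>m\<in>Idx. yt m * S m j)"
        using j finite_Idx by (intro sum.cong refl) (simp add: of_bool_def if_distrib mult_ac cong: if_cong)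
      also have "\<dots> = ah c \<beta> p Om K (comb yt) (bas j)"
      proof -
        have "vlin (\<lambda>u. ah c \<beta> p Om K u (bas j))" using vbil_ah Vh_bas[OF j] by (simp add: vbil_def)
        from comb_lin[OF this] show ?thesis by (simp add: S_def)
      qed
      finally show ?thesis by simp
    qed
    have "vlin (\<lambda>v. wip K (al t) (comb (\<lambda>i. z i t)) v + ah c \<beta> p Om K (comb yt) v)"
      using vbil_ah Vcomb by (intro vlin_lincomb(1) wip_lin Val t) (simp_all add: vbil_def)
    from vlin_expand[OF this v] show ?thesis unfolding t2[OF t] tl by (simp add: base)
  qed
  show ?thesis
    unfolding is_solution_def using C2 init eq by (intro exI[of _ psi]) auto
qed

end

section \<open>Stability of the interior penalty form\<close>

lemma set_lebesgue_integral_const: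
  assumes "A \<in> sets M" "emeasure M A < \<infinity>"
  shows "set_lebesgue_integral M A (\<lambda>x. r) = measure M A * (r::real)"
  using assms by (simp add: set_lebesgue_integral_def)

text \<open>Young's inequality weighted by the penalty \<open>w\<close>; 1/4 is the share of the
  penalty that \<open>cons_bound\<close> allows.\<close>

lemma young_face:
  fixes g J :: "'b::real_inner"
  assumes c: "c > 0" and chi: "w > 0" and M: "c^4 * (norm g)\<^sup>2 / w \<le> R"
  shows "\<bar>(c\<^sup>2 *\<^sub>R g) \<bullet> J\<bar> \<le> 1/4 * (w * (J \<bullet> J)) + R"
proof -
  have "\<bar>(c\<^sup>2 *\<^sub>R g) \<bullet> J\<bar> \<le> c\<^sup>2 * norm g * norm J"
    using Cauchy_Schwarz_ineq2[of "c\<^sup>2 *\<^sub>R g" J] by simp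
  also have "\<dots> \<le> 1/4 * (w * (norm J)\<^sup>2) + c^4 * (norm g)\<^sup>2 / w"
  proof -
    define s where "s = sqrt w"
    have s: "s > 0" "s\<^sup>2 = w" using chi by (simp_all add: s_def)
    have "0 \<le> (s * norm J / 2 - c\<^sup>2 * norm g / s)\<^sup>2" by simp
    also have "\<dots> = 1/4 * (s\<^sup>2 * (norm J)\<^sup>2) + c^4 * (norm g)\<^sup>2 / s\<^sup>2 - c\<^sup>2 * norm g * norm J"
      using s(1) by (simp add: power2_diff power_mult_distrib power_divide)
    finally show ?thesis by (simp add: s(2))
  qed
  finally show ?thesis using M by (simp add: power2_norm_eq_inner)
qed

context dg_mesh begin

text \<open>Passes from faces to elements. Each of the at most \<open>N\<close> interior faces of an
  element is bounded by its whole frontier, so overlapping faces do no harm; the extra 2 comes from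
  the boundary faces.\<close>

lemma face_sum_const_le:
  fixes m :: "(real^'n) set \<Rightarrow> real"
  assumes m: "\<And>k. k \<in> K \<Longrightarrow> m k \<ge> 0"
    and N: "\<And>k. k \<in> K \<Longrightarrow> card {k'\<in>K. closure k \<inter> closure k' \<noteq> {}} \<le> N"
  shows "face_sum Om K (\<lambda>k1 k2 x. m k1 + m k2) (\<lambda>k x. 2 * m k) \<le> real (N + 2) * (\<Sum>k\<in>K. m k * measure surf (frontier k))"
proof -
  define F where "F k1 k2 = measure surf (closure k1 \<inter> closure k2)" for k1 k2 :: "(real^'n) set"
  let ?P = "{(k1, k2). k1 \<in> K \<and> k2 \<in> K \<and> k1 \<noteq> k2}"
  have P: "?P = Sigma K (\<lambda>k. K - {k})" by auto
  have le: "measure surf G \<le> measure surf (frontier k)" if "k \<in> K" "G \<subseteq> frontier k" "G \<in> sets borel" for k G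
    using that frontier_finite[OF that(1)] by (intro measure_mono_fmeasurable) (auto simp: fmeasurable_def)
  have int: "set_lebesgue_integral surf (closure k1 \<inter> closure k2) (\<lambda>x. r) = F k1 k2 * r"
    if "k1 \<in> K" "k2 \<in> K" "k1 \<noteq> k2" for k1 k2 r
    unfolding F_def using face_emeasure_le(2)[OF that(1) interior_face_subset(1)[OF that]]
    by (intro set_lebesgue_integral_const) auto
  \<comment> \<open>Swapping the two elements preserves the face, so both summands contribute
    equally, and the half in \<open>face_sum\<close> absorbs the double counting of ordered
    pairs.\<close>
  have sw: "(\<Sum>(k1, k2)\<in>?P. m k2 * F k1 k2) = (\<Sum>(k1, k2)\<in>?P. m k1 * F k1 k2)"
    by (rule sum.reindex_bij_witness[of _ prod.swap prod.swap]) (auto simp: F_def Int_commute)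
  have "(\<Sum>(k1, k2)\<in>?P. set_lebesgue_integral surf (closure k1 \<inter> closure k2) (\<lambda>x. m k1 + m k2) / 2)
      = (\<Sum>(k1, k2)\<in>?P. m k1 * F k1 k2 / 2 + m k2 * F k1 k2 / 2)"
  proof (intro sum.cong refl, clarify)
    fix k1 k2 assume "k1 \<in> K" "k2 \<in> K" "k1 \<noteq> k2"
    from int[OF this, of "m k1 + m k2"]
    show "set_lebesgue_integral surf (closure k1 \<inter> closure k2) (\<lambda>x. m k1 + m k2) / 2
        = m k1 * F k1 k2 / 2 + m k2 * F k1 k2 / 2"
      by (simp only: distrib_left add_divide_distrib mult.commute)
  qed
  also have "\<dots> = (\<Sum>(k1, k2)\<in>?P. m k1 * F k1 k2) / 2 + (\<Sum>(k1, k2)\<in>?P. m k2 * F k1 k2) / 2"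
    by (simp add: sum.distrib sum_divide_distrib case_prod_beta)
  also have "\<dots> = (\<Sum>(k1, k2)\<in>?P. m k1 * F k1 k2)" unfolding sw by simp
  also have "\<dots> = (\<Sum>k1\<in>K. \<Sum>k2\<in>K - {k1}. m k1 * F k1 k2)"
    unfolding P using finite_K by (subst sum.Sigma) auto
  also have "\<dots> \<le> (\<Sum>k\<in>K. real N * (m k * measure surf (frontier k)))"
  proof (rule sum_mono)
    fix k assume k: "k \<in> K"
    let ?nb = "{k'\<in>K. closure k \<inter> closure k' \<noteq> {}}"
    have "(\<Sum>k2\<in>K - {k}. F k k2) \<le> (\<Sum>k2\<in>K - {k}. if closure k \<inter> closure k2 \<noteq> {} then measure surf (frontier k) else 0)"
    proof (rule sum_mono)
      fix k2 assume k2: "k2 \<in> K - {k}"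
      show "F k k2 \<le> (if closure k \<inter> closure k2 \<noteq> {} then measure surf (frontier k) else 0)"
        using le[OF k interior_face_subset(1)[OF k, of k2]] k2 by (auto simp: F_def)
    qed
    also have "\<dots> \<le> (\<Sum>k2\<in>K. if closure k \<inter> closure k2 \<noteq> {} then measure surf (frontier k) else 0)"
      using finite_K by (intro sum_mono2) auto
    also have "\<dots> = real (card ?nb) * measure surf (frontier k)"
      using finite_K by (simp add: sum.If_cases Int_def)
    also have "\<dots> \<le> real N * measure surf (frontier k)" using N[OF k] by (intro mult_right_mono) auto
    finally have "m k * (\<Sum>k2\<in>K - {k}. F k k2) \<le> m k * (real N * measure surf (frontier k))"
      using m[OF k] by (rule mult_left_mono)
    then show "(\<Sum>k2\<in>K - {k}. m k * F k k2) \<le> real N * (m k * measure surf (frontier k))"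
      by (simp add: sum_distrib_left mult_ac)
  qed
  finally have I: "(\<Sum>(k1, k2)\<in>?P. set_lebesgue_integral surf (closure k1 \<inter> closure k2) (\<lambda>x. m k1 + m k2) / 2)
      \<le> (\<Sum>k\<in>K. real N * (m k * measure surf (frontier k)))" .
  have B: "(\<Sum>k\<in>K. set_lebesgue_integral surf (closure k \<inter> frontier Om) (\<lambda>x. 2 * m k))
      \<le> (\<Sum>k\<in>K. 2 * (m k * measure surf (frontier k)))"
  proof (rule sum_mono)
    fix k assume k: "k \<in> K"
    have "set_lebesgue_integral surf (closure k \<inter> frontier Om) (\<lambda>x. 2 * m k) = measure surf (closure k \<inter> frontier Om) * (2 * m k)"
      using face_emeasure_le(2)[OF k boundary_face_subset[OF k]] by (intro set_lebesgue_integral_const) auto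
    also have "\<dots> \<le> measure surf (frontier k) * (2 * m k)"
      using le[OF k boundary_face_subset[OF k]] m[OF k] by (intro mult_right_mono) auto
    finally show "set_lebesgue_integral surf (closure k \<inter> frontier Om) (\<lambda>x. 2 * m k) \<le> 2 * (m k * measure surf (frontier k))"
      by (simp add: mult_ac)
  qed
  show ?thesis unfolding face_sum_def using add_mono[OF I B]
    by (simp add: sum_distrib_left[symmetric] distrib_right)
qed

text \<open>A pointwise bound \<open>M k\<close> on the squared gradient reduces the face integrals
  to constants after Young's inequality. Those constants are summed by
  \<open>face_sum_const_le\<close>, and every power of the diameter cancels.\<close>

lemma cons_form_le:
  fixes Ci Cf :: real
  assumes p: "p \<ge> 1" and c: "c > 0" and beta: "\<beta> > 0" and u: "Vh p K u" and v: "Vh p K v"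
    and inv: "\<And>k x. k \<in> K \<Longrightarrow> x \<in> closure k \<Longrightarrow> (norm (grad (u k) x))\<^sup>2
        \<le> Ci / diameter k ^ CARD('n) * set_lebesgue_integral lborel k (\<lambda>x. grad (u k) x \<bullet> grad (u k) x)"
    and Ci: "Ci \<ge> 0" and Cf: "Cf \<ge> 0" "\<And>k. k \<in> K \<Longrightarrow> emeasure surf (frontier k) \<le> ennreal (Cf * diameter k ^ (CARD('n) - 1))"
    and N: "\<And>k. k \<in> K \<Longrightarrow> card {k'\<in>K. closure k \<inter> closure k' \<noteq> {}} \<le> N"
  shows "\<bar>cons_form c u v\<bar> \<le> pen_form c \<beta> v v / 4 + real (N + 2) * Cf * Ci / (2 * \<beta>) * (c\<^sup>2 * grad_ip K u u)"
proof -
  let ?d = "CARD('n)"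
  have h: "diameter k > 0" if "k \<in> K" for k using diameter_open_pos el that by blast
  define I where "I k = set_lebesgue_integral lborel k (\<lambda>x. grad (u k) x \<bullet> grad (u k) x)" for k
  have I0: "I k \<ge> 0" for k unfolding I_def set_lebesgue_integral_def by (intro Bochner_Integration.integral_nonneg) simp
  define M where "M k = Ci / diameter k ^ ?d * I k" for k
  have M: "M k \<ge> 0" "x \<in> closure k \<Longrightarrow> (norm (grad (u k) x))\<^sup>2 \<le> M k" if "k \<in> K" for k x
    using inv[OF that, of x] I0[of k] Ci h[OF that] by (simp_all add: M_def I_def)
  \<comment> \<open>Half of the elementwise bound, because the squared average of two gradients is
    at most the mean of their squares. A boundary face sees a single gradient and takes
    \<open>2 * m k\<close>.\<close>
  define m where "m k = c\<^sup>2 / (2 * \<beta>) * (diameter k * M k)" for k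
  have m: "m k \<ge> 0" if "k \<in> K" for k unfolding m_def using M(1)[OF that] h[OF that] beta by simp
  have p2: "real p ^ 2 \<ge> 1" using p by simp
  \<comment> \<open>As \<open>p ^ 2\<close> is at least 1, the penalty is at least
    \<open>c\<^sup>2 * \<beta> / diameter k\<close> for each adjacent element, which trades
    \<open>1 / w\<close> for one power of the diameter.\<close>
  have chi: "c^4 * X / w \<le> c\<^sup>2 / \<beta> * (diameter k * X)" if "k \<in> K" "w \<ge> c\<^sup>2 * \<beta> * (real p ^ 2 / diameter k)" "X \<ge> 0" for k w X
  proof -
    have "c\<^sup>2 * \<beta> * (1 / diameter k) \<le> c\<^sup>2 * \<beta> * (real p ^ 2 / diameter k)"
      using p2 beta h[OF that(1)] by (intro mult_left_mono divide_right_mono) auto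
    then have le: "c\<^sup>2 * \<beta> / diameter k \<le> w" using that(2) by simp
    have pos: "c\<^sup>2 * \<beta> / diameter k > 0" using c beta h[OF that(1)] by simp
    have "c^4 * X / w \<le> c^4 * X / (c\<^sup>2 * \<beta> / diameter k)"
      using le pos that(3) by (intro divide_left_mono mult_nonneg_nonneg mult_pos_pos) auto
    also have "\<dots> = c\<^sup>2 / \<beta> * (diameter k * X)"
      using c beta h[OF that(1)] by (simp add: field_simps power2_eq_square power4_eq_xxxx)
    finally show ?thesis .
  qed
  define fi where "fi k1 k2 x = (c^2 *\<^sub>R avg_grad u k1 k2 x) \<bullet> jump v k1 k2 x" for k1 k2 x
  define fb where "fb k x = (c^2 *\<^sub>R grad (u k) x) \<bullet> bjump v k x" for k x
  define gi where "gi k1 k2 x = 1/4 * (chi_int c \<beta> p k1 k2 * (jump v k1 k2 x \<bullet> jump v k1 k2 x)) + (m k1 + m k2)" for k1 k2 x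
  define gb where "gb k x = 1/4 * (chi_bd c \<beta> p k * (bjump v k x \<bullet> bjump v k x)) + 2 * m k" for k x
  have ff: "fint fi fb" unfolding fi_def[abs_def] fb_def[abs_def] by (rule fint_cons[OF u v])
  have fp: "fint (\<lambda>k1 k2 x. 1/4 * (chi_int c \<beta> p k1 k2 * (jump v k1 k2 x \<bullet> jump v k1 k2 x)))
     (\<lambda>k x. 1/4 * (chi_bd c \<beta> p k * (bjump v k x \<bullet> bjump v k x)))"
    using fint_pen[OF v v, of c \<beta>] unfolding fint_def by simp
  have fm: "fint (\<lambda>k1 k2 x. m k1 + m k2) (\<lambda>k x. 2 * m k)"
    by (intro fintI locally_bounded_borel_const)
  have fg: "fint gi gb"
    using fp fm unfolding fint_def gi_def[abs_def] gb_def[abs_def] by (auto intro!: set_integral_add(1))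
  have bi: "\<bar>fi k1 k2 x\<bar> \<le> gi k1 k2 x" if k: "k1 \<in> K" "k2 \<in> K" and x: "x \<in> closure k1 \<inter> closure k2" for k1 k2 x
    unfolding fi_def gi_def
  proof (rule young_face[OF c])
    let ?w = "chi_int c \<beta> p k1 k2"
    have c1: "?w \<ge> c\<^sup>2 * \<beta> * (real p ^ 2 / diameter k1)" and c2: "?w \<ge> c\<^sup>2 * \<beta> * (real p ^ 2 / diameter k2)"
      unfolding chi_int_def using c beta by (intro mult_left_mono; simp)+
    have "c\<^sup>2 * \<beta> * (real p ^ 2 / diameter k1) > 0" using c beta p h[OF k(1)] by simp
    then show "?w > 0" using c1 by linarith
    let ?X = "(norm (grad (u k1) x))\<^sup>2" and ?Y = "(norm (grad (u k2) x))\<^sup>2"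
    have "(norm (avg_grad u k1 k2 x))\<^sup>2 \<le> ?X / 2 + ?Y / 2"
    proof -
      have "0 \<le> (norm (grad (u k1) x - grad (u k2) x))\<^sup>2" by simp
      then show ?thesis unfolding avg_grad_def power2_norm_eq_inner
        by (simp add: inner_add_left inner_add_right inner_diff_left inner_diff_right inner_commute field_simps)
    qed
    then have "c^4 * (norm (avg_grad u k1 k2 x))\<^sup>2 / ?w \<le> c^4 * (?X / 2 + ?Y / 2) / ?w"
      using \<open>?w > 0\<close> by (intro divide_right_mono mult_left_mono) auto
    also have "\<dots> = (c^4 * ?X / ?w) / 2 + (c^4 * ?Y / ?w) / 2"
      by (simp add: distrib_left add_divide_distrib)
    also have "\<dots> \<le> (c\<^sup>2 / \<beta> * (diameter k1 * ?X)) / 2 + (c\<^sup>2 / \<beta> * (diameter k2 * ?Y)) / 2"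
      by (intro add_mono divide_right_mono chi k c1 c2) auto
    also have "\<dots> \<le> (c\<^sup>2 / \<beta> * (diameter k1 * M k1)) / 2 + (c\<^sup>2 / \<beta> * (diameter k2 * M k2)) / 2"
      using M(2)[OF k(1), of x] M(2)[OF k(2), of x] x h[OF k(1)] h[OF k(2)] beta
      by (intro add_mono divide_right_mono mult_left_mono) auto
    finally show "c^4 * (norm (avg_grad u k1 k2 x))\<^sup>2 / ?w \<le> m k1 + m k2" by (simp add: m_def)
  qed
  have bb: "\<bar>fb k x\<bar> \<le> gb k x" if k: "k \<in> K" and x: "x \<in> closure k \<inter> frontier Om" for k x
    unfolding fb_def gb_def
  proof (rule young_face[OF c])
    let ?w = "chi_bd c \<beta> p k"
    have c1: "?w \<ge> c\<^sup>2 * \<beta> * (real p ^ 2 / diameter k)" by (simp add: chi_bd_def)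
    have "c\<^sup>2 * \<beta> * (real p ^ 2 / diameter k) > 0" using c beta p h[OF k] by simp
    then show "?w > 0" using c1 by linarith
    have "c^4 * (norm (grad (u k) x))\<^sup>2 / ?w \<le> c\<^sup>2 / \<beta> * (diameter k * (norm (grad (u k) x))\<^sup>2)"
      by (intro chi k c1) auto
    also have "\<dots> \<le> c\<^sup>2 / \<beta> * (diameter k * M k)"
      using M(2)[OF k, of x] x h[OF k] beta by (intro mult_left_mono) auto
    finally show "c^4 * (norm (grad (u k) x))\<^sup>2 / ?w \<le> 2 * m k" by (simp add: m_def)
  qed
  have "face_sum Om K gi gb = pen_form c \<beta> v v / 4 + face_sum Om K (\<lambda>k1 k2 x. m k1 + m k2) (\<lambda>k x. 2 * m k)"
    unfolding gi_def[abs_def] gb_def[abs_def] face_sum_add[OF fp fm] face_sum_cmult by (simp add: pen_form_def)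
  also have "\<dots> \<le> pen_form c \<beta> v v / 4 + real (N + 2) * (\<Sum>k\<in>K. m k * measure surf (frontier k))"
    using face_sum_const_le[OF m N] by simp
  also have "\<dots> \<le> pen_form c \<beta> v v / 4 + real (N + 2) * (\<Sum>k\<in>K. c\<^sup>2 / (2 * \<beta>) * (Cf * Ci * I k))"
  proof (intro add_left_mono mult_left_mono sum_mono)
    fix k assume k: "k \<in> K"
    have "measure surf (frontier k) \<le> Cf * diameter k ^ (?d - 1)"
      unfolding measure_def using Cf(1) Cf(2)[OF k] h[OF k] by (intro enn2real_leI) auto
    then have "m k * measure surf (frontier k) \<le> m k * (Cf * diameter k ^ (?d - 1))"
      using m[OF k] by (rule mult_left_mono)
    also have "\<dots> = c\<^sup>2 / (2 * \<beta>) * (Cf * Ci * I k) * (diameter k * diameter k ^ (?d - 1) / diameter k ^ ?d)"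
      by (simp add: m_def M_def)
    also have "diameter k * diameter k ^ (?d - 1) / diameter k ^ ?d = 1"
      using h[OF k] power_Suc[of "diameter k" "?d - 1"] by simp
    finally show "m k * measure surf (frontier k) \<le> c\<^sup>2 / (2 * \<beta>) * (Cf * Ci * I k)" by simp
  qed simp
  also have "(\<Sum>k\<in>K. c\<^sup>2 / (2 * \<beta>) * (Cf * Ci * I k)) = c\<^sup>2 / (2 * \<beta>) * (Cf * Ci * grad_ip K u u)"
    by (simp add: grad_ip_def I_def sum_distrib_left)
  also have "real (N + 2) * (c\<^sup>2 / (2 * \<beta>) * (Cf * Ci * grad_ip K u u)) = real (N + 2) * Cf * Ci / (2 * \<beta>) * (c\<^sup>2 * grad_ip K u u)"
    by simp
  finally have G: "face_sum Om K gi gb \<le> pen_form c \<beta> v v / 4 + real (N + 2) * Cf * Ci / (2 * \<beta>) * (c\<^sup>2 * grad_ip K u u)" .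
  have "face_sum Om K fi fb \<le> face_sum Om K gi gb"
    using bi bb by (intro face_sum_mono ff fg) (auto simp: abs_le_iff)
  moreover have "face_sum Om K (\<lambda>k1 k2 x. (-1) * fi k1 k2 x) (\<lambda>k x. (-1) * fb k x) \<le> face_sum Om K gi gb"
  proof (intro face_sum_mono fg)
    show "fint (\<lambda>k1 k2 x. (-1) * fi k1 k2 x) (\<lambda>k x. (-1) * fb k x)"
      unfolding fint_def by (intro conjI ballI impI set_integrable_mult_right fintD[OF ff])
  qed (use bi bb in \<open>auto simp: abs_le_iff\<close>)
  ultimately have "\<bar>face_sum Om K fi fb\<bar> \<le> face_sum Om K gi gb"
    unfolding face_sum_cmult by simp
  then show ?thesis using G by (simp add: cons_form_def fi_def[abs_def] fb_def[abs_def])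
qed

end

text \<open>Each partial derivative is again a polynomial of degree at most \<open>p\<close>, and
  enlarging the ball to \<open>k\<close> only increases the integral of a square; summing the
  components gives the claim.\<close>

lemma gradient_inverse_estimate:
  fixes c :: real
  assumes c: "c > 0"
  shows "\<exists>C>0. \<forall>(q :: real^'n \<Rightarrow> real) z h k x. poly_le p q \<longrightarrow> h > 0 \<longrightarrow> open k \<longrightarrow> bounded k \<longrightarrow>
     ball z (c * h) \<subseteq> k \<longrightarrow> x \<in> cball z h \<longrightarrow>
     (norm (grad q x))\<^sup>2 \<le> C / h ^ CARD('n) * set_lebesgue_integral lborel k (\<lambda>x. grad q x \<bullet> grad q x)"
proof -
  obtain C where C: "C > 0" and Ce: "\<forall>(q :: real^'n \<Rightarrow> real) z h x. poly_le p q \<longrightarrow> h > 0 \<longrightarrow> x \<in> cball z h \<longrightarrow>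
     (q x)\<^sup>2 \<le> C / h ^ CARD('n) * set_lebesgue_integral lborel (ball z (c * h)) (\<lambda>x. (q x)\<^sup>2)"
    using inverse_estimate[OF c, of p] by blast
  show ?thesis
  proof (intro exI[of _ C] conjI allI impI C)
    fix q :: "real^'n \<Rightarrow> real" and z x :: "real^'n" and h :: real and k
    assume q: "poly_le p q" and h: "h > 0" and k: "open k" "bounded k" "ball z (c * h) \<subseteq> k" and x: "x \<in> cball z h"
    have int: "set_integrable lborel k f" if "continuous_on UNIV f" for f :: "real^'n \<Rightarrow> real"
      using k by (intro set_integrable_lborel_continuous that) auto
    have gi: "poly_le p (\<lambda>x. grad q x $ i)" for i by (rule poly_le_grad[OF q])
    have ci: "continuous_on UNIV (\<lambda>x. (grad q x $ i)\<^sup>2)" for i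
      by (rule continuous_on_power[OF poly_le_continuous[OF gi]])
    have sq: "grad q x \<bullet> grad q x = (\<Sum>i\<in>UNIV. (grad q x $ i)\<^sup>2)" for x
      by (simp add: inner_vec_def power2_eq_square)
    have "(norm (grad q x))\<^sup>2 = (\<Sum>i\<in>UNIV. (grad q x $ i)\<^sup>2)" by (simp add: power2_norm_eq_inner sq)
    also have "\<dots> \<le> (\<Sum>i\<in>UNIV. C / h ^ CARD('n) * set_lebesgue_integral lborel k (\<lambda>x. (grad q x $ i)\<^sup>2))"
    proof (rule sum_mono)
      fix i :: 'n
      have "(grad q x $ i)\<^sup>2 \<le> C / h ^ CARD('n) * set_lebesgue_integral lborel (ball z (c * h)) (\<lambda>x. (grad q x $ i)\<^sup>2)"
        using Ce gi h x by blast
      also have "\<dots> \<le> C / h ^ CARD('n) * set_lebesgue_integral lborel k (\<lambda>x. (grad q x $ i)\<^sup>2)"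
      proof (rule mult_left_mono)
        show "set_lebesgue_integral lborel (ball z (c * h)) (\<lambda>x. (grad q x $ i)\<^sup>2) \<le> set_lebesgue_integral lborel k (\<lambda>x. (grad q x $ i)\<^sup>2)"
          unfolding set_lebesgue_integral_def
        proof (rule integral_mono)
          show "integrable lborel (\<lambda>x. indicat_real k x *\<^sub>R (grad q x $ i)\<^sup>2)"
            using int[OF ci] by (simp add: set_integrable_def)
          show "integrable lborel (\<lambda>x. indicat_real (ball z (c * h)) x *\<^sub>R (grad q x $ i)\<^sup>2)"
            using set_integrable_subset[OF int[OF ci], of "ball z (c * h)"] k(3) by (simp add: set_integrable_def)
        qed (use k(3) in \<open>auto simp: indicator_def\<close>)
      qed (use C h in simp)
      finally show "(grad q x $ i)\<^sup>2 \<le> C / h ^ CARD('n) * set_lebesgue_integral lborel k (\<lambda>x. (grad q x $ i)\<^sup>2)" .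
    qed
    also have "\<dots> = C / h ^ CARD('n) * set_lebesgue_integral lborel k (\<lambda>x. \<Sum>i\<in>UNIV. (grad q x $ i)\<^sup>2)"
      by (simp only: set_lebesgue_integral_sum[OF int[OF ci]] sum_distrib_left)
    finally show "(norm (grad q x))\<^sup>2 \<le> C / h ^ CARD('n) * set_lebesgue_integral lborel k (\<lambda>x. grad q x \<bullet> grad q x)"
      by (simp add: sq)
  qed
qed

theorem mainTheorem2:
  fixes Om :: "(real^'n) set"
    and Cv Cs \<rho> Cq \<gamma> :: real and m p :: nat
  assumes dim: "CARD('n) = 2 \<or> CARD('n) = 3"
    and dom: "open Om" "Om \<noteq> {}" "bounded Om" "convex Om" "polytope (closure Om)"
    and mconst: "Cv > 0" "Cs > 0" "\<rho> > 0" "Cq \<ge> 1"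
    and p: "p \<ge> 1"
    and gam: "0 < \<gamma>" "\<gamma> < 1"
  shows "\<exists>\<beta>0 > 0. \<exists>C > 0.
    \<forall>K c b T a0 a1 al psi0 psi1 \<beta>.
      admissible_mesh Om Cv m Cs \<rho> Cq K \<longrightarrow>
      c > 0 \<longrightarrow> b \<ge> 0 \<longrightarrow> T > 0 \<longrightarrow> a0 > 0 \<longrightarrow> a1 > 0 \<longrightarrow>
      C1Vh p K T al \<longrightarrow>
      (\<forall>t\<in>{0..T}. \<forall>k\<in>K. \<forall>x\<in>closure k. a0 \<le> al t k x \<and> al t k x \<le> a1) \<longrightarrow>
      integral {0..T} (\<lambda>t. SUP kx\<in>(SIGMA k:K. k). \<bar>tder T al t (fst kx) (snd kx) / al t (fst kx) (snd kx)\<bar>) \<le> \<gamma> \<longrightarrow>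
      Vh p K psi0 \<longrightarrow> Vh p K psi1 \<longrightarrow>
      \<beta> \<ge> \<beta>0 \<longrightarrow>
      (\<exists>psi. is_solution p Om K c b \<beta> T al psi0 psi1 psi) \<and>
      (\<forall>psi phi. is_solution p Om K c b \<beta> T al psi0 psi1 psi \<longrightarrow>
                 is_solution p Om K c b \<beta> T al psi0 psi1 phi \<longrightarrow>
                 (\<forall>t\<in>{0..T}. \<forall>k\<in>K. psi t k = phi t k)) \<and>
      (\<forall>psi. is_solution p Om K c b \<beta> T al psi0 psi1 psi \<longrightarrow>
         (\<forall>t\<in>{0..T}. energy p Om K c b \<beta> T al psi t \<le> C * energy p Om K c b \<beta> T al psi 0))"
proof -
  obtain c1 where c1: "c1 > 0" and ball: "\<forall>K k. admissible_mesh Om Cv m Cs \<rho> Cq K \<longrightarrow> k \<in> K \<longrightarrow>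
     diameter k > 0 \<and>
     (\<exists>z. ball z (c1 * diameter k) \<subseteq> k \<and> closure k \<subseteq> cball z (diameter k)) \<and>
     emeasure surf (frontier k) \<le> ennreal (real m * frontier_const CARD('n) * diameter k ^ (CARD('n) - 1))"
    using admissible_mesh_ball[OF dom(3) mconst(1-3), of m Cq] by blast
  obtain N where N: "\<forall>K k. admissible_mesh Om Cv m Cs \<rho> Cq K \<longrightarrow> k \<in> K \<longrightarrow>
     card {k'\<in>K. closure k \<inter> closure k' \<noteq> {}} \<le> N"
    using admissible_mesh_neighbours[OF dom(3) mconst(1,4), of m Cs \<rho>] by blast
  obtain Ci where Ci: "Ci > 0" and inv: "\<forall>(q :: real^'n \<Rightarrow> real) z h k x. poly_le p q \<longrightarrow> h > 0 \<longrightarrow> open k \<longrightarrow> bounded k \<longrightarrow>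
     ball z (c1 * h) \<subseteq> k \<longrightarrow> x \<in> cball z h \<longrightarrow>
     (norm (grad q x))\<^sup>2 \<le> Ci / h ^ CARD('n) * set_lebesgue_integral lborel k (\<lambda>x. grad q x \<bullet> grad q x)"
    using gradient_inverse_estimate[OF c1, of p] by blast
  define Cf where "Cf = real m * frontier_const CARD('n)"
  have Cf: "Cf \<ge> 0"
    unfolding Cf_def frontier_const_def by (intro mult_nonneg_nonneg hausdorff_const_nonneg) auto
  define Q where "Q = real (N + 2) * Cf * Ci"
  have Q: "Q \<ge> 0" unfolding Q_def using Cf Ci by simp
  \<comment> \<open>The consistency bound carries the factor \<open>Q / (2 * \<beta>)\<close>, which
    must not exceed 1/4, that is \<open>\<beta> \<ge> 2 * Q\<close>; the added 1 makes the threshold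
    positive.\<close>
  define \<beta>0 where "\<beta>0 = 2 * Q + 1"
  have b0: "\<beta>0 > 0" using Q by (simp add: \<beta>0_def)
  have Cpos: "4 / (1 - \<gamma>) > 0" using gam by simp
  show ?thesis
  proof (rule exI[of _ \<beta>0], rule conjI[OF b0], rule exI[of _ "4 / (1 - \<gamma>)"], rule conjI[OF Cpos], intro allI impI)
    fix K and c b T a0 a1 :: real and al psi0 psi1 and \<beta> :: real
    assume adm: "admissible_mesh Om Cv m Cs \<rho> Cq K" and c: "c > 0" and b: "b \<ge> 0" and T: "T > 0"
      and a: "a0 > 0" "a1 > 0" and al: "C1Vh p K T al"
      and alb: "\<forall>t\<in>{0..T}. \<forall>k\<in>K. \<forall>x\<in>closure k. a0 \<le> al t k x \<and> al t k x \<le> a1"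
      and var: "integral {0..T} (\<lambda>t. SUP kx\<in>(SIGMA k:K. k). \<bar>tder T al t (fst kx) (snd kx) / al t (fst kx) (snd kx)\<bar>) \<le> \<gamma>"
      and psi: "Vh p K psi0" "Vh p K psi1" and beta: "\<beta> \<ge> \<beta>0"
    note aD = admissible_meshD[OF adm]
    have fr: "emeasure surf (frontier k) \<le> ennreal (Cf * diameter k ^ (CARD('n) - 1))" if "k \<in> K" for k
      using ball adm that unfolding Cf_def by blast
    have el': "open k" "k \<noteq> {}" "k \<subseteq> Om" if "k \<in> K" for k using aD that by simp_all
    have kb: "bounded k" if "k \<in> K" for k by (rule bounded_subset[OF dom(3) el'(3)[OF that]])
    have disj: "k1 \<inter> k2 = {}" if "k1 \<in> K" "k2 \<in> K" "k1 \<noteq> k2" for k1 k2 using aD that by simp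
    have fin: "finite K" using aD by simp
    have ff: "emeasure surf (frontier k) < \<infinity>" if "k \<in> K" for k
      using fr[OF that] by (rule order_le_less_trans) simp
    interpret dg_mesh Om K p
      by (rule dg_mesh.intro) (fact fin dom(1) el' kb disj ff)+
    have "\<beta> > 0" using beta b0 by linarith
    have cb: "\<bar>cons_form c u u\<bar> \<le> (c\<^sup>2 * grad_ip K u u + pen_form c \<beta> u u) / 4" if u: "Vh p K u" for u
    proof -
      have "\<bar>cons_form c u u\<bar> \<le> pen_form c \<beta> u u / 4 + real (N + 2) * Cf * Ci / (2 * \<beta>) * (c\<^sup>2 * grad_ip K u u)"
      proof (rule cons_form_le[OF p c \<open>\<beta> > 0\<close> u u _ _ Cf fr])
        fix k x assume k: "k \<in> K" and x: "x \<in> closure k"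
        obtain z where z: "ball z (c1 * diameter k) \<subseteq> k" "closure k \<subseteq> cball z (diameter k)" and h: "diameter k > 0"
          using ball adm k by blast
        have "poly_le p (u k)" using u k by (simp add: Vh_def)
        moreover have "x \<in> cball z (diameter k)" using z(2) x by blast
        ultimately show "(norm (grad (u k) x))\<^sup>2
            \<le> Ci / diameter k ^ CARD('n) * set_lebesgue_integral lborel k (\<lambda>x. grad (u k) x \<bullet> grad (u k) x)"
          using inv h el(1)[OF k] el(3)[OF k] z(1) by blast
      qed (use Ci N adm in auto)
      also have "real (N + 2) * Cf * Ci / (2 * \<beta>) * (c\<^sup>2 * grad_ip K u u) \<le> 1 / 4 * (c\<^sup>2 * grad_ip K u u)"
      proof (rule mult_right_mono)
        have "4 * Q \<le> 2 * \<beta>" using beta by (simp add: \<beta>0_def)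
        then show "real (N + 2) * Cf * Ci / (2 * \<beta>) \<le> 1 / 4"
          using \<open>\<beta> > 0\<close> unfolding Q_def[symmetric] by (simp add: field_simps)
        show "0 \<le> c\<^sup>2 * grad_ip K u u" using grad_ip_nonneg by simp
      qed
      finally show ?thesis by (simp add: add_divide_distrib)
    qed
    have "K \<noteq> {}" using adm by (simp add: admissible_mesh_def)
    interpret dg_wave Om K p c b \<beta> T a0 \<gamma> al
      by unfold_locales (use \<open>K \<noteq> {}\<close> c b \<open>\<beta> > 0\<close> T a(1) al alb var gam(2) cb in auto)
    show "(\<exists>psi. is_solution p Om K c b \<beta> T al psi0 psi1 psi) \<and>
      (\<forall>psi phi. is_solution p Om K c b \<beta> T al psi0 psi1 psi \<longrightarrow>
                 is_solution p Om K c b \<beta> T al psi0 psi1 phi \<longrightarrow>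
                 (\<forall>t\<in>{0..T}. \<forall>k\<in>K. psi t k = phi t k)) \<and>
      (\<forall>psi. is_solution p Om K c b \<beta> T al psi0 psi1 psi \<longrightarrow>
         (\<forall>t\<in>{0..T}. energy p Om K c b \<beta> T al psi t \<le> 4 / (1 - \<gamma>) * energy p Om K c b \<beta> T al psi 0))"
    proof (intro conjI allI impI ballI)
      show "\<exists>psi. is_solution p Om K c b \<beta> T al psi0 psi1 psi" by (rule solution_exists[OF psi])
    next
      fix psi phi t k
      assume "is_solution p Om K c b \<beta> T al psi0 psi1 psi" "is_solution p Om K c b \<beta> T al psi0 psi1 phi"
        "t \<in> {0..T}" "k \<in> K"
      then show "psi t k = phi t k" by (rule solution_unique)
    next
      fix psi t assume "is_solution p Om K c b \<beta> T al psi0 psi1 psi" "t \<in> {0..T}"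
      then show "energy p Om K c b \<beta> T al psi t \<le> 4 / (1 - \<gamma>) * energy p Om K c b \<beta> T al psi 0"
        by (rule energy_estimate)
    qed
  qed
qed

end
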